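(* Consider the linearly constrained problem (P) of the context under its assumptions. Let $\varepsilon>0$ satisfy $\varepsilon\le\|A\|^2/L_f$. In the I-FALM algorithm (defined in the context) choose $\rho=L_f/\|A\|^2$, $\varepsilon_0=\rho^{-1}$, $\sigma=1/4$, $\gamma_p=\varepsilon/(2D)$, $\gamma_d=\sigma^{3/2}\varepsilon/(\sqrt3\,\mathcal R)$, where $$\mathcal R:=\hat R_{\tilde\Lambda}\,(1+\sqrt{2\varepsilon_0C})\left(\frac2{\sqrt{1-\sigma}}+1\right),\qquad \hat R_{\tilde\Lambda}:=\max\{1,\|\tilde\lambda_*-\lambda_0\|\},\qquad C:=\sum_{i=0}^\infty B_{i+1}\alpha^i<\infty,$$ with $\tilde\lambda_*$ the unique maximizer of the perturbed dual $\tilde d$ and $B_i$ the scalars generated by the algorithm. Furthermore, assume $\alpha$ satisfies $$\alpha\le\min\left\{\frac9{10}(1+\sqrt{\rho\gamma_d})^{-2},\ \left(\frac{15D\varepsilon}{28\varepsilon_0}\right)^{\sqrt{\rho\varepsilon/D}}\right\}.$$ Then I-FALM finds an $\varepsilon$-primal-dual solution to (P) in $$\tilde{\mathcal O}\left(1+\frac{\sqrt{D^2+D\hat R_\Lambda}\,\|A\|}{\varepsilon}+\frac{\sqrt{D+\hat R_\Lambda}\,\|A\|}{\sqrt{L_f\varepsilon}}+\frac{\sqrt{DL_f}}{\sqrt\varepsilon}\right)$$ total ACG iterations, where $\hat R_\Lambda=\max\{1,\|\lambda_*-\lambda_0\|\}$, $\lambda_*=\operatorname{argmin}\{\|\lambda-\lambda_0\|:\lambda\in\Lambda_*\}$,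 and $\Lambda_*$ is the set of maximizers of the dual function $d$.
   Context: Problem (P): $\hat\phi_*=\min\{\phi(x):=f(x)+h(x):Ax=b\}$, $A\in\mathbb{R}^{m\times n}$, $b\in\mathbb{R}^m$, $m\le n$. Assumptions: $f$ is proper closed convex and $L_f$-smooth on $\mathbb{R}^n$ ($\nabla f$ is $L_f$-Lipschitz), $L_f>0$; $h$ is proper closed convex with computable proximal mapping, $\operatorname{dom}h\subset\operatorname{dom}f$; $\operatorname{relint}(\operatorname{dom}h)\cap\{x:Ax=b\}\neq\emptyset$; $\operatorname{dom}h$ is bounded with diameter $D\ge1$. $\|A\|$ is the spectral norm. Lagrangian $\mathcal L(x,\lambda)=\phi(x)+\langle\lambda,Ax-b\rangle$; dual $d(\lambda)=\min_x\mathcal L(x,\lambda)$. $(x,\lambda)$ is an $\varepsilon$-primal-dual solution if there is $v\in\partial h(x)+\nabla f(x)+A^\top\lambda$ with $\|v\|\le\varepsilon$, and $\|Ax-b\|\le\varepsilon$. Perturbed functions ($x_0\in\operatorname{dom}h$ and $\lambda_0$ the initial points): $\tilde{\mathcal L}(x,\lambda)=\mathcal L(x,\lambda)+\frac{\gamma_p}2\|x-x_0\|^2-\frac{\gamma_d}2\|\lambda-\lambda_0\|^2$, $\tilde{\mathcal L}_\rho(x,\lambda)=\tilde{\mathcal L}(x,\lambda)+\frac\rho2\|Ax-b\|^2$, $\tilde d(\lambda)=\min_x\tilde{\mathcal L}(x,\lambda)$ (which is $\gamma_d$-strongly concave), $\Psi^{\gamma_p}_\lambda(x)=f(x)+\frac{\gamma_p}2\|x-x_0\|^2+\langle\lambda,Ax-b\rangle+\frac\rho2\|Ax-b\|^2$;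 $M_\rho=L_f+\rho\|A\|^2$. Gradient mapping: for $F=s+h$ with $s$ smooth, $\mathcal G_F^\eta(x)=\frac1\eta\big(x-\operatorname{prox}_{\eta h}(x-\eta\nabla s(x))\big)$, where $\operatorname{prox}_{\eta h}(z)=\operatorname{argmin}_y\{\eta h(y)+\frac12\|z-y\|^2\}$. For $\tilde{\mathcal L}_\rho(\cdot,\lambda)$ the smooth part is $\Psi^{\gamma_p}_\lambda$ (up to a constant). ACG, applied to $\psi=g+h$ ($g$ $\mu$-strongly convex, $(L+\mu)$-smooth) from $p_0$: $S_0=0$, $\theta_0=1$, $q_0=p_0$; iteration $j=0,1,\dots$: $s_j=\frac{\theta_j+\sqrt{\theta_j^2+8\theta_jS_jL}}{4L}$, $S_{j+1}=S_j+s_j$, $\theta_{j+1}=\theta_j+\mu s_j$, $\tilde p_j=\frac{S_j}{S_{j+1}}q_j+\frac{s_j}{S_{j+1}}p_j$; $\tilde q_{j+1}=\operatorname{argmin}_u\{g(\tilde p_j)+\langle\nabla g(\tilde p_j),u-\tilde p_j\rangle+h(u)+\frac{2L+\mu}2\|u-\tilde p_j\|^2\}$; $q_{j+1}$ is a point of $\{q_j,\tilde q_{j+1}\}$ with smallest $\psi$-value; $p_{j+1}=\frac{(2L+\mu)s_j\tilde q_{j+1}-\frac{2S_js_jL}{S_{j+1}}q_j}{S_{j+1}\mu+1}$. I-FALM. Input $x_0\in\operatorname{dom}h$, $\rho>0$, $\gamma_d>0$, $\varepsilon>0$, $\varepsilon_0\ge\varepsilon$; $B_0=0$, $\tau_0=1$,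 $\gamma_p=\varepsilon/(2D)$, $\lambda_0=\nu_0=0$; $\sigma\in(0,1)$ with $4\sigma\rho\varepsilon\le1$; $0\le\alpha<(1+\sqrt{\gamma_d\rho})^{-2}$. For $k=0,1,\dots$: 1. Set $\varepsilon_k=(7\varepsilon_0\alpha^k+\sigma\rho\varepsilon^2)/8$ (with $\varepsilon_0$ on the right the input), $b_k=\frac{\rho\tau_k+\sqrt{\rho^2\tau_k^2+4\rho\tau_kB_k}}2$, $B_{k+1}=B_k+b_k$, $\tau_{k+1}=\tau_k+b_k\gamma_d$, $\tilde\nu_k=\frac{B_k}{B_{k+1}}\lambda_k+\frac{b_k}{B_{k+1}}\nu_k$. 2. Run ACG from $p_0=x_k$ with $\psi=\tilde{\mathcal L}_\rho(\cdot,\tilde\nu_k)+\frac{\varepsilon_k}{8D^2}\|\cdot-x_k\|^2$, $g=\Psi^{\gamma_p}_{\tilde\nu_k}+\frac{\varepsilon_k}{8D^2}\|\cdot-x_k\|^2$, $L=M_\rho$, $\mu=\gamma_p+\frac{\varepsilon_k}{4D^2}$, until one of its points $\tilde x_k:=\tilde p_j$ satisfies $\|\mathcal G^{(2L+\mu)^{-1}}_{\tilde{\mathcal L}_\rho(\cdot,\tilde\nu_k)}(\tilde x_k)\|\le\varepsilon_k/(2D)$. Set $x_{k+1}=\tilde x_k-(2L+\mu)^{-1}\mathcal G^{(2L+\mu)^{-1}}_{\tilde{\mathcal L}_\rho(\cdot,\tilde\nu_k)}(\tilde x_k)$. 3. $\lambda_{k+1}=\tilde\nu_k+\rho(Ax_{k+1}-b)$.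 4. If $\|\mathcal G^{(2L+\mu)^{-1}}_{\tilde{\mathcal L}_\rho(\cdot,\tilde\nu_k)}(\tilde x_k)\|\le\varepsilon/4$ and $\|Ax_{k+1}-b\|\le\varepsilon$, return $(x_{k+1},\lambda_{k+1})$ and terminate; otherwise $\nu_{k+1}=\frac1{\tau_{k+1}}\Big(\tau_k\nu_k+b_k\gamma_d\frac{\lambda_{k+1}}{1+\gamma_d\rho}-\frac{b_k}\rho\big(\tilde\nu_k-\frac{\lambda_{k+1}}{1+\gamma_d\rho}\big)\Big)$. Note that $\mathcal R$ depends on $\gamma_d$ and $\alpha$; the hypotheses are that $\gamma_d,\alpha$ satisfy the stated relations. $\tilde{\mathcal O}$ suppresses absolute constants and logarithmic factors in the problem and algorithm parameters. *)

theory Defs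
  imports "HOL-Analysis.Analysis"
begin

section \<open>The spaces \<open>\<real>\<^sup>n\<close> for variable \<open>n\<close>\<close>

text \<open>
  The constants hidden in a complexity bound must not depend on the dimensions, so \<open>n\<close> and \<open>m\<close>
  have to be quantified inside the statement, which excludes the type \<open>real ^ 'n\<close>.
  All vectors live in the inner product space of finitely supported real sequences, and \<open>\<real>\<^sup>n\<close> is
  its subspace of sequences that vanish from index \<open>n\<close> on.
\<close>

typedef fvec = "{x :: nat \<Rightarrow> real. finite {i. x i \<noteq> 0}}"
  morphisms coord Abs_fvec
  by (rule exI[of _ "\<lambda>_. 0"]) simp

setup_lifting type_definition_fvec

lemma finite_coord [simp]: "finite {i. coord x i \<noteq> 0}"
  using coord[of x] by simp

lemma fvec_eqI: "(\<And>i. coord x i = coord y i) \<Longrightarrow> x = y"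
  by (metis coord_inject ext)

instantiation fvec :: real_vector
begin

lift_definition zero_fvec :: fvec is "\<lambda>_. 0" by simp

lift_definition plus_fvec :: "fvec \<Rightarrow> fvec \<Rightarrow> fvec" is "\<lambda>x y i. x i + y i"
proof -
  fix x y :: "nat \<Rightarrow> real"
  assume "finite {i. x i \<noteq> 0}" "finite {i. y i \<noteq> 0}"
  then show "finite {i. x i + y i \<noteq> 0}"
    by (rule finite_subset[rotated, OF finite_UnI]) auto
qed

lift_definition minus_fvec :: "fvec \<Rightarrow> fvec \<Rightarrow> fvec" is "\<lambda>x y i. x i - y i"
proof -
  fix x y :: "nat \<Rightarrow> real"
  assume "finite {i. x i \<noteq> 0}" "finite {i. y i \<noteq> 0}"
  then show "finite {i. x i - y i \<noteq> 0}"
    by (rule finite_subset[rotated, OF finite_UnI]) auto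
qed

lift_definition uminus_fvec :: "fvec \<Rightarrow> fvec" is "\<lambda>x i. - x i" by simp

lift_definition scaleR_fvec :: "real \<Rightarrow> fvec \<Rightarrow> fvec" is "\<lambda>c x i. c * x i" by simp

instance
  by standard (transfer; simp add: algebra_simps fun_eq_iff)+

end

lemmas coord_simps [simp] =
  zero_fvec.rep_eq plus_fvec.rep_eq minus_fvec.rep_eq uminus_fvec.rep_eq scaleR_fvec.rep_eq

instantiation fvec :: real_inner
begin

definition inner_fvec :: "fvec \<Rightarrow> fvec \<Rightarrow> real"
  where "inner_fvec x y = (\<Sum>i | coord x i \<noteq> 0. coord x i * coord y i)"

definition norm_fvec :: "fvec \<Rightarrow> real"
  where "norm_fvec x = sqrt (inner x x)"

definition sgn_fvec :: "fvec \<Rightarrow> fvec"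
  where "sgn_fvec x = x /\<^sub>R norm x"

definition dist_fvec :: "fvec \<Rightarrow> fvec \<Rightarrow> real"
  where "dist_fvec x y = norm (x - y)"

definition uniformity_fvec :: "(fvec \<times> fvec) filter"
  where "uniformity_fvec = (INF e\<in>{0<..}. principal {(x, y). dist x y < e})"

definition open_fvec :: "fvec set \<Rightarrow> bool"
  where "open_fvec U \<longleftrightarrow> (\<forall>x\<in>U. eventually (\<lambda>(x', y). x' = x \<longrightarrow> y \<in> U) uniformity)"

lemma inner_fvec_superset:
  assumes "finite I" "{i. coord x i \<noteq> 0} \<subseteq> I"
  shows "inner x y = (\<Sum>i\<in>I. coord x i * coord y i)"
  unfolding inner_fvec_def by (rule sum.mono_neutral_left) (use assms in auto)

instance
proof
  fix x y z :: fvec and r :: real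
  let ?I = "{i. coord x i \<noteq> 0} \<union> {i. coord y i \<noteq> 0}"
  have fin: "finite ?I" by simp
  show "dist x y = norm (x - y)" by (rule dist_fvec_def)
  show "sgn x = x /\<^sub>R norm x" by (rule sgn_fvec_def)
  show "uniformity = (INF e\<in>{0<..}. principal {(x, y::fvec). dist x y < e})"
    by (rule uniformity_fvec_def)
  show "open U = (\<forall>x\<in>U. \<forall>\<^sub>F (x', y) in uniformity. x' = x \<longrightarrow> y \<in> U)" for U :: "fvec set"
    by (rule open_fvec_def)
  show "inner x y = inner y x"
    using inner_fvec_superset[OF fin, of x y] inner_fvec_superset[OF fin, of y x]
    by (simp add: mult.commute)
  show "inner (x + y) z = inner x z + inner y z"
    using inner_fvec_superset[OF fin, of x z] inner_fvec_superset[OF fin, of y z]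
      inner_fvec_superset[OF fin, of "x + y" z]
    by (simp add: distrib_right sum.distrib subset_iff)
  show "inner (r *\<^sub>R x) y = r * inner x y"
    using inner_fvec_superset[OF fin, of x y] inner_fvec_superset[OF fin, of "r *\<^sub>R x" y]
    by (auto simp: sum_distrib_left mult.assoc)
  show "0 \<le> inner x x" unfolding inner_fvec_def by (simp add: sum_nonneg)
  show "(inner x x = 0) = (x = 0)"
  proof
    assume "inner x x = 0"
    then have "\<forall>i \<in> {i. coord x i \<noteq> 0}. coord x i * coord x i = 0"
      unfolding inner_fvec_def by (subst (asm) sum_nonneg_eq_0_iff) auto
    then show "x = 0" by (intro fvec_eqI) auto
  next
    assume "x = 0"
    then show "inner x x = 0" unfolding inner_fvec_def by simp
  qed
  show "norm x = sqrt (inner x x)" by (rule norm_fvec_def)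
qed

end

definition Rn :: "nat \<Rightarrow> fvec set"
  where "Rn n = {x. \<forall>i\<ge>n. coord x i = 0}"

lift_definition of_coords :: "nat \<Rightarrow> (nat \<Rightarrow> real) \<Rightarrow> fvec" is "\<lambda>n a i. if i < n then a i else 0"
  by simp

text \<open>Only the entries \<open>A i j\<close> with \<open>i < m\<close> and \<open>j < n\<close> of an \<open>m \<times> n\<close> matrix are used.\<close>

definition mat_vec :: "nat \<Rightarrow> nat \<Rightarrow> (nat \<Rightarrow> nat \<Rightarrow> real) \<Rightarrow> fvec \<Rightarrow> fvec"
  where "mat_vec m n A x = of_coords m (\<lambda>i. \<Sum>j<n. A i j * coord x j)"


section \<open>Convex analysis on \<open>\<real>\<^sup>n\<close>\<close>

definition has_grad :: "nat \<Rightarrow> (fvec \<Rightarrow> real) \<Rightarrow> fvec \<Rightarrow> fvec \<Rightarrow> bool"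
  where "has_grad n s x v \<longleftrightarrow> v \<in> Rn n \<and> (s has_derivative (\<lambda>u. inner v u)) (at x within Rn n)"

definition grad :: "nat \<Rightarrow> (fvec \<Rightarrow> real) \<Rightarrow> fvec \<Rightarrow> fvec"
  where "grad n s x = (THE v. has_grad n s x v)"

definition smooth :: "nat \<Rightarrow> real \<Rightarrow> (fvec \<Rightarrow> real) \<Rightarrow> bool"
  where "smooth n L s \<longleftrightarrow> (\<forall>x\<in>Rn n. \<exists>v. has_grad n s x v) \<and> L-lipschitz_on (Rn n) (grad n s)"

definition eff_dom :: "nat \<Rightarrow> (fvec \<Rightarrow> ereal) \<Rightarrow> fvec set"
  where "eff_dom n h = {x \<in> Rn n. h x < \<infinity>}"

definition epi :: "nat \<Rightarrow> (fvec \<Rightarrow> ereal) \<Rightarrow> (fvec \<times> real) set"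
  where "epi n h = {(x, t). x \<in> Rn n \<and> h x \<le> ereal t}"

definition proper_closed_convex :: "nat \<Rightarrow> (fvec \<Rightarrow> ereal) \<Rightarrow> bool"
  where "proper_closed_convex n h \<longleftrightarrow>
    (\<forall>x\<in>Rn n. h x \<noteq> - \<infinity>) \<and> eff_dom n h \<noteq> {} \<and> closed (epi n h) \<and> convex (epi n h)"

definition subdiff :: "nat \<Rightarrow> (fvec \<Rightarrow> ereal) \<Rightarrow> fvec \<Rightarrow> fvec set"
  where "subdiff n h x =
    {v \<in> Rn n. x \<in> eff_dom n h \<and> (\<forall>y\<in>Rn n. h x + ereal (inner v (y - x)) \<le> h y)}"

definition prox :: "nat \<Rightarrow> real \<Rightarrow> (fvec \<Rightarrow> ereal) \<Rightarrow> fvec \<Rightarrow> fvec"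
  where "prox n \<eta> h z = arg_min_on (\<lambda>y. ereal \<eta> * h y + ereal (1/2 * (norm (z - y))\<^sup>2)) (Rn n)"

definition grad_map ::
    "nat \<Rightarrow> (fvec \<Rightarrow> ereal) \<Rightarrow> (fvec \<Rightarrow> real) \<Rightarrow> real \<Rightarrow> fvec \<Rightarrow> fvec"
  where "grad_map n h s \<eta> x = (1/\<eta>) *\<^sub>R (x - prox n \<eta> h (x - \<eta> *\<^sub>R grad n s x))"


section \<open>The linearly constrained problem\<close>

record problem =
  nvar :: nat
  ncon :: nat
  fobj :: "fvec \<Rightarrow> real"
  hobj :: "fvec \<Rightarrow> ereal"
  Lf   :: real
  matA :: "nat \<Rightarrow> nat \<Rightarrow> real"
  rhs  :: fvec

abbreviation Xsp :: "problem \<Rightarrow> fvec set" where "Xsp P \<equiv> Rn (nvar P)"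
abbreviation Ysp :: "problem \<Rightarrow> fvec set" where "Ysp P \<equiv> Rn (ncon P)"

definition appA :: "problem \<Rightarrow> fvec \<Rightarrow> fvec"
  where "appA P x = mat_vec (ncon P) (nvar P) (matA P) x"

definition appAT :: "problem \<Rightarrow> fvec \<Rightarrow> fvec"
  where "appAT P y = mat_vec (nvar P) (ncon P) (\<lambda>j i. matA P i j) y"

definition resid :: "problem \<Rightarrow> fvec \<Rightarrow> fvec"
  where "resid P x = appA P x - rhs P"

definition normA :: "problem \<Rightarrow> real"
  where "normA P = onorm (appA P)"

definition domh :: "problem \<Rightarrow> fvec set"
  where "domh P = eff_dom (nvar P) (hobj P)"

definition diam :: "problem \<Rightarrow> real"
  where "diam P = diameter (domh P)"

text \<open>
  Since \<open>f\<close> is smooth on all of \<open>\<real>\<^sup>n\<close> it is real-valued; then it is automatically proper and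
  closed, and \<open>dom h \<subseteq> dom f = \<real>\<^sup>n\<close>.
\<close>

definition standing_assms :: "problem \<Rightarrow> bool"
  where "standing_assms P \<longleftrightarrow>
    ncon P \<le> nvar P \<and> rhs P \<in> Ysp P \<and>
    Lf P > 0 \<and> convex_on (Xsp P) (fobj P) \<and> smooth (nvar P) (Lf P) (fobj P) \<and>
    proper_closed_convex (nvar P) (hobj P) \<and>
    rel_interior (domh P) \<inter> {x \<in> Xsp P. appA P x = rhs P} \<noteq> {} \<and>
    bounded (domh P) \<and> diam P \<ge> 1"

definition phi :: "problem \<Rightarrow> fvec \<Rightarrow> ereal"
  where "phi P x = ereal (fobj P x) + hobj P x"

definition lagr :: "problem \<Rightarrow> fvec \<Rightarrow> fvec \<Rightarrow> ereal"
  where "lagr P x l = phi P x + ereal (inner l (resid P x))"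

definition dual :: "problem \<Rightarrow> fvec \<Rightarrow> ereal"
  where "dual P l = (INF x\<in>Xsp P. lagr P x l)"

definition dual_solutions :: "problem \<Rightarrow> fvec set"
  where "dual_solutions P = {l \<in> Ysp P. \<forall>l'\<in>Ysp P. dual P l' \<le> dual P l}"

definition primal_dual_solution :: "problem \<Rightarrow> real \<Rightarrow> fvec \<Rightarrow> fvec \<Rightarrow> bool"
  where "primal_dual_solution P \<epsilon> x l \<longleftrightarrow> x \<in> Xsp P \<and> l \<in> Ysp P \<and>
    (\<exists>v \<in> {w + grad (nvar P) (fobj P) x + appAT P l | w. w \<in> subdiff (nvar P) (hobj P) x}.
       norm v \<le> \<epsilon>) \<and>
    norm (resid P x) \<le> \<epsilon>"


section \<open>The accelerated composite gradient method (ACG)\<close>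

record acg_state =
  acgS :: real
  acg_theta :: real
  acg_p :: fvec
  acg_q :: fvec

definition acg_s :: "real \<Rightarrow> acg_state \<Rightarrow> real"
  where "acg_s L st =
    (acg_theta st + sqrt ((acg_theta st)\<^sup>2 + 8 * acg_theta st * acgS st * L)) / (4 * L)"

definition acg_S' :: "real \<Rightarrow> acg_state \<Rightarrow> real"
  where "acg_S' L st = acgS st + acg_s L st"

definition acg_ptilde :: "real \<Rightarrow> acg_state \<Rightarrow> fvec"
  where "acg_ptilde L st =
    (acgS st / acg_S' L st) *\<^sub>R acg_q st + (acg_s L st / acg_S' L st) *\<^sub>R acg_p st"

definition acg_qtilde ::
    "nat \<Rightarrow> (fvec \<Rightarrow> ereal) \<Rightarrow> (fvec \<Rightarrow> real) \<Rightarrow> real \<Rightarrow> real \<Rightarrow> acg_state \<Rightarrow> fvec"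
  where "acg_qtilde n h g L \<mu> st = (let pt = acg_ptilde L st in
    arg_min_on (\<lambda>u. ereal (g pt + inner (grad n g pt) (u - pt)) + h u
                    + ereal ((2 * L + \<mu>) / 2 * (norm (u - pt))\<^sup>2)) (Rn n))"

text \<open>
  A step is a relation because the choice of \<open>q\<close> is free when both candidates have the same
  \<open>\<psi>\<close>-value.
\<close>

definition acg_step ::
    "nat \<Rightarrow> (fvec \<Rightarrow> ereal) \<Rightarrow> (fvec \<Rightarrow> ereal) \<Rightarrow> (fvec \<Rightarrow> real) \<Rightarrow> real \<Rightarrow> real \<Rightarrow>
     acg_state \<Rightarrow> acg_state \<Rightarrow> bool"
  where "acg_step n \<psi> h g L \<mu> st st' \<longleftrightarrow>
    (let s = acg_s L st; S' = acg_S' L st; qt = acg_qtilde n h g L \<mu> st in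
      acgS st' = S' \<and>
      acg_theta st' = acg_theta st + \<mu> * s \<and>
      acg_q st' \<in> {acg_q st, qt} \<and> \<psi> (acg_q st') = min (\<psi> (acg_q st)) (\<psi> qt) \<and>
      acg_p st' = (1 / (S' * \<mu> + 1)) *\<^sub>R
        (((2 * L + \<mu>) * s) *\<^sub>R qt - (2 * acgS st * s * L / S') *\<^sub>R acg_q st))"

definition acg_run ::
    "nat \<Rightarrow> (fvec \<Rightarrow> ereal) \<Rightarrow> (fvec \<Rightarrow> ereal) \<Rightarrow> (fvec \<Rightarrow> real) \<Rightarrow> real \<Rightarrow> real \<Rightarrow>
     fvec \<Rightarrow> (nat \<Rightarrow> acg_state) \<Rightarrow> bool"
  where "acg_run n \<psi> h g L \<mu> p0 st \<longleftrightarrow>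
    st 0 = \<lparr>acgS = 0, acg_theta = 1, acg_p = p0, acg_q = p0\<rparr> \<and>
    (\<forall>j. acg_step n \<psi> h g L \<mu> (st j) (st (Suc j)))"


section \<open>I-FALM\<close>

record params =
  xinit :: fvec
  linit :: fvec
  rho   :: real
  gam_p :: real
  gam_d :: real
  eps   :: real
  eps0  :: real
  sig :: real
  alpha :: real

definition ifalm_input :: "problem \<Rightarrow> params \<Rightarrow> bool"
  where "ifalm_input P M \<longleftrightarrow>
    xinit M \<in> domh P \<and> linit M = 0 \<and> rho M > 0 \<and> gam_d M > 0 \<and>
    eps M > 0 \<and> eps0 M \<ge> eps M \<and> gam_p M = eps M / (2 * diam P) \<and>
    0 < sig M \<and> sig M < 1 \<and> 4 * sig M * rho M * eps M \<le> 1 \<and>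
    0 \<le> alpha M \<and> alpha M < 1 / (1 + sqrt (gam_d M * rho M))\<^sup>2"

definition lagr_pert :: "problem \<Rightarrow> params \<Rightarrow> fvec \<Rightarrow> fvec \<Rightarrow> ereal"
  where "lagr_pert P M x l = lagr P x l +
    ereal (gam_p M / 2 * (norm (x - xinit M))\<^sup>2 - gam_d M / 2 * (norm (l - linit M))\<^sup>2)"

definition auglagr_pert :: "problem \<Rightarrow> params \<Rightarrow> fvec \<Rightarrow> fvec \<Rightarrow> ereal"
  where "auglagr_pert P M x l = lagr_pert P M x l + ereal (rho M / 2 * (norm (resid P x))\<^sup>2)"

definition dual_pert :: "problem \<Rightarrow> params \<Rightarrow> fvec \<Rightarrow> ereal"
  where "dual_pert P M l = (INF x\<in>Xsp P. lagr_pert P M x l)"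

definition Psi :: "problem \<Rightarrow> params \<Rightarrow> fvec \<Rightarrow> fvec \<Rightarrow> real"
  where "Psi P M l x = fobj P x + gam_p M / 2 * (norm (x - xinit M))\<^sup>2
    + inner l (resid P x) + rho M / 2 * (norm (resid P x))\<^sup>2"

definition M_rho :: "problem \<Rightarrow> params \<Rightarrow> real"
  where "M_rho P M = Lf P + rho M * (normA P)\<^sup>2"

definition b_next :: "real \<Rightarrow> real \<Rightarrow> real \<Rightarrow> real"
  where "b_next r t B = (r * t + sqrt (r\<^sup>2 * t\<^sup>2 + 4 * r * t * B)) / 2"

fun Bk :: "params \<Rightarrow> nat \<Rightarrow> real" and tauk :: "params \<Rightarrow> nat \<Rightarrow> real" where
  "Bk M 0 = 0"
| "Bk M (Suc k) = Bk M k + b_next (rho M) (tauk M k) (Bk M k)"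
| "tauk M 0 = 1"
| "tauk M (Suc k) = tauk M k + b_next (rho M) (tauk M k) (Bk M k) * gam_d M"

definition bk :: "params \<Rightarrow> nat \<Rightarrow> real"
  where "bk M k = b_next (rho M) (tauk M k) (Bk M k)"

definition eps_k :: "params \<Rightarrow> nat \<Rightarrow> real"
  where "eps_k M k = (7 * eps0 M * alpha M ^ k + sig M * rho M * (eps M)\<^sup>2) / 8"

definition mu_k :: "problem \<Rightarrow> params \<Rightarrow> nat \<Rightarrow> real"
  where "mu_k P M k = gam_p M + eps_k M k / (4 * (diam P)\<^sup>2)"

definition eta_k :: "problem \<Rightarrow> params \<Rightarrow> nat \<Rightarrow> real"
  where "eta_k P M k = 1 / (2 * M_rho P M + mu_k P M k)"

text \<open>The field \<open>acg_tr r k\<close> is the sequence of states of the \<open>k\<close>-th call of ACG.\<close>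

record run =
  xs :: "nat \<Rightarrow> fvec"
  lams :: "nat \<Rightarrow> fvec"
  nus :: "nat \<Rightarrow> fvec"
  acg_tr :: "nat \<Rightarrow> nat \<Rightarrow> acg_state"

definition nu_tilde :: "params \<Rightarrow> run \<Rightarrow> nat \<Rightarrow> fvec"
  where "nu_tilde M r k =
    (Bk M k / Bk M (Suc k)) *\<^sub>R lams r k + (bk M k / Bk M (Suc k)) *\<^sub>R nus r k"

definition sub_psi :: "problem \<Rightarrow> params \<Rightarrow> run \<Rightarrow> nat \<Rightarrow> fvec \<Rightarrow> ereal"
  where "sub_psi P M r k x = auglagr_pert P M x (nu_tilde M r k)
    + ereal (eps_k M k / (8 * (diam P)\<^sup>2) * (norm (x - xs r k))\<^sup>2)"

definition sub_g :: "problem \<Rightarrow> params \<Rightarrow> run \<Rightarrow> nat \<Rightarrow> fvec \<Rightarrow> real"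
  where "sub_g P M r k x = Psi P M (nu_tilde M r k) x
    + eps_k M k / (8 * (diam P)\<^sup>2) * (norm (x - xs r k))\<^sup>2"

definition sub_gm :: "problem \<Rightarrow> params \<Rightarrow> run \<Rightarrow> nat \<Rightarrow> fvec \<Rightarrow> fvec"
  where "sub_gm P M r k x =
    grad_map (nvar P) (hobj P) (Psi P M (nu_tilde M r k)) (eta_k P M k) x"

definition acg_stop :: "problem \<Rightarrow> params \<Rightarrow> run \<Rightarrow> nat \<Rightarrow> nat \<Rightarrow> bool"
  where "acg_stop P M r k j \<longleftrightarrow>
    norm (sub_gm P M r k (acg_ptilde (M_rho P M) (acg_tr r k j))) \<le> eps_k M k / (2 * diam P)"

definition acg_last :: "problem \<Rightarrow> params \<Rightarrow> run \<Rightarrow> nat \<Rightarrow> nat"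
  where "acg_last P M r k = (LEAST j. acg_stop P M r k j)"

definition x_tilde :: "problem \<Rightarrow> params \<Rightarrow> run \<Rightarrow> nat \<Rightarrow> fvec"
  where "x_tilde P M r k = acg_ptilde (M_rho P M) (acg_tr r k (acg_last P M r k))"

text \<open>
  The recursions of I-FALM, written for all \<open>k\<close>: the iterates computed by the algorithm are the
  initial segment up to the first \<open>k\<close> that passes the termination test, provided that all calls of
  ACG up to there stop.  Both provisos are part of \<open>ifalm_halts\<close>; \<open>acg_last\<close> is meaningful
  only for calls that stop.
\<close>

definition ifalm_run :: "problem \<Rightarrow> params \<Rightarrow> run \<Rightarrow> bool"
  where "ifalm_run P M r \<longleftrightarrow>
    xs r 0 = xinit M \<and> lams r 0 = linit M \<and> nus r 0 = linit M \<and>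
    (\<forall>k. acg_run (nvar P) (sub_psi P M r k) (hobj P) (sub_g P M r k) (M_rho P M) (mu_k P M k)
            (xs r k) (acg_tr r k) \<and>
         xs r (Suc k) = x_tilde P M r k - eta_k P M k *\<^sub>R sub_gm P M r k (x_tilde P M r k) \<and>
         lams r (Suc k) = nu_tilde M r k + rho M *\<^sub>R resid P (xs r (Suc k)) \<and>
         (let l' = (1 / (1 + gam_d M * rho M)) *\<^sub>R lams r (Suc k) in
          nus r (Suc k) = (1 / tauk M (Suc k)) *\<^sub>R
            (tauk M k *\<^sub>R nus r k + (bk M k * gam_d M) *\<^sub>R l'
             - (bk M k / rho M) *\<^sub>R (nu_tilde M r k - l'))))"

definition outer_stop :: "problem \<Rightarrow> params \<Rightarrow> run \<Rightarrow> nat \<Rightarrow> bool"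
  where "outer_stop P M r k \<longleftrightarrow>
    norm (sub_gm P M r k (x_tilde P M r k)) \<le> eps M / 4 \<and> norm (resid P (xs r (Suc k))) \<le> eps M"

definition ifalm_halts :: "problem \<Rightarrow> params \<Rightarrow> run \<Rightarrow> nat \<Rightarrow> bool"
  where "ifalm_halts P M r k \<longleftrightarrow>
    (\<forall>i\<le>k. \<exists>j. acg_stop P M r i j) \<and> (\<forall>i<k. \<not> outer_stop P M r i) \<and> outer_stop P M r k"

text \<open>A call of ACG that stops at \<open>j\<close>, counted from 0, has performed \<open>j + 1\<close> iterations.\<close>

definition total_acg :: "problem \<Rightarrow> params \<Rightarrow> run \<Rightarrow> nat \<Rightarrow> nat"
  where "total_acg P M r k = (\<Sum>i\<le>k. Suc (acg_last P M r i))"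


section \<open>Quantities of the complexity bound\<close>

definition C_const :: "params \<Rightarrow> real"
  where "C_const M = (\<Sum>i. Bk M (Suc i) * alpha M ^ i)"

definition Rhat :: "params \<Rightarrow> fvec \<Rightarrow> real"
  where "Rhat M l = max 1 (norm (l - linit M))"

definition R_const :: "params \<Rightarrow> fvec \<Rightarrow> real"
  where "R_const M lt =
    Rhat M lt * (1 + sqrt (2 * eps0 M * C_const M)) * (2 / sqrt (1 - sig M) + 1)"

definition is_unique_maximizer :: "fvec set \<Rightarrow> (fvec \<Rightarrow> ereal) \<Rightarrow> fvec \<Rightarrow> bool"
  where "is_unique_maximizer S d l \<longleftrightarrow> l \<in> S \<and> (\<forall>l'\<in>S. l' \<noteq> l \<longrightarrow> d l' < d l)"

definition complexity :: "problem \<Rightarrow> params \<Rightarrow> fvec \<Rightarrow> real"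
  where "complexity P M ls = 1
    + sqrt ((diam P)\<^sup>2 + diam P * Rhat M ls) * normA P / eps M
    + sqrt (diam P + Rhat M ls) * normA P / sqrt (Lf P * eps M)
    + sqrt (diam P * Lf P) / sqrt (eps M)"

text \<open>
  The notation \<open>\<O>\<close> with a tilde suppresses absolute constants and a fixed power of this logarithm.
  Under the assumptions its argument is at least 8, so that the factor exceeds 1.
\<close>

definition log_factor :: "problem \<Rightarrow> params \<Rightarrow> fvec \<Rightarrow> real"
  where "log_factor P M ls =
    ln (Lf P + 1 / Lf P + normA P + 1 / normA P + diam P + eps M + 1 / eps M + Rhat M ls)"

end

theory Submission
  imports Defs
begin

text \<open>
  Since the terms with \<open>\<lambda>\<^sub>k\<^sub>+\<^sub>1 / (1 + \<gamma>\<^sub>d \<rho>)\<close> cancel, the dual update reads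
  \<open>\<tau>\<^sub>k\<^sub>+\<^sub>1 \<nu>\<^sub>k\<^sub>+\<^sub>1 = \<tau>\<^sub>k \<nu>\<^sub>k + b\<^sub>k (A x\<^sub>k\<^sub>+\<^sub>1 - b)\<close>, and \<open>A x\<^sub>k\<^sub>+\<^sub>1 - b\<close> is an \<open>\<epsilon>\<^sub>k\<close>-supergradient at
  \<open>\<lambda>\<^sub>k\<^sub>+\<^sub>1\<close> of the part of the perturbed dual that does not contain the quadratic in \<open>\<lambda>\<close>.  The
  potential \<open>B\<^sub>k (d(\<lambda>\<^sub>*) - d(\<lambda>\<^sub>k)) + \<tau>\<^sub>k / 2 \<parallel>\<lambda>\<^sub>* - \<nu>\<^sub>k\<parallel>\<^sup>2\<close> is therefore nonincreasing up to inexactness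
  and an error proportional to \<open>\<rho> B\<^sub>k\<^sub>+\<^sub>1 \<gamma>\<^sub>d\<^sup>2 \<parallel>\<nu>\<^sub>k\<^sub>+\<^sub>1\<parallel>\<^sup>2\<close>, and each step gains
  \<open>\<rho> B\<^sub>k\<^sub>+\<^sub>1 / 2 \<parallel>A x\<^sub>k\<^sub>+\<^sub>1 - b\<parallel>\<^sup>2\<close>.  As \<open>\<gamma>\<^sub>d\<close> is small compared with \<open>\<epsilon> / \<R>\<close>, the error terms keep
  \<open>\<nu>\<^sub>k\<close> of size \<open>O(\<R>)\<close>, and the weighted mean of the squared residuals drops below \<open>\<epsilon>\<^sup>2\<close> once the
  geometrically growing weights \<open>B\<^sub>k\<close> dominate \<open>\<R>\<^sup>2 / (\<rho> \<epsilon>\<^sup>2)\<close>.  The standard potential of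
  accelerated gradient methods gives linear convergence of the inner points to the minimizer of the
  proximal subproblem, hence a logarithmic bound on the length of each inner run.  Finally
  \<open>\<epsilon>\<^sub>0 C\<close> is bounded by an absolute constant, because \<open>B\<^sub>i\<^sub>+\<^sub>1 \<alpha>\<^sup>i \<le> \<rho> (i + 1)\<^sup>2 (9 / 10)\<^sup>i\<close>, and comparing the
  two dual functions at their maximizers bounds \<open>\<R>\<close> by a multiple of the diameter plus the norm of
  the unperturbed dual solution.
\<close>


section \<open>The subspaces of finitely supported sequences\<close>

lemma subspace_Rn: "subspace (Rn n)"
  by (rule subspaceI) (auto simp: Rn_def)

lemmas Rn_simps [simp] = subspace_0[OF subspace_Rn]
lemmas Rn_intros [intro] = subspace_add[OF subspace_Rn] subspace_diff[OF subspace_Rn]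
  subspace_scale[OF subspace_Rn] subspace_neg[OF subspace_Rn]

lemma inner_Rn: "x \<in> Rn n \<Longrightarrow> inner x y = (\<Sum>i<n. coord x i * coord y i)"
  by (rule inner_fvec_superset) (auto simp: Rn_def not_less[symmetric])

lemma of_coords_in_Rn [intro, simp]: "of_coords n a \<in> Rn n"
  by (auto simp: Rn_def of_coords.rep_eq)

definition unit_vec :: "nat \<Rightarrow> fvec"
  where "unit_vec i = of_coords (Suc i) (\<lambda>j. if j = i then 1 else 0)"

lemma coord_unit_vec: "coord (unit_vec i) j = (if j = i then 1 else 0)"
  by (simp add: unit_vec_def of_coords.rep_eq)

lemma inner_unit_vec: "inner (unit_vec i) x = coord x i"
proof -
  have "inner (unit_vec i) x = (\<Sum>j<Suc i. coord (unit_vec i) j * coord x j)"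
    by (rule inner_Rn) (simp add: unit_vec_def)
  also have "\<dots> = coord x i"
    by (simp add: coord_unit_vec)
  finally show ?thesis .
qed

lemma norm_unit_vec: "norm (unit_vec i) = 1"
  by (simp add: norm_eq_sqrt_inner inner_unit_vec coord_unit_vec)

lemma bounded_linear_coord: "bounded_linear (\<lambda>x. coord x i)"
  using bounded_linear_inner_right[of "unit_vec i"] by (simp add: inner_unit_vec)

lemma abs_coord_le_norm: "\<bar>coord x i\<bar> \<le> norm x"
  using Cauchy_Schwarz_ineq2[of "unit_vec i" x] by (simp add: inner_unit_vec norm_unit_vec)

lemma coord_sum: "coord (sum f I) i = (\<Sum>k\<in>I. coord (f k) i)"
  using linear_sum[OF bounded_linear.linear[OF bounded_linear_coord]] .

text \<open>The space \<open>fvec\<close> is infinite-dimensional, so closed bounded sets need not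
  be compact. These boxes supply the compact sets for the existence of minimizers.\<close>

definition box_Rn :: "nat \<Rightarrow> real \<Rightarrow> fvec set"
  where "box_Rn n K = {x \<in> Rn n. \<forall>i. \<bar>coord x i\<bar> \<le> K}"

text \<open>Induction on the dimension: splitting off the last coordinate exhibits the next box as a
  continuous image of the smaller box times an interval.\<close>

lemma compact_box_Rn:
  assumes "0 \<le> K"
  shows "compact (box_Rn n K)"
proof (induction n)
  case 0
  have "box_Rn 0 K = {0}"
    using assms by (auto simp: box_Rn_def Rn_def intro: fvec_eqI)
  then show ?case by simp
next
  case (Suc n)
  let ?F = "\<lambda>(x, t). x + t *\<^sub>R unit_vec n"
  have "box_Rn (Suc n) K = ?F ` (box_Rn n K \<times> {-K..K})"
  proof (intro set_eqI iffI)
    fix x assume x: "x \<in> box_Rn (Suc n) K"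
    let ?y = "x - coord x n *\<^sub>R unit_vec n"
    have "coord ?y i = (if i = n then 0 else coord x i)" for i
      by (simp add: coord_unit_vec)
    then have "?y \<in> box_Rn n K"
      using x assms by (auto simp: box_Rn_def Rn_def)
    moreover have "coord x n \<in> {-K..K}"
    proof -
      have "\<bar>coord x n\<bar> \<le> K" using x by (simp add: box_Rn_def)
      then show ?thesis by auto
    qed
    ultimately show "x \<in> ?F ` (box_Rn n K \<times> {-K..K})"
      by (intro image_eqI[of _ _ "(?y, coord x n)"]) auto
  next
    fix x assume "x \<in> ?F ` (box_Rn n K \<times> {-K..K})"
    then obtain y t where y: "y \<in> box_Rn n K" and t: "t \<in> {-K..K}"
      and x: "x = y + t *\<^sub>R unit_vec n" by auto
    have "coord x i = (if i = n then t else coord y i)" for i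
      using y by (auto simp: x coord_unit_vec box_Rn_def Rn_def)
    then show "x \<in> box_Rn (Suc n) K"
      using y t by (auto simp: box_Rn_def Rn_def)
  qed
  moreover have "continuous_on (box_Rn n K \<times> {-K..K}) ?F"
    by (auto intro!: continuous_intros simp: case_prod_unfold)
  ultimately show ?case
    using compact_continuous_image compact_Times[OF Suc.IH compact_Icc] by metis
qed

lemma bounded_subset_box_Rn:
  assumes "bounded S" "S \<subseteq> Rn n"
  obtains K where "0 \<le> K" "S \<subseteq> box_Rn n K"
proof -
  obtain K where K: "\<And>x. x \<in> S \<Longrightarrow> norm x \<le> K"
    using assms(1) by (auto simp: bounded_iff)
  have "S \<subseteq> box_Rn n (max 0 K)"
    using K assms(2) abs_coord_le_norm
    by (fastforce simp: box_Rn_def intro: order_trans)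
  then show thesis using that[of "max 0 K"] by simp
qed

text \<open>As a combination of columns weighted by coordinate functionals the product is visibly
  bounded, which linearity alone does not give on \<open>fvec\<close>.\<close>

lemma mat_vec_eq_sum: "mat_vec m n A x = (\<Sum>j<n. coord x j *\<^sub>R of_coords m (\<lambda>i. A i j))"
  by (rule fvec_eqI) (simp add: mat_vec_def of_coords.rep_eq coord_sum mult.commute)

lemma bounded_linear_mat_vec: "bounded_linear (mat_vec m n A)"
  unfolding mat_vec_eq_sum[abs_def]
  by (intro bounded_linear_sum bounded_linear_compose[OF bounded_linear_scaleR_left]
      bounded_linear_coord)

lemma inner_mat_vec: "inner y (mat_vec m n A x) = inner (mat_vec n m (\<lambda>j i. A i j) y) x"
proof -
  have "inner y (mat_vec m n A x) = inner (mat_vec m n A x) y"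
    by (rule inner_commute)
  also have "\<dots> = (\<Sum>i<m. (\<Sum>j<n. A i j * coord x j) * coord y i)"
    by (subst inner_Rn[of _ m]) (simp_all add: mat_vec_def of_coords.rep_eq)
  also have "\<dots> = (\<Sum>i<m. \<Sum>j<n. A i j * coord y i * coord x j)"
    by (simp add: sum_distrib_left sum_distrib_right mult_ac)
  also have "\<dots> = (\<Sum>j<n. \<Sum>i<m. A i j * coord y i * coord x j)"
    by (rule sum.swap)
  also have "\<dots> = (\<Sum>j<n. (\<Sum>i<m. A i j * coord y i) * coord x j)"
    by (simp add: sum_distrib_right)
  also have "\<dots> = inner (mat_vec n m (\<lambda>j i. A i j) y) x"
    by (subst inner_Rn[of _ n]) (simp_all add: mat_vec_def of_coords.rep_eq)
  finally show ?thesis .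
qed

section \<open>The constraint operator and its adjoint\<close>

lemma appA_in_Ysp [intro, simp]: "appA P x \<in> Ysp P"
  by (simp add: appA_def mat_vec_def)

lemma appAT_in_Xsp [intro, simp]: "appAT P y \<in> Xsp P"
  by (simp add: appAT_def mat_vec_def)

lemma bounded_linear_appA: "bounded_linear (appA P)"
  unfolding appA_def[abs_def] by (rule bounded_linear_mat_vec)

lemma linear_appAT: "linear (appAT P)"
  unfolding appAT_def[abs_def] by (intro bounded_linear.linear bounded_linear_mat_vec)

lemma inner_appA: "inner y (appA P x) = inner (appAT P y) x"
  by (simp add: appA_def appAT_def inner_mat_vec)

lemma norm_appA_le: "norm (appA P x) \<le> normA P * norm x"
  unfolding normA_def by (rule onorm[OF bounded_linear_appA])

lemma normA_nonneg: "0 \<le> normA P"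
  unfolding normA_def by (rule onorm_pos_le[OF bounded_linear_appA])

text \<open>The adjoint inherits the bound from
  \<open>(norm (appAT P y))\<^sup>2 = inner y (appA P (appAT P y))\<close> and
  Cauchy-Schwarz.\<close>

lemma norm_appAT_le: "norm (appAT P y) \<le> normA P * norm y"
proof (cases "appAT P y = 0")
  case False
  have "(norm (appAT P y))\<^sup>2 = inner y (appA P (appAT P y))"
    by (simp add: inner_appA power2_norm_eq_inner)
  also have "\<dots> \<le> norm y * norm (appA P (appAT P y))"
    by (rule norm_cauchy_schwarz)
  also have "\<dots> \<le> norm y * (normA P * norm (appAT P y))"
    by (intro mult_left_mono norm_appA_le) simp
  finally have "norm (appAT P y) * norm (appAT P y) \<le> (normA P * norm y) * norm (appAT P y)"
    by (simp add: power2_eq_square mult_ac)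
  then show ?thesis
    using False by (simp add: mult_le_cancel_right)
qed (simp add: normA_nonneg)

lemma resid_diff: "resid P x - resid P y = appA P (x - y)"
  by (simp add: resid_def linear_diff[OF bounded_linear.linear[OF bounded_linear_appA]])


section \<open>Convex functions with bounded domain\<close>

lemma ereal_real_eff_dom:
  assumes "proper_closed_convex n h" "x \<in> eff_dom n h"
  shows "h x = ereal (real_of_ereal (h x))"
  using assms by (cases "h x") (auto simp: proper_closed_convex_def eff_dom_def)

lemma eff_dom_subset_Rn: "eff_dom n h \<subseteq> Rn n"
  by (auto simp: eff_dom_def)

lemma in_epi_iff:
  assumes "proper_closed_convex n h"
  shows "(x, t) \<in> epi n h \<longleftrightarrow> x \<in> eff_dom n h \<and> real_of_ereal (h x) \<le> t"
proof
  assume "(x, t) \<in> epi n h"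
  then have x: "x \<in> eff_dom n h" "h x \<le> ereal t"
    by (auto simp: epi_def eff_dom_def)
  show "x \<in> eff_dom n h \<and> real_of_ereal (h x) \<le> t"
    using x ereal_real_eff_dom[OF assms x(1)] by (metis ereal_less_eq(3))
next
  assume x: "x \<in> eff_dom n h \<and> real_of_ereal (h x) \<le> t"
  then have "h x \<le> ereal t"
    using ereal_real_eff_dom[OF assms] by (metis ereal_less_eq(3))
  then show "(x, t) \<in> epi n h"
    using x by (auto simp: epi_def eff_dom_def)
qed

lemma convex_on_eff_dom:
  assumes "proper_closed_convex n h"
  shows "convex_on (eff_dom n h) (\<lambda>x. real_of_ereal (h x))"
proof -
  have *: "(1 - t) *\<^sub>R x + t *\<^sub>R y \<in> eff_dom n h \<and>
      real_of_ereal (h ((1 - t) *\<^sub>R x + t *\<^sub>R y)) \<le>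
        (1 - t) * real_of_ereal (h x) + t * real_of_ereal (h y)"
    if "x \<in> eff_dom n h" "y \<in> eff_dom n h" "0 \<le> t" "t \<le> 1" for x y t
  proof -
    have "(x, real_of_ereal (h x)) \<in> epi n h" "(y, real_of_ereal (h y)) \<in> epi n h"
      using that by (auto simp: in_epi_iff[OF assms])
    then have "(1 - t) *\<^sub>R (x, real_of_ereal (h x)) + t *\<^sub>R (y, real_of_ereal (h y)) \<in> epi n h"
      using assms that(3,4) by (intro convexD_alt) (auto simp: proper_closed_convex_def)
    then show ?thesis
      by (simp add: in_epi_iff[OF assms])
  qed
  have "convex (eff_dom n h)"
    using * by (auto simp: convex_alt)
  then show ?thesis
    using * by (intro convex_onI) auto
qed

text \<open>Without a lower bound the sublevel sets at levels \<open>- real i\<close> would be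
  nonempty, nested and compact, each being the projection of a slice of the closed epigraph over a
  box. At a common point the finite value of \<open>h\<close> would lie below every real
  number.\<close>

lemma bounded_below_eff_dom:
  assumes h: "proper_closed_convex n h" and bdd: "bounded (eff_dom n h)"
  shows "\<exists>m. \<forall>x\<in>eff_dom n h. m \<le> real_of_ereal (h x)"
proof (rule ccontr)
  assume contra: "\<not> ?thesis"
  obtain K where K: "0 \<le> K" "eff_dom n h \<subseteq> box_Rn n K"
    using bounded_subset_box_Rn[OF bdd eff_dom_subset_Rn] .
  define F where "F i = fst ` (epi n h \<inter> (box_Rn n K \<times> {- real i}))" for i
  have F: "F i = {x \<in> eff_dom n h. real_of_ereal (h x) \<le> - real i}" for i
    using K by (force simp: F_def in_epi_iff[OF h] image_def)
  have cpt: "compact (F i)" for i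
      unfolding F_def using h compact_box_Rn[OF K(1)]
      by (intro compact_continuous_image continuous_intros closed_Int_compact compact_Times)
        (auto simp: proper_closed_convex_def)
  have "F 0 \<inter> (\<Inter>i\<in>UNIV. F i) \<noteq> {}"
  proof (rule compact_imp_fip_image[OF cpt])
    show "closed (F i)" for i
      by (rule compact_imp_closed[OF cpt])
    fix I :: "nat set" assume "finite I"
    then obtain b where b: "\<And>i. i \<in> I \<Longrightarrow> i \<le> b"
      by (meson finite_nat_set_iff_bounded_le)
    obtain x where x: "x \<in> eff_dom n h" "\<not> - real b \<le> real_of_ereal (h x)"
      using contra by blast
    then have "x \<in> F i" if "i \<le> b" for i
      using that by (simp add: F)
    then show "F 0 \<inter> (\<Inter>i\<in>I. F i) \<noteq> {}"
      using b by blast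
  qed
  then obtain x where x: "\<And>i. x \<in> F i" by blast
  obtain i where "- real_of_ereal (h x) < real i"
    using reals_Archimedean2 by blast
  then show False
    using x[of i] by (simp add: F)
qed

text \<open>Lower semicontinuity enters through the closed epigraph: the continuous function
  \<open>c * t + G x\<close> is minimized over a compact truncation of it.\<close>

lemma argmin_exists:
  assumes h: "proper_closed_convex n h" and bdd: "bounded (eff_dom n h)"
    and G: "continuous_on (Rn n) G" and c: "0 < c"
  shows "\<exists>y\<in>eff_dom n h. \<forall>u\<in>eff_dom n h.
    c * real_of_ereal (h y) + G y \<le> c * real_of_ereal (h u) + G u"
proof -
  obtain K where K: "0 \<le> K" "eff_dom n h \<subseteq> box_Rn n K"
    using bounded_subset_box_Rn[OF bdd eff_dom_subset_Rn] .
  obtain m where m: "\<And>x. x \<in> eff_dom n h \<Longrightarrow> m \<le> real_of_ereal (h x)"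
    using bounded_below_eff_dom[OF h bdd] by blast
  have GK: "continuous_on (box_Rn n K) G"
    using G by (rule continuous_on_subset) (auto simp: box_Rn_def)
  have "bounded (G ` box_Rn n K)"
    by (intro compact_imp_bounded compact_continuous_image GK compact_box_Rn K)
  then obtain B where B: "\<And>x. x \<in> box_Rn n K \<Longrightarrow> \<bar>G x\<bar> \<le> B"
    by (auto simp: bounded_iff)
  obtain y0 where y0: "y0 \<in> eff_dom n h"
    using h by (auto simp: proper_closed_convex_def)
  \<comment> \<open>As \<open>\<bar>G\<bar> \<le> B\<close> on the box, a point where
    \<open>h\<close> exceeds \<open>t0\<close> has a larger objective than \<open>y0\<close>, so
    cutting the epigraph at height \<open>t0\<close> loses no minimizer.\<close>
  define t0 where "t0 = real_of_ereal (h y0) + 2 * B / c"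
  define E where "E = epi n h \<inter> (box_Rn n K \<times> {m..t0})"
  have "B \<ge> 0" using B[of y0] y0 K by fastforce
  then have "(y0, real_of_ereal (h y0)) \<in> E"
    using y0 m[OF y0] K c by (auto simp: E_def in_epi_iff[OF h] t0_def)
  then have E0: "E \<noteq> {}" by auto
  have E1: "compact E"
    unfolding E_def using h compact_box_Rn[OF K(1)]
    by (intro closed_Int_compact compact_Times) (auto simp: proper_closed_convex_def)
  have "continuous_on E (\<lambda>p. G (fst p))"
    by (rule continuous_on_compose2[OF GK]) (auto intro: continuous_intros simp: E_def)
  then have E2: "continuous_on E (\<lambda>p. c * snd p + G (fst p))"
    by (intro continuous_intros)
  from continuous_attains_inf[OF E1 E0 E2] obtain p where p: "p \<in> E"
    "\<And>q. q \<in> E \<Longrightarrow> c * snd p + G (fst p) \<le> c * snd q + G (fst q)" by blast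
  have p1: "fst p \<in> eff_dom n h" "real_of_ereal (h (fst p)) \<le> snd p"
    using p(1) in_epi_iff[OF h, of "fst p" "snd p"] by (auto simp: E_def)
  have "c * real_of_ereal (h (fst p)) + G (fst p) \<le> c * real_of_ereal (h u) + G u"
    if u: "u \<in> eff_dom n h" for u
  proof -
    have "c * real_of_ereal (h (fst p)) \<le> c * snd p"
      using p1 c by (intro mult_left_mono) auto
    moreover have "c * snd p + G (fst p) \<le> c * real_of_ereal (h u) + G u"
    proof (cases "real_of_ereal (h u) \<le> t0")
      case True
      then have "(u, real_of_ereal (h u)) \<in> E"
        using u m[OF u] K by (auto simp: E_def in_epi_iff[OF h])
      then show ?thesis using p(2) by fastforce
    next
      case False
      have "c * snd p + G (fst p) \<le> c * real_of_ereal (h y0) + G y0"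
        using p(2)[OF \<open>(y0, _) \<in> E\<close>] by simp
      also have "\<dots> = c * t0 - 2 * B + G y0"
        using c by (simp add: t0_def field_simps)
      also have "\<dots> \<le> c * t0 - B"
        using B[of y0] y0 K by fastforce
      also have "\<dots> \<le> c * t0 + G u"
        using B[of u] u K by fastforce
      also have "\<dots> \<le> c * real_of_ereal (h u) + G u"
        using False c by simp
      finally show ?thesis .
    qed
    ultimately show ?thesis by linarith
  qed
  then show ?thesis using p1 by blast
qed

lemma ereal_scaled_real:
  assumes "proper_closed_convex n h" "x \<in> eff_dom n h"
  shows "ereal c * h x + ereal g = ereal (c * real_of_ereal (h x) + g)"
  using ereal_real_eff_dom[OF assms] by (metis plus_ereal.simps(1) times_ereal.simps(1))

lemma ereal_scaled_outside:
  assumes "x \<in> Rn n" "x \<notin> eff_dom n h" "0 < c"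
  shows "ereal c * h x + ereal g = \<infinity>"
proof -
  have "h x = \<infinity>" using assms by (simp add: eff_dom_def)
  then show ?thesis using assms by simp
qed

text \<open>\<open>arg_min_on\<close> selects by choice and has content only if a minimizer exists.
  \<open>argmin_exists\<close> provides one over the domain, and outside the domain the objective is
  infinite.\<close>

lemma arg_min_on_ereal:
  assumes h: "proper_closed_convex n h" and bdd: "bounded (eff_dom n h)"
    and G: "continuous_on (Rn n) G" and c: "0 < c"
    and y: "y = arg_min_on (\<lambda>u. ereal c * h u + ereal (G u)) (Rn n)"
  shows "y \<in> eff_dom n h"
    and "u \<in> eff_dom n h \<Longrightarrow> c * real_of_ereal (h y) + G y \<le> c * real_of_ereal (h u) + G u"
proof -
  let ?F = "\<lambda>u. ereal c * h u + ereal (G u)"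
  obtain z where z: "z \<in> eff_dom n h"
    "\<And>u. u \<in> eff_dom n h \<Longrightarrow> c * real_of_ereal (h z) + G z \<le> c * real_of_ereal (h u) + G u"
    using argmin_exists[OF h bdd G c] by blast
  have "?F z \<le> ?F u" if "u \<in> Rn n" for u
  proof (cases "u \<in> eff_dom n h")
    case True
    then show ?thesis
      using z by (simp only: ereal_scaled_real[OF h] ereal_less_eq)
  next
    case False
    show ?thesis
      unfolding ereal_scaled_outside[OF that False c] by simp
  qed
  then have "is_arg_min ?F (\<lambda>x. x \<in> Rn n) z"
    using z(1) eff_dom_subset_Rn by (fastforce simp: is_arg_min_def not_less)
  then have y': "is_arg_min ?F (\<lambda>x. x \<in> Rn n) y"
    unfolding y arg_min_on_def arg_min_def by (rule someI)
  then have yn: "y \<in> Rn n" and min: "\<And>u. u \<in> Rn n \<Longrightarrow> ?F y \<le> ?F u"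
    by (auto simp: is_arg_min_def not_less)
  show y1: "y \<in> eff_dom n h"
  proof (rule ccontr)
    assume "y \<notin> eff_dom n h"
    then have "?F y = \<infinity>" by (rule ereal_scaled_outside[OF yn _ c])
    moreover have "?F y \<le> ?F z" using z(1) eff_dom_subset_Rn min by blast
    moreover have "?F z \<noteq> \<infinity>" unfolding ereal_scaled_real[OF h z(1)] by simp
    ultimately show False by (metis ereal_infty_less_eq(1))
  qed
  show "c * real_of_ereal (h y) + G y \<le> c * real_of_ereal (h u) + G u"
    if "u \<in> eff_dom n h"
    using min[OF subsetD[OF eff_dom_subset_Rn that]]
    unfolding ereal_scaled_real[OF h that] ereal_scaled_real[OF h y1] by simp
qed

lemma INF_ereal_eq:
  assumes h: "proper_closed_convex n h" and y: "y \<in> eff_dom n h"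
    and min: "\<And>u. u \<in> eff_dom n h \<Longrightarrow> real_of_ereal (h y) + G y \<le> real_of_ereal (h u) + G u"
  shows "(INF x\<in>Rn n. h x + ereal (G x)) = ereal (real_of_ereal (h y) + G y)"
proof (rule antisym)
  show "(INF x\<in>Rn n. h x + ereal (G x)) \<le> ereal (real_of_ereal (h y) + G y)"
    using y eff_dom_subset_Rn ereal_scaled_real[OF h y, of 1 "G y"]
    by (intro INF_lower2[of y]) auto
  show "ereal (real_of_ereal (h y) + G y) \<le> (INF x\<in>Rn n. h x + ereal (G x))"
  proof (rule INF_greatest)
    fix x assume "x \<in> Rn n"
    then show "ereal (real_of_ereal (h y) + G y) \<le> h x + ereal (G x)"
      using min[of x] ereal_scaled_real[OF h, of x 1 "G x"]
        ereal_scaled_outside[of x n h 1 "G x"]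
      by (cases "x \<in> eff_dom n h") (auto simp: one_ereal_def[symmetric])
  qed
qed

section \<open>First-order optimality conditions\<close>

lemma nonneg_of_small_perturbation:
  fixes a b :: real
  assumes "\<And>t. 0 < t \<Longrightarrow> t \<le> 1 \<Longrightarrow> 0 \<le> a + t * b"
  shows "0 \<le> a"
proof (rule ccontr)
  assume "\<not> 0 \<le> a"
  then have a: "a < 0" by simp
  define t where "t = min 1 (- a / (2 * (\<bar>b\<bar> + 1)))"
  have t: "0 < t" "t \<le> 1" using a by (auto simp: t_def divide_neg_pos add_nonneg_pos)
  have "t * b \<le> t * (\<bar>b\<bar> + 1)" using t by (intro mult_left_mono) auto
  also have "\<dots> \<le> (- a / (2 * (\<bar>b\<bar> + 1))) * (\<bar>b\<bar> + 1)"
    by (intro mult_right_mono) (auto simp: t_def)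
  also have "\<dots> = - a / 2" by (simp add: field_simps)
  finally have "a + t * b < 0" using a by simp
  then show False using assms[OF t] by simp
qed

text \<open>The differentiable part enters only through an upper quadratic model at
  \<open>y\<close>. Comparing \<open>y\<close> with the point a fraction \<open>t\<close> of the way
  to \<open>u\<close>, dividing by \<open>t\<close> and letting \<open>t\<close> tend to 0 removes
  the quadratic remainder.\<close>

lemma argmin_first_order:
  assumes H: "convex_on S H" and y: "y \<in> S" and u: "u \<in> S"
    and min: "\<And>u. u \<in> S \<Longrightarrow> H y + G y \<le> H u + G u"
    and G: "\<And>u. u \<in> S \<Longrightarrow> G u \<le> G y + inner w (u - y) + K * (norm (u - y))\<^sup>2"
  shows "H y - inner w (u - y) \<le> H u"
proof -
  have "0 \<le> (H u - H y + inner w (u - y)) + t * (K * (norm (u - y))\<^sup>2)"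
    if t: "0 < t" "t \<le> 1" for t
  proof -
    define v where "v = (1 - t) *\<^sub>R y + t *\<^sub>R u"
    have v: "v \<in> S" unfolding v_def
      using convexD_alt[OF convex_on_imp_convex[OF H] y u] t by simp
    have vy: "v - y = t *\<^sub>R (u - y)" by (simp add: v_def algebra_simps)
    have "H v \<le> (1 - t) * H y + t * H u"
      unfolding v_def using convex_onD[OF H, of t y u] t y u by simp
    moreover have "G v \<le> G y + t * inner w (u - y) + t\<^sup>2 * (K * (norm (u - y))\<^sup>2)"
      using G[OF v] by (simp add: vy power_mult_distrib mult_ac)
    ultimately have "0 \<le> t * ((H u - H y + inner w (u - y)) + t * (K * (norm (u - y))\<^sup>2))"
      using min[OF v] by (simp add: algebra_simps power2_eq_square)
    then show ?thesis using t by (simp add: zero_le_mult_iff)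
  qed
  then have "0 \<le> H u - H y + inner w (u - y)"
    by (rule nonneg_of_small_perturbation)
  then show ?thesis by simp
qed

lemma norm_diff_sq_expand:
  fixes x y c :: "'a::real_inner"
  shows "(norm (y - c))\<^sup>2 = (norm (x - c))\<^sup>2 + 2 * inner (x - c) (y - x) + (norm (y - x))\<^sup>2"
  by (simp add: power2_norm_eq_inner inner_diff_left inner_diff_right inner_commute)

text \<open>The inequality says that the step from the proximal point to \<open>z\<close>, divided
  by \<eta>, is a subgradient of \<open>h\<close> at the proximal point.\<close>

lemma prox_char:
  assumes h: "proper_closed_convex n h" and bdd: "bounded (eff_dom n h)" and \<eta>: "0 < \<eta>"
  shows "prox n \<eta> h z \<in> eff_dom n h"
    and "u \<in> eff_dom n h \<Longrightarrow> \<eta> * real_of_ereal (h (prox n \<eta> h z)) + inner (z - prox n \<eta> h z) (u - prox n \<eta> h z)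
      \<le> \<eta> * real_of_ereal (h u)"
proof -
  let ?G = "\<lambda>y. 1/2 * (norm (z - y))\<^sup>2"
  have G: "continuous_on (Rn n) ?G" by (intro continuous_intros)
  note p = arg_min_on_ereal[OF h bdd G \<eta> prox_def]
  show y: "prox n \<eta> h z \<in> eff_dom n h" by (rule p(1))
  assume u: "u \<in> eff_dom n h"
  let ?y = "prox n \<eta> h z"
  have "\<eta> * real_of_ereal (h ?y) - inner (?y - z) (u - ?y) \<le> \<eta> * real_of_ereal (h u)"
  proof (rule argmin_first_order[where K = "1/2" and G = ?G])
    show "convex_on (eff_dom n h) (\<lambda>x. \<eta> * real_of_ereal (h x))"
      using convex_on_cmul[OF _ convex_on_eff_dom[OF h], of \<eta>] \<eta> by simp
    show "?G u \<le> ?G ?y + inner (?y - z) (u - ?y) + 1/2 * (norm (u - ?y))\<^sup>2" for u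
      using norm_diff_sq_expand[of u z ?y] by (simp add: norm_minus_commute)
  qed (use y u p(2) in auto)
  then show "\<eta> * real_of_ereal (h ?y) + inner (z - ?y) (u - ?y) \<le> \<eta> * real_of_ereal (h u)"
    by (simp add: inner_diff_left)
qed


section \<open>Gradients on \<open>\<real>\<^sup>n\<close>\<close>

lemma has_grad_line:
  assumes "has_grad n s (x + t *\<^sub>R d) v" "x \<in> Rn n" "d \<in> Rn n"
  shows "((\<lambda>t. s (x + t *\<^sub>R d)) has_real_derivative inner v d) (at t)"
proof -
  have "((\<lambda>t. x + t *\<^sub>R d) has_derivative (\<lambda>t. 0 + t *\<^sub>R d)) (at t)"
    by (intro derivative_intros)
  then have 1: "((\<lambda>t. x + t *\<^sub>R d) has_derivative (\<lambda>t. t *\<^sub>R d)) (at t)"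
    by simp
  have 2: "(s has_derivative (\<lambda>u. inner v u)) (at (x + t *\<^sub>R d) within range (\<lambda>t. x + t *\<^sub>R d))"
  proof (rule has_derivative_subset)
    show "(s has_derivative (\<lambda>u. inner v u)) (at (x + t *\<^sub>R d) within Rn n)"
      using assms(1) by (simp add: has_grad_def)
  qed (use assms in auto)
  have "((\<lambda>t. s (x + t *\<^sub>R d)) has_derivative (\<lambda>t. inner v (t *\<^sub>R d))) (at t)"
    using has_derivative_in_compose[OF 1 2] .
  then show ?thesis
    by (simp add: has_field_derivative_def mult_commute_abs)
qed

text \<open>Derivatives are taken within \<open>Rn n\<close> and gradients are required to lie
  there, so \<open>v - w\<close> is itself an admissible direction in which to compare them.\<close>

lemma has_grad_unique:
  assumes "has_grad n s x v" "has_grad n s x w" "x \<in> Rn n"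
  shows "v = w"
proof -
  have d: "v - w \<in> Rn n" using assms by (auto simp: has_grad_def)
  have "inner v (v - w) = inner w (v - w)"
    using has_grad_line[of n s x 0 "v - w" v] has_grad_line[of n s x 0 "v - w" w] assms d
    by (intro DERIV_unique) auto
  then show ?thesis
    by (metis eq_iff_diff_eq_0 inner_diff_left inner_eq_zero_iff)
qed

lemma grad_eqI: "has_grad n s x v \<Longrightarrow> x \<in> Rn n \<Longrightarrow> grad n s x = v"
  unfolding grad_def using has_grad_unique by blast

lemma smooth_has_grad: "smooth n L s \<Longrightarrow> x \<in> Rn n \<Longrightarrow> has_grad n s x (grad n s x)"
  using grad_eqI by (fastforce simp: smooth_def)

lemma smooth_continuous_on: "smooth n L s \<Longrightarrow> continuous_on (Rn n) s"
  unfolding continuous_on_eq_continuous_within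
  by (metis smooth_has_grad has_grad_def has_derivative_continuous)

lemma smooth_grad_diff:
  "smooth n L s \<Longrightarrow> x \<in> Rn n \<Longrightarrow> y \<in> Rn n \<Longrightarrow> norm (grad n s x - grad n s y) \<le> L * norm (x - y)"
  unfolding smooth_def dist_norm[symmetric] by (blast intro: lipschitz_onD)

text \<open>The descent lemma, proved along the segment: \<phi> is the function minus its quadratic
  model, and the Lipschitz bound on the gradient makes its derivative nonpositive.\<close>

lemma smooth_upper_bound:
  assumes s: "smooth n L s" and x: "x \<in> Rn n" and y: "y \<in> Rn n"
  shows "s y \<le> s x + inner (grad n s x) (y - x) + L / 2 * (norm (y - x))\<^sup>2"
proof -
  define d where "d = y - x"
  have d: "d \<in> Rn n" using x y by (auto simp: d_def)
  define \<phi> where "\<phi> t = s (x + t *\<^sub>R d) - t * inner (grad n s x) d - L / 2 * t\<^sup>2 * (norm d)\<^sup>2" for t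
  have "\<phi> 1 \<le> \<phi> 0"
  proof (rule DERIV_nonpos_imp_nonincreasing[of 0 1])
    fix t :: real assume t: "0 \<le> t" "t \<le> 1"
    let ?z = "x + t *\<^sub>R d"
    have z: "?z \<in> Rn n" using x d by auto
    have D: "(\<phi> has_real_derivative
      inner (grad n s ?z) d - inner (grad n s x) d - L * t * (norm d)\<^sup>2) (at t)"
      unfolding \<phi>_def
      by (rule derivative_eq_intros has_grad_line[OF smooth_has_grad[OF s z] x d] refl)+ simp
    have "inner (grad n s ?z - grad n s x) d \<le> norm (grad n s ?z - grad n s x) * norm d"
      by (rule norm_cauchy_schwarz)
    also have "\<dots> \<le> L * norm (?z - x) * norm d"
      by (intro mult_right_mono smooth_grad_diff[OF s z x]) simp
    also have "\<dots> = L * t * (norm d)\<^sup>2"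
      using t by (simp add: power2_eq_square)
    finally have "inner (grad n s ?z) d - inner (grad n s x) d - L * t * (norm d)\<^sup>2 \<le> 0"
      by (simp add: inner_diff_left)
    then show "\<exists>y. (\<phi> has_real_derivative y) (at t) \<and> y \<le> 0" using D by blast
  qed simp
  then show ?thesis by (simp add: \<phi>_def d_def)
qed

text \<open>Restriction to the line through \<open>x\<close> and \<open>y\<close> reduces the claim
  to the tangent inequality for a convex function of one real variable.\<close>

lemma convex_lower_bound:
  assumes f: "convex_on (Rn n) s" and g: "has_grad n s x v" and x: "x \<in> Rn n" and y: "y \<in> Rn n"
  shows "s x + inner v (y - x) \<le> s y"
proof -
  define d where "d = y - x"
  have d: "d \<in> Rn n" using x y by (auto simp: d_def)
  let ?\<phi> = "\<lambda>t::real. s (x + t *\<^sub>R d)"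
  have "convex_on UNIV ?\<phi>"
  proof (intro convex_onI)
    fix t a b :: real assume t: "0 < t" "t < 1"
    have "x + ((1 - t) *\<^sub>R a + t *\<^sub>R b) *\<^sub>R d = (1 - t) *\<^sub>R (x + a *\<^sub>R d) + t *\<^sub>R (x + b *\<^sub>R d)"
      by (simp add: algebra_simps)
    then show "?\<phi> ((1 - t) *\<^sub>R a + t *\<^sub>R b) \<le> (1 - t) * ?\<phi> a + t * ?\<phi> b"
      using convex_onD[OF f, of t "x + a *\<^sub>R d" "x + b *\<^sub>R d"] t x d by auto
  qed simp
  moreover have "(?\<phi> has_real_derivative inner v d) (at 0)"
    using has_grad_line[of n s x 0 d v] g x d by simp
  ultimately have "inner v d * (1 - 0) \<le> ?\<phi> 1 - ?\<phi> 0"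
    by (intro convex_on_imp_above_tangent[of UNIV]) auto
  then show ?thesis by (simp add: d_def)
qed

section \<open>Gradient and quadratic bounds of the smooth part of the augmented Lagrangian\<close>

lemma has_grad_add_quadratic:
  assumes "has_grad n s x v" "x \<in> Rn n" "c \<in> Rn n"
  shows "has_grad n (\<lambda>u. s u + a * (norm (u - c))\<^sup>2) x (v + (2 * a) *\<^sub>R (x - c))"
proof -
  have "((\<lambda>u. s u + a * inner (u - c) (u - c)) has_derivative
      (\<lambda>u. inner (v + (2 * a) *\<^sub>R (x - c)) u)) (at x within Rn n)"
    using assms(1) unfolding has_grad_def
    by (auto intro!: derivative_eq_intros simp: inner_add_left inner_commute algebra_simps)
  then show ?thesis
    using assms by (auto simp: has_grad_def power2_norm_eq_inner)
qed

text \<open>Multiplier and penalty are collected under one adjoint: at the extrapolated multiplier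
  and the new primal point its argument is exactly the new multiplier
  \<open>lams r (Suc k)\<close>.\<close>

definition grad_Psi :: "problem \<Rightarrow> params \<Rightarrow> fvec \<Rightarrow> fvec \<Rightarrow> fvec"
  where "grad_Psi P M l x = grad (nvar P) (fobj P) x + gam_p M *\<^sub>R (x - xinit M)
    + appAT P (l + rho M *\<^sub>R resid P x)"

lemma has_grad_Psi:
  assumes s: "smooth (nvar P) L (fobj P)" and x: "x \<in> Xsp P" and x0: "xinit M \<in> Xsp P"
  shows "has_grad (nvar P) (Psi P M l) x (grad_Psi P M l x)"
proof -
  have r: "(resid P has_derivative appA P) (at x within Xsp P)"
    unfolding resid_def[abs_def]
    by (auto intro!: derivative_eq_intros bounded_linear.has_derivative[OF bounded_linear_appA])
  have "has_grad (nvar P) (\<lambda>x. fobj P x + gam_p M / 2 * (norm (x - xinit M))\<^sup>2) x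
    (grad (nvar P) (fobj P) x + gam_p M *\<^sub>R (x - xinit M))"
    using has_grad_add_quadratic[OF smooth_has_grad[OF s x] x x0, of "gam_p M / 2"] by simp
  then have 1: "((\<lambda>x. fobj P x + gam_p M / 2 * (norm (x - xinit M))\<^sup>2) has_derivative
     (\<lambda>u. inner (grad (nvar P) (fobj P) x + gam_p M *\<^sub>R (x - xinit M)) u)) (at x within Xsp P)"
    and 2: "grad (nvar P) (fobj P) x + gam_p M *\<^sub>R (x - xinit M) \<in> Xsp P"
    by (auto simp: has_grad_def)
  have adj: "inner (appAT P (l + rho M *\<^sub>R resid P x)) u
      = inner l (appA P u) + rho M * inner (resid P x) (appA P u)" for u
    by (simp add: inner_appA[symmetric] inner_add_left)
  have "((\<lambda>x. fobj P x + gam_p M / 2 * (norm (x - xinit M))\<^sup>2 + inner l (resid P x)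
      + rho M / 2 * inner (resid P x) (resid P x)) has_derivative
     (\<lambda>u. inner (grad_Psi P M l x) u)) (at x within Xsp P)"
    by (rule has_derivative_eq_rhs[OF has_derivative_add[OF has_derivative_add[OF 1
            has_derivative_inner_right[OF r]]
            has_derivative_mult_right[OF has_derivative_inner[OF r r]]]])
      (simp add: grad_Psi_def inner_add_left adj inner_commute[of "appA P _" "resid P x"]
        fun_eq_iff algebra_simps)
  then show ?thesis
    using 2 by (auto simp: has_grad_def Psi_def[abs_def] power2_norm_eq_inner grad_Psi_def)
qed

lemma grad_Psi_in_Xsp:
  "smooth (nvar P) L (fobj P) \<Longrightarrow> x \<in> Xsp P \<Longrightarrow> xinit M \<in> Xsp P \<Longrightarrow> grad_Psi P M l x \<in> Xsp P"
  using has_grad_Psi by (simp add: has_grad_def)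

lemma grad_Psi_diff_le:
  assumes s: "smooth (nvar P) (Lf P) (fobj P)" and x: "x \<in> Xsp P" and y: "y \<in> Xsp P"
    and "0 \<le> gam_p M" "0 \<le> rho M"
  shows "norm (grad_Psi P M l x - grad_Psi P M l y) \<le> (M_rho P M + gam_p M) * norm (x - y)"
proof -
  have "grad_Psi P M l x - grad_Psi P M l y =
    (grad (nvar P) (fobj P) x - grad (nvar P) (fobj P) y) + gam_p M *\<^sub>R (x - y)
     + appAT P (rho M *\<^sub>R appA P (x - y))"
    by (simp add: grad_Psi_def resid_diff[symmetric] linear_add[OF linear_appAT]
        linear_diff[OF linear_appAT] linear_scale[OF linear_appAT] algebra_simps)
  also have "norm \<dots> \<le> Lf P * norm (x - y) + gam_p M * norm (x - y)
      + normA P * (rho M * (normA P * norm (x - y)))"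
  proof (intro norm_triangle_mono)
    show "norm (appAT P (rho M *\<^sub>R appA P (x - y))) \<le> normA P * (rho M * (normA P * norm (x - y)))"
      using norm_appAT_le[of P "rho M *\<^sub>R appA P (x - y)"] norm_appA_le[of P "x - y"] assms
      by (smt (verit, best) abs_of_nonneg mult_left_mono norm_scaleR normA_nonneg)
  qed (use smooth_grad_diff[OF s x y] assms in auto)
  also have "\<dots> = (M_rho P M + gam_p M) * norm (x - y)"
    by (simp add: M_rho_def algebra_simps power2_eq_square)
  finally show ?thesis .
qed

text \<open>An exact expansion with the remainder of \<open>fobj\<close> left as it is. Convexity
  bounds that remainder from below in \<open>Psi_lower\<close>, smoothness from above in
  \<open>Psi_upper\<close>.\<close>

lemma Psi_expand:
  "Psi P M l y = Psi P M l x + inner (grad_Psi P M l x) (y - x)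
    + (fobj P y - fobj P x - inner (grad (nvar P) (fobj P) x) (y - x))
    + gam_p M / 2 * (norm (y - x))\<^sup>2 + rho M / 2 * (norm (appA P (y - x)))\<^sup>2"
proof -
  have r: "resid P y = resid P x + appA P (y - x)"
    using resid_diff[of P y x] by (simp add: algebra_simps)
  have "(norm (resid P y))\<^sup>2 = (norm (resid P x))\<^sup>2 + 2 * inner (resid P x) (appA P (y - x))
    + (norm (appA P (y - x)))\<^sup>2"
    by (simp add: r power2_norm_eq_inner inner_add_left inner_add_right inner_commute)
  moreover have "inner (appAT P (l + rho M *\<^sub>R resid P x)) (y - x) =
    inner l (appA P (y - x)) + rho M * inner (resid P x) (appA P (y - x))"
    by (simp add: inner_appA[symmetric] inner_add_left)
  moreover have "inner l (resid P y) = inner l (resid P x) + inner l (appA P (y - x))"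
    by (simp add: r inner_add_right)
  ultimately show ?thesis
    unfolding Psi_def grad_Psi_def norm_diff_sq_expand[of y "xinit M" x]
    by (simp add: inner_add_left algebra_simps)
qed

lemma Psi_lower:
  assumes "convex_on (Xsp P) (fobj P)" "smooth (nvar P) L (fobj P)" "0 \<le> rho M"
    "x \<in> Xsp P" "y \<in> Xsp P"
  shows "Psi P M l x + inner (grad_Psi P M l x) (y - x) + gam_p M / 2 * (norm (y - x))\<^sup>2
    \<le> Psi P M l y"
proof -
  have "0 \<le> rho M / 2 * (norm (appA P (y - x)))\<^sup>2" using assms(3) by simp
  then show ?thesis
    using convex_lower_bound[OF assms(1) smooth_has_grad[OF assms(2,4)] assms(4,5)]
      Psi_expand[of P M l y x] by linarith
qed

lemma Psi_upper:
  assumes "smooth (nvar P) (Lf P) (fobj P)" "0 \<le> rho M" "x \<in> Xsp P" "y \<in> Xsp P"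
  shows "Psi P M l y \<le> Psi P M l x + inner (grad_Psi P M l x) (y - x)
    + (M_rho P M + gam_p M) / 2 * (norm (y - x))\<^sup>2"
proof -
  have "(norm (appA P (y - x)))\<^sup>2 \<le> (normA P * norm (y - x))\<^sup>2"
    by (intro power_mono norm_appA_le) simp
  then have "rho M / 2 * (norm (appA P (y - x)))\<^sup>2 \<le> rho M / 2 * (normA P * norm (y - x))\<^sup>2"
    using assms(2) by (intro mult_left_mono) auto
  moreover have "(M_rho P M + gam_p M) / 2 * (norm (y - x))\<^sup>2 = Lf P / 2 * (norm (y - x))\<^sup>2
      + gam_p M / 2 * (norm (y - x))\<^sup>2 + rho M / 2 * (normA P * norm (y - x))\<^sup>2"
    by (simp add: M_rho_def power_mult_distrib field_simps)
  ultimately show ?thesis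
    using smooth_upper_bound[OF assms(1,3,4)] Psi_expand[of P M l y x] by linarith
qed


section \<open>The scalar sequences of accelerated methods\<close>

lemma b_next_pos: "0 < r \<Longrightarrow> 0 < t \<Longrightarrow> 0 \<le> B \<Longrightarrow> 0 < b_next r t B"
  unfolding b_next_def by (intro divide_pos_pos add_pos_nonneg) auto

text \<open>\<open>b_next\<close> is the positive root of a quadratic equation. This balance between
  the step and the weights is what makes accelerated potentials decrease.\<close>

lemma b_next_sq:
  assumes "0 < r" "0 < t" "0 \<le> B"
  shows "(b_next r t B)\<^sup>2 = r * t * (B + b_next r t B)"
proof -
  define w where "w = sqrt (r\<^sup>2 * t\<^sup>2 + 4 * r * t * B)"
  have "w\<^sup>2 = r\<^sup>2 * t\<^sup>2 + 4 * r * t * B"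
    using assms by (simp add: w_def)
  moreover have b: "b_next r t B = (r * t + w) / 2"
    by (simp add: b_next_def w_def)
  ultimately show ?thesis
    unfolding b by (simp add: power2_eq_square field_simps)
qed

text \<open>Both loops obey this recursion: ACG with \<open>r = 1 / (2 * L)\<close> and modulus
  \<mu>, the outer loop with r equal to \<rho> and modulus \<open>gam_d M\<close>.\<close>

locale accel_seq =
  fixes r \<gamma> :: real and B \<tau> :: "nat \<Rightarrow> real"
  assumes r_pos: "0 < r" and \<gamma>_pos: "0 < \<gamma>"
    and B_0: "B 0 = 0" and \<tau>_0: "\<tau> 0 = 1"
    and B_Suc: "B (Suc k) = B k + b_next r (\<tau> k) (B k)"
    and \<tau>_Suc: "\<tau> (Suc k) = \<tau> k + \<gamma> * b_next r (\<tau> k) (B k)"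
begin

abbreviation b :: "nat \<Rightarrow> real"
  where "b k \<equiv> b_next r (\<tau> k) (B k)"

text \<open>The growth rate: the square roots of the weights grow at least by the factor 1 +
  \<delta> / 2 per step and, up to an additive \<open>sqrt r\<close>, at most by 1 +
  \<delta>.\<close>

definition \<delta> :: real
  where "\<delta> = sqrt (r * \<gamma>)"

lemma \<delta>_pos: "0 < \<delta>"
  using r_pos \<gamma>_pos by (simp add: \<delta>_def)

lemma \<delta>_sq: "\<delta>\<^sup>2 = r * \<gamma>"
  using r_pos \<gamma>_pos by (simp add: \<delta>_def)

lemma \<tau>_eq: "\<tau> k = 1 + \<gamma> * B k"
  by (induction k) (simp_all add: B_0 \<tau>_0 B_Suc \<tau>_Suc algebra_simps)

lemma B_nonneg: "0 \<le> B k"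
proof (induction k)
  case (Suc k)
  have "0 < \<tau> k" using Suc \<gamma>_pos by (simp add: \<tau>_eq add_pos_nonneg)
  then show ?case using Suc b_next_pos[OF r_pos, of "\<tau> k" "B k"] by (simp add: B_Suc)
qed (simp add: B_0)

lemma \<tau>_ge_1: "1 \<le> \<tau> k"
  using B_nonneg[of k] \<gamma>_pos by (simp add: \<tau>_eq)

lemma \<tau>_pos: "0 < \<tau> k"
  using \<tau>_ge_1[of k] by simp

lemma b_pos: "0 < b k"
  by (intro b_next_pos r_pos \<tau>_pos B_nonneg)

lemma b_sq: "(b k)\<^sup>2 = r * \<tau> k * B (Suc k)"
  using b_next_sq[OF r_pos \<tau>_pos B_nonneg] by (simp add: B_Suc)

lemma B_Suc_pos: "0 < B (Suc k)"
  using B_nonneg[of k] b_pos[of k] by (simp add: B_Suc)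

lemma B_1: "B (Suc 0) = r"
  using r_pos by (simp add: B_Suc B_0 \<tau>_0 b_next_def)

lemma B_mono: "i \<le> j \<Longrightarrow> B i \<le> B j"
  by (rule lift_Suc_mono_le[of B]) (use b_pos in \<open>simp_all add: B_Suc less_imp_le\<close>)

lemma \<tau>_mono: "i \<le> j \<Longrightarrow> \<tau> i \<le> \<tau> j"
  using B_mono \<gamma>_pos by (simp add: \<tau>_eq)

lemma sqrt_B_diff: "B (Suc k) - B k = sqrt (r * \<tau> k) * sqrt (B (Suc k))"
proof -
  have "b k = sqrt ((b k)\<^sup>2)" using b_pos[of k] by simp
  then show ?thesis by (simp add: b_sq B_Suc[of k] real_sqrt_mult)
qed

text \<open>With p and q the two square roots, the increment of \<open>B\<close> is q times
  \<open>sqrt (r * \<tau> k)\<close>, hence at least \<delta> p q. It also factors as (q - p)(q +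
  p), which would be too small if q were below the claimed bound.\<close>

lemma sqrt_B_lower: "(1 + \<delta> / 2) * sqrt (B k) \<le> sqrt (B (Suc k))"
proof (rule ccontr)
  define p q where "p = sqrt (B k)" and "q = sqrt (B (Suc k))"
  assume "\<not> ?thesis"
  then have c: "q < (1 + \<delta> / 2) * p" by (simp add: p_def q_def)
  have pq: "p \<le> q" "0 \<le> p" "0 < q"
    using B_mono[of k "Suc k"] B_nonneg B_Suc_pos by (auto simp: p_def q_def)
  have "\<delta> * p = sqrt (r * (\<gamma> * B k))"
    by (simp add: \<delta>_def p_def real_sqrt_mult)
  also have "\<dots> \<le> sqrt (r * \<tau> k)"
    using r_pos by (simp add: \<tau>_eq)
  finally have "\<delta> * p * q \<le> sqrt (r * \<tau> k) * q"
    using pq by (intro mult_right_mono) auto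
  also have "\<dots> = q\<^sup>2 - p\<^sup>2"
    using sqrt_B_diff[of k] B_nonneg[of k] B_nonneg[of "Suc k"] by (simp add: p_def q_def)
  also have "\<dots> = (q - p) * (q + p)"
    by (simp add: power2_eq_square algebra_simps)
  also have "\<dots> < (\<delta> / 2 * p) * (2 * q)"
  proof (rule mult_less_le_imp_less)
    show "q - p < \<delta> / 2 * p" using c by (simp add: algebra_simps)
  qed (use pq in auto)
  finally show False by simp
qed

lemma B_lower: "r * (1 + \<delta> / 2) ^ (2 * k) \<le> B (Suc k)"
proof -
  have "sqrt r * (1 + \<delta> / 2) ^ k \<le> sqrt (B (Suc k))"
  proof (induction k)
    case (Suc k)
    have "sqrt r * (1 + \<delta> / 2) ^ Suc k = (1 + \<delta> / 2) * (sqrt r * (1 + \<delta> / 2) ^ k)"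
      by simp
    also have "\<dots> \<le> (1 + \<delta> / 2) * sqrt (B (Suc k))"
      using Suc \<delta>_pos by (intro mult_left_mono) auto
    also have "\<dots> \<le> sqrt (B (Suc (Suc k)))" by (rule sqrt_B_lower)
    finally show ?case .
  qed (simp add: B_1)
  then have "(sqrt r * (1 + \<delta> / 2) ^ k)\<^sup>2 \<le> (sqrt (B (Suc k)))\<^sup>2"
    using r_pos \<delta>_pos by (intro power_mono) auto
  then show ?thesis
    using r_pos B_nonneg[of "Suc k"] by (simp add: power_mult_distrib power_mult[symmetric] mult.commute)
qed

text \<open>The same factorization read in the other direction, with \<open>r * \<tau> k\<close>
  bounded by the square of \<open>sqrt r + \<delta> * sqrt (B k)\<close>.\<close>

lemma sqrt_B_upper: "sqrt (B (Suc k)) \<le> (1 + \<delta>) * sqrt (B k) + sqrt r"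
proof -
  define p q where "p = sqrt (B k)" and "q = sqrt (B (Suc k))"
  have pq: "p \<le> q" "0 \<le> p" "0 < q"
    using B_mono[of k "Suc k"] B_nonneg B_Suc_pos by (auto simp: p_def q_def)
  have "r * \<tau> k = (sqrt r)\<^sup>2 + (\<delta> * p)\<^sup>2"
    using r_pos B_nonneg[of k] by (simp add: \<tau>_eq power_mult_distrib \<delta>_sq p_def algebra_simps)
  also have "\<dots> \<le> (sqrt r + \<delta> * p)\<^sup>2"
    using r_pos \<delta>_pos pq by (simp add: power2_sum)
  finally have "sqrt (r * \<tau> k) \<le> sqrt r + \<delta> * p"
    using r_pos \<delta>_pos pq by (intro real_le_lsqrt) auto
  then have "sqrt (r * \<tau> k) * q \<le> (sqrt r + \<delta> * p) * q"
    using pq by (intro mult_right_mono) auto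
  moreover have "sqrt (r * \<tau> k) * q = (q - p) * (q + p)"
    using sqrt_B_diff[of k] B_nonneg[of k] B_nonneg[of "Suc k"]
    by (simp add: p_def q_def power2_eq_square algebra_simps)
  moreover have "(q - p) * q \<le> (q - p) * (q + p)"
    using pq by (intro mult_left_mono) auto
  ultimately have "(q - p) * q \<le> (sqrt r + \<delta> * p) * q" by linarith
  then have "q - p \<le> sqrt r + \<delta> * p"
    using pq by simp
  then show ?thesis by (simp add: p_def q_def algebra_simps)
qed

text \<open>The additive terms of \<open>sqrt_B_upper\<close> accumulate to a factor linear in the
  index, hence quadratic for \<open>B\<close>. The geometric factor is the one that the first bound
  on \<alpha> cancels.\<close>

lemma B_upper: "B (Suc k) \<le> r * (real (Suc k))\<^sup>2 * ((1 + \<delta>)\<^sup>2) ^ k"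
proof -
  have "sqrt (B (Suc k)) \<le> sqrt r * real (Suc k) * (1 + \<delta>) ^ k"
  proof (induction k)
    case (Suc k)
    have 1: "1 \<le> (1 + \<delta>) ^ Suc k"
      using \<delta>_pos by (intro one_le_power) simp
    have "sqrt (B (Suc (Suc k))) \<le> (1 + \<delta>) * sqrt (B (Suc k)) + sqrt r"
      by (rule sqrt_B_upper)
    also have "\<dots> \<le> (1 + \<delta>) * (sqrt r * real (Suc k) * (1 + \<delta>) ^ k) + sqrt r"
      using Suc \<delta>_pos by (intro add_right_mono mult_left_mono) auto
    also have "\<dots> \<le> (1 + \<delta>) * (sqrt r * real (Suc k) * (1 + \<delta>) ^ k) + sqrt r * (1 + \<delta>) ^ Suc k"
      using 1 r_pos by simp
    also have "\<dots> = sqrt r * real (Suc (Suc k)) * (1 + \<delta>) ^ Suc k"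
      by (simp add: algebra_simps)
    finally show ?case .
  qed (simp add: B_1)
  then have "(sqrt (B (Suc k)))\<^sup>2 \<le> (sqrt r * real (Suc k) * (1 + \<delta>) ^ k)\<^sup>2"
    using B_nonneg by (intro power_mono) auto
  then show ?thesis
    using r_pos B_nonneg[of "Suc k"]
    by (simp add: power_mult_distrib power_mult[symmetric] mult.commute)
qed

text \<open>The increment of \<tau> is at most \<delta> times the geometric mean of its old and new
  values, because \<open>\<gamma> * B (Suc k)\<close> is below
  \<open>\<tau> (Suc k)\<close>.\<close>

lemma \<tau>_Suc_le: "\<tau> (Suc k) \<le> (1 + \<delta>)\<^sup>2 * \<tau> k"
proof -
  define u v where "u = sqrt (\<tau> k)" and "v = sqrt (\<tau> (Suc k))"
  have uv: "0 < u" "u \<le> v" "u\<^sup>2 = \<tau> k" "v\<^sup>2 = \<tau> (Suc k)"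
    using \<tau>_pos[of k] \<tau>_pos[of "Suc k"] \<tau>_mono[of k "Suc k"] by (auto simp: u_def v_def)
  have "(\<gamma> * b k)\<^sup>2 = \<delta>\<^sup>2 * \<tau> k * (\<gamma> * B (Suc k))"
    unfolding power_mult_distrib b_sq \<delta>_sq by (simp add: power2_eq_square)
  also have "\<dots> \<le> \<delta>\<^sup>2 * \<tau> k * \<tau> (Suc k)"
    using \<tau>_pos[of k] by (intro mult_left_mono) (auto simp: \<tau>_eq[of "Suc k"])
  also have "\<dots> = (\<delta> * u * v)\<^sup>2"
    by (simp add: power_mult_distrib uv)
  finally have "\<gamma> * b k \<le> \<delta> * u * v"
    by (rule power2_le_imp_le) (use \<delta>_pos uv in auto)
  then have le: "(v - u) * (v + u) \<le> \<delta> * u * v"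
    using uv \<tau>_Suc[of k] by (simp add: power2_eq_square algebra_simps)
  have "v \<le> (1 + \<delta>) * u"
  proof (rule ccontr)
    assume "\<not> ?thesis"
    then have "\<delta> * u < v - u" by (simp add: algebra_simps)
    then have "(\<delta> * u) * v < (v - u) * (v + u)"
      using uv \<delta>_pos by (intro mult_less_le_imp_less) auto
    then show False using le by simp
  qed
  then have "v\<^sup>2 \<le> ((1 + \<delta>) * u)\<^sup>2"
    using uv by (intro power_mono) auto
  then show ?thesis by (simp add: uv power_mult_distrib)
qed

lemma B_le_b: "\<delta> * B (Suc k) \<le> (1 + \<delta>) * b k"
proof (rule power2_le_imp_le)
  have "(\<delta> * B (Suc k))\<^sup>2 = r * B (Suc k) * (\<gamma> * B (Suc k))"
    unfolding power_mult_distrib \<delta>_sq by (simp add: power2_eq_square)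
  also have "\<dots> \<le> r * B (Suc k) * \<tau> (Suc k)"
    using r_pos B_nonneg[of "Suc k"] by (intro mult_left_mono) (auto simp: \<tau>_eq[of "Suc k"])
  also have "\<dots> \<le> r * B (Suc k) * ((1 + \<delta>)\<^sup>2 * \<tau> k)"
    using r_pos B_nonneg[of "Suc k"] by (intro mult_left_mono \<tau>_Suc_le) auto
  also have "\<dots> = ((1 + \<delta>) * b k)\<^sup>2"
    unfolding power_mult_distrib b_sq by simp
  finally show "(\<delta> * B (Suc k))\<^sup>2 \<le> ((1 + \<delta>) * b k)\<^sup>2" .
  show "0 \<le> (1 + \<delta>) * b k" using b_pos[of k] \<delta>_pos by simp
qed

text \<open>By \<open>B_le_b\<close> each weight is at most (1 + \<delta>) / \<delta> times its
  increment, and the increments telescope. A constant error in every step therefore costs only a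
  factor of order 1 / \<delta>.\<close>

lemma sum_B_le: "\<delta> * (\<Sum>i<k. B (Suc i)) \<le> (1 + \<delta>) * B k"
proof (induction k)
  case (Suc k)
  then show ?case using B_le_b[of k] by (simp add: B_Suc[of k] algebra_simps)
qed (simp add: B_0)

end


section \<open>The accelerated composite gradient method\<close>

text \<open>Convexity of the squared norm, with unnormalized weights since the potentials carry such
  weights.\<close>

lemma weighted_norm_sq_le:
  fixes x y v :: "'a::real_inner"
  assumes "0 \<le> a" "0 \<le> b" "0 < a + b" and v: "(a + b) *\<^sub>R v = a *\<^sub>R x + b *\<^sub>R y"
  shows "(a + b) * (norm v)\<^sup>2 \<le> a * (norm x)\<^sup>2 + b * (norm y)\<^sup>2"
proof -
  have "(a + b) * ((a + b) * (norm v)\<^sup>2) = (norm ((a + b) *\<^sub>R v))\<^sup>2"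
    by (simp add: power_mult_distrib power2_eq_square mult_ac)
  also have "\<dots> = (a + b) * (a * (norm x)\<^sup>2 + b * (norm y)\<^sup>2) - a * b * (norm (x - y))\<^sup>2"
    unfolding v by (simp add: power2_norm_eq_inner inner_add_left inner_add_right
        inner_diff_left inner_diff_right inner_commute algebra_simps)
  also have "\<dots> \<le> (a + b) * (a * (norm x)\<^sup>2 + b * (norm y)\<^sup>2)"
    using assms by simp
  finally show ?thesis using assms(3) by (simp add: mult_le_cancel_left)
qed

text \<open>Adding the lower model at \<open>p\<close>, the descent bound and the optimality of
  \<open>q\<close> cancels \<open>v\<close>, and the \<mu> part of the proximal weight cancels the
  cross term of strong convexity.\<close>

lemma prox_gradient_model:
  fixes u p q v :: "'a::real_inner"
  assumes lower: "g p + inner v (u - p) + \<mu> / 2 * (norm (u - p))\<^sup>2 \<le> g u"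
    and upper: "g q \<le> g p + inner v (q - p) + (L + \<mu>) / 2 * (norm (q - p))\<^sup>2"
    and opt: "H q - inner (v + (2 * L + \<mu>) *\<^sub>R (q - p)) (u - q) \<le> H u"
  shows "H q + g q - L / 2 * (norm (p - q))\<^sup>2 + 2 * L * inner (p - q) (u - q)
    + \<mu> / 2 * (norm (u - q))\<^sup>2 \<le> H u + g u"
proof -
  define d e where "d = p - q" and "e = u - q"
  have eqs: "q - p = - d" "u - p = e - d" "p - q = d" "u - q = e"
    by (simp_all add: d_def e_def)
  have n: "(norm (e - d))\<^sup>2 = (norm e)\<^sup>2 - 2 * inner d e + (norm d)\<^sup>2"
    by (simp add: power2_norm_eq_inner inner_diff_left inner_diff_right inner_commute)
  show ?thesis
    using assms unfolding eqs n
    by (simp add: inner_diff_right inner_add_left algebra_simps add_divide_distrib)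
qed

text \<open>The model inequality is used at \<open>u\<close> with weight \<open>s\<close> and at
  \<open>q\<close> with weight \<open>S\<close>. The relation \<open>s_sq\<close> makes the
  resulting cross terms equal to those of the new distance term.\<close>

lemma acg_potential_step:
  fixes p q pt qt u p' :: "'a::real_inner"
  assumes S: "0 \<le> S" "0 < s" "S' = S + s" and \<theta>: "\<theta> = S * \<mu> + 1" and pos: "0 < L" "0 < \<mu>"
    and s_sq: "2 * L * s\<^sup>2 = \<theta> * S'"
    and pt: "pt = (S / S') *\<^sub>R q + (s / S') *\<^sub>R p"
    and p': "p' = (1 / (S' * \<mu> + 1)) *\<^sub>R (((2 * L + \<mu>) * s) *\<^sub>R qt - (2 * S * s * L / S') *\<^sub>R q)"
    and F': "F' \<le> Fqt"
    and mq: "Fqt - L / 2 * (norm (pt - qt))\<^sup>2 + 2 * L * inner (pt - qt) (q - qt) \<le> Fq"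
    and mu: "Fqt - L / 2 * (norm (pt - qt))\<^sup>2 + 2 * L * inner (pt - qt) (u - qt)
      + \<mu> / 2 * (norm (u - qt))\<^sup>2 \<le> Fu"
  shows "S' * (F' - Fu) + (S' * \<mu> + 1) / 2 * (norm (u - p'))\<^sup>2
    \<le> S * (Fq - Fu) + \<theta> / 2 * (norm (u - p))\<^sup>2"
proof -
  define d where "d = pt - qt"
  define w where "w = u - p"
  define e where "e = u - qt"
  define a where "a = w + (2 * L * s / \<theta>) *\<^sub>R d"
  have S': "0 < S'" using S by simp
  have \<theta>_pos: "0 < \<theta>" using S pos by (simp add: \<theta> add_nonneg_pos)
  have \<theta>': "S' * \<mu> + 1 = \<theta> + s * \<mu>" by (simp add: \<theta> S algebra_simps)
  have S'pt: "S' *\<^sub>R pt = S *\<^sub>R q + s *\<^sub>R p" using S' by (simp add: pt scaleR_add_right)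
  \<comment> \<open>The update of \<open>p\<close> is designed so that \<open>u - p'\<close> is a
    weighted average of \<open>a\<close>, the error after a gradient step from \<open>p\<close>, and
    of the error \<open>e\<close> of \<open>qt\<close>.\<close>
  have "(\<theta> + s * \<mu>) *\<^sub>R (u - p') = \<theta> *\<^sub>R a + (s * \<mu>) *\<^sub>R e"
  proof -
    have "(\<theta> + s * \<mu>) *\<^sub>R p' = ((2 * L + \<mu>) * s) *\<^sub>R qt - (2 * S * s * L / S') *\<^sub>R q"
      using \<theta>_pos S pos unfolding p' \<theta>' by (simp add: add_pos_pos less_imp_neq[symmetric])
    moreover have "(2 * L * s) *\<^sub>R pt = (2 * S * s * L / S') *\<^sub>R q + \<theta> *\<^sub>R p"
    proof -
      have "2 * L * s * (s / S') = \<theta>" using s_sq S' by (simp add: power2_eq_square field_simps)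
      then show ?thesis by (simp add: pt scaleR_add_right mult_ac)
    qed
    ultimately show ?thesis
      using \<theta>_pos unfolding a_def w_def d_def e_def
      by (simp add: algebra_simps)
  qed
  then have "(\<theta> + s * \<mu>) * (norm (u - p'))\<^sup>2 \<le> \<theta> * (norm a)\<^sup>2 + s * \<mu> * (norm e)\<^sup>2"
    using \<theta>_pos S pos by (intro weighted_norm_sq_le) (auto intro: add_pos_pos)
  also have "\<theta> * (norm a)\<^sup>2 = \<theta> * (norm w)\<^sup>2 + 4 * L * s * inner d w + 2 * L * S' * (norm d)\<^sup>2"
  proof -
    have "\<theta> * (norm a)\<^sup>2 = \<theta> * (norm w)\<^sup>2 + \<theta> * (2 * (2 * L * s / \<theta>)) * inner d w
        + \<theta> * (2 * L * s / \<theta>)\<^sup>2 * (norm d)\<^sup>2"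
      unfolding a_def power2_norm_eq_inner
      by (simp add: inner_add_left inner_add_right inner_commute algebra_simps power2_eq_square)
    moreover have "\<theta> * (2 * (2 * L * s / \<theta>)) = 4 * L * s" using \<theta>_pos by simp
    moreover have "\<theta> * (2 * L * s / \<theta>)\<^sup>2 = 2 * L * (2 * L * s\<^sup>2) / \<theta>"
      using \<theta>_pos by (simp add: power2_eq_square field_simps)
    ultimately show ?thesis
      unfolding s_sq using \<theta>_pos by simp
  qed
  finally have 1: "(S' * \<mu> + 1) * (norm (u - p'))\<^sup>2 \<le> \<theta> * (norm w)\<^sup>2 + 4 * L * s * inner d w
      + 2 * L * S' * (norm d)\<^sup>2 + s * \<mu> * (norm e)\<^sup>2"
    by (simp add: \<theta>')
  have 2: "S * (Fqt - L / 2 * (norm d)\<^sup>2 + 2 * L * inner d (q - qt)) \<le> S * Fq"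
    using mq S(1) unfolding d_def by (rule mult_left_mono)
  have 3: "s * (Fqt - L / 2 * (norm d)\<^sup>2 + 2 * L * inner d (u - qt) + \<mu> / 2 * (norm e)\<^sup>2) \<le> s * Fu"
    using mu S(2) unfolding d_def e_def by (intro mult_left_mono) auto
  have "S *\<^sub>R (q - qt) + s *\<^sub>R (u - qt) = S' *\<^sub>R d + s *\<^sub>R w"
    unfolding d_def w_def scaleR_diff_right S'pt by (simp add: S algebra_simps)
  then have "inner d (S *\<^sub>R (q - qt) + s *\<^sub>R (u - qt)) = inner d (S' *\<^sub>R d + s *\<^sub>R w)" by simp
  then have 4: "S * inner d (q - qt) + s * inner d (u - qt) = S' * (norm d)\<^sup>2 + s * inner d w"
    by (simp add: inner_add_right power2_norm_eq_inner)
  have 5: "S' * F' \<le> S' * Fqt" using F' S' by simp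
  have 6: "2 * L * (S * inner d (q - qt)) + 2 * L * (s * inner d (u - qt))
      = 2 * L * (S' * (norm d)\<^sup>2) + 2 * L * (s * inner d w)"
    using 4 by (metis distrib_left)
  \<comment> \<open>In the sum of all inequalities half of this term is left over, with the
    favourable sign.\<close>
  have 7: "0 \<le> L * S' * (norm d)\<^sup>2" using pos S' by simp
  show ?thesis
    using 1 2 3 5 6 7 unfolding w_def[symmetric]
    by (simp add: S(3) algebra_simps add_divide_distrib)
qed

text \<open>The constant \<open>c\<close> allows for terms of the Lagrangian in the multiplier
  alone, which belong to the objective \<psi> but not to the smooth part \<open>g\<close>.\<close>

locale acg =
  fixes n :: nat and h :: "fvec \<Rightarrow> ereal" and g :: "fvec \<Rightarrow> real" and g' :: "fvec \<Rightarrow> fvec"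
    and \<psi> :: "fvec \<Rightarrow> ereal" and c L \<mu> :: real and p0 :: fvec and st :: "nat \<Rightarrow> acg_state"
  assumes h: "proper_closed_convex n h" and bounded_dom: "bounded (eff_dom n h)"
    and has_grad_g: "\<And>x. x \<in> Rn n \<Longrightarrow> has_grad n g x (g' x)"
    and g_lower: "\<And>x y. x \<in> Rn n \<Longrightarrow> y \<in> Rn n \<Longrightarrow>
      g x + inner (g' x) (y - x) + \<mu> / 2 * (norm (y - x))\<^sup>2 \<le> g y"
    and g_upper: "\<And>x y. x \<in> Rn n \<Longrightarrow> y \<in> Rn n \<Longrightarrow>
      g y \<le> g x + inner (g' x) (y - x) + (L + \<mu>) / 2 * (norm (y - x))\<^sup>2"
    and L_pos: "0 < L" and \<mu>_pos: "0 < \<mu>" and p0: "p0 \<in> eff_dom n h"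
    and \<psi>_eq: "\<And>x. \<psi> x = h x + ereal (g x + c)"
    and run: "acg_run n \<psi> h g L \<mu> p0 st"
begin

abbreviation hr :: "fvec \<Rightarrow> real" where "hr x \<equiv> real_of_ereal (h x)"
abbreviation F :: "fvec \<Rightarrow> real" where "F x \<equiv> hr x + g x"

lemma st_0: "acgS (st 0) = 0" "acg_theta (st 0) = 1" "acg_p (st 0) = p0" "acg_q (st 0) = p0"
  using run by (auto simp: acg_run_def)

lemma step: "acg_step n \<psi> h g L \<mu> (st j) (st (Suc j))"
  using run by (simp add: acg_run_def)

lemma acg_s_eq: "acg_s L (st j) = b_next (1 / (2 * L)) (acg_theta (st j)) (acgS (st j))"
proof -
  let ?t = "acg_theta (st j)" and ?S = "acgS (st j)"
  have "(1 / (2 * L))\<^sup>2 * ?t\<^sup>2 + 4 * (1 / (2 * L)) * ?t * ?S = (?t\<^sup>2 + 8 * ?t * ?S * L) / (2 * L)\<^sup>2"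
    using L_pos by (simp add: power2_eq_square field_simps)
  then have "sqrt ((1 / (2 * L))\<^sup>2 * ?t\<^sup>2 + 4 * (1 / (2 * L)) * ?t * ?S)
      = sqrt (?t\<^sup>2 + 8 * ?t * ?S * L) / (2 * L)"
    using L_pos by (simp only: real_sqrt_divide real_sqrt_abs)
  then show ?thesis
    unfolding acg_s_def b_next_def using L_pos by (simp add: field_simps)
qed

lemma st_Suc:
  "acgS (st (Suc j)) = acgS (st j) + acg_s L (st j)"
  "acg_theta (st (Suc j)) = acg_theta (st j) + \<mu> * acg_s L (st j)"
  using step[of j] by (auto simp: acg_step_def Let_def acg_S'_def)

sublocale seq: accel_seq "1 / (2 * L)" \<mu> "\<lambda>j. acgS (st j)" "\<lambda>j. acg_theta (st j)"
  by unfold_locales (use L_pos \<mu>_pos in \<open>simp_all add: st_0 st_Suc acg_s_eq\<close>)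

lemma g_continuous: "continuous_on (Rn n) g"
  unfolding continuous_on_eq_continuous_within
  by (metis has_grad_g has_grad_def has_derivative_continuous)

lemma qtilde:
  assumes pt: "acg_ptilde L (st j) \<in> Rn n"
  defines "pt \<equiv> acg_ptilde L (st j)" and "qt \<equiv> acg_qtilde n h g L \<mu> (st j)"
  shows "qt \<in> eff_dom n h"
    and "u \<in> eff_dom n h \<Longrightarrow> hr qt - inner (g' pt + (2 * L + \<mu>) *\<^sub>R (qt - pt)) (u - qt) \<le> hr u"
proof -
  let ?G = "\<lambda>u. g pt + inner (g' pt) (u - pt) + (2 * L + \<mu>) / 2 * (norm (u - pt))\<^sup>2"
  have G: "continuous_on (Rn n) ?G" by (intro continuous_intros)
  have "grad n g pt = g' pt"
    unfolding pt_def by (rule grad_eqI[OF has_grad_g[OF pt] pt])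
  then have "qt = arg_min_on (\<lambda>u. ereal 1 * h u + ereal (?G u)) (Rn n)"
    unfolding qt_def acg_qtilde_def Let_def pt_def[symmetric]
    by (simp add: add_ac plus_ereal.simps(1)[symmetric] one_ereal_def[symmetric]
        del: plus_ereal.simps(1))
  note q = arg_min_on_ereal[OF h bounded_dom G zero_less_one this]
  show dom: "qt \<in> eff_dom n h" by (rule q(1))
  assume u: "u \<in> eff_dom n h"
  show "hr qt - inner (g' pt + (2 * L + \<mu>) *\<^sub>R (qt - pt)) (u - qt) \<le> hr u"
  proof (rule argmin_first_order[where G = ?G and K = "(2 * L + \<mu>) / 2" and S = "eff_dom n h"])
    show "convex_on (eff_dom n h) hr" by (rule convex_on_eff_dom[OF h])
    show "?G u \<le> ?G qt + inner (g' pt + (2 * L + \<mu>) *\<^sub>R (qt - pt)) (u - qt)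
      + (2 * L + \<mu>) / 2 * (norm (u - qt))\<^sup>2" for u
    proof -
      define K where "K = 2 * L + \<mu>"
      show ?thesis
        unfolding norm_diff_sq_expand[of u pt qt] K_def[symmetric]
        by (simp add: inner_add_left inner_diff_right algebra_simps)
    qed
  qed (use u dom q(2) in auto)
qed

text \<open>The points \<open>acg_p\<close> arise by extrapolation and are located only in the
  ambient space. For this reason the bounds on \<open>g\<close> are assumed on all of
  \<open>Rn n\<close>.\<close>

lemma states_in_domain: "acg_p (st j) \<in> Rn n \<and> acg_q (st j) \<in> eff_dom n h"
proof (induction j)
  case 0
  then show ?case using p0 eff_dom_subset_Rn by (auto simp: st_0)
next
  case (Suc j)
  then have q: "acg_q (st j) \<in> Rn n" using eff_dom_subset_Rn by auto
  then have "acg_ptilde L (st j) \<in> Rn n"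
    using Suc by (auto simp: acg_ptilde_def)
  then have qt: "acg_qtilde n h g L \<mu> (st j) \<in> eff_dom n h" by (rule qtilde)
  then have "acg_q (st (Suc j)) \<in> eff_dom n h"
    using step[of j] Suc by (auto simp: acg_step_def Let_def)
  moreover have "acg_p (st (Suc j)) \<in> Rn n"
    using step[of j] q subsetD[OF eff_dom_subset_Rn qt]
    by (simp add: acg_step_def Let_def subspace_scale[OF subspace_Rn] subspace_diff[OF subspace_Rn])
  ultimately show ?case by simp
qed

lemma ptilde_in_Rn: "acg_ptilde L (st j) \<in> Rn n"
  using states_in_domain[of j] eff_dom_subset_Rn[of n h]
  by (auto simp: acg_ptilde_def)

lemma \<psi>_dom: "x \<in> eff_dom n h \<Longrightarrow> \<psi> x = ereal (F x + c)"
  using ereal_scaled_real[OF h, of x 1 "g x + c"] by (simp add: \<psi>_eq one_ereal_def[symmetric])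

lemma potential_step:
  assumes u: "u \<in> eff_dom n h"
  shows "acgS (st (Suc j)) * (F (acg_q (st (Suc j))) - F u)
      + acg_theta (st (Suc j)) / 2 * (norm (u - acg_p (st (Suc j))))\<^sup>2
    \<le> acgS (st j) * (F (acg_q (st j)) - F u) + acg_theta (st j) / 2 * (norm (u - acg_p (st j)))\<^sup>2"
proof -
  let ?pt = "acg_ptilde L (st j)" and ?qt = "acg_qtilde n h g L \<mu> (st j)"
  let ?q = "acg_q (st j)" and ?q' = "acg_q (st (Suc j))"
  have q: "?q \<in> eff_dom n h" "?q' \<in> eff_dom n h" using states_in_domain by auto
  note pt = ptilde_in_Rn[of j]
  note qt = qtilde[OF pt]
  have Rn: "?qt \<in> Rn n" "u \<in> Rn n" "?q \<in> Rn n" using qt(1) u q eff_dom_subset_Rn by auto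
  have th: "acg_theta (st (Suc j)) = acgS (st (Suc j)) * \<mu> + 1"
    using seq.\<tau>_eq[of "Suc j"] by (simp add: mult.commute)
  have "\<psi> ?q' \<le> \<psi> ?qt"
    using step[of j] by (auto simp: acg_step_def Let_def)
  then have F': "F ?q' \<le> F ?qt" using q qt(1) by (simp add: \<psi>_dom)
  have m: "F ?qt - L / 2 * (norm (?pt - ?qt))\<^sup>2 + 2 * L * inner (?pt - ?qt) (v - ?qt)
    + \<mu> / 2 * (norm (v - ?qt))\<^sup>2 \<le> F v" if "v \<in> eff_dom n h" for v
    using that eff_dom_subset_Rn
    by (intro prox_gradient_model[where v = "g' ?pt"] g_lower g_upper pt Rn qt(2)) auto
  have mq: "F ?qt - L / 2 * (norm (?pt - ?qt))\<^sup>2 + 2 * L * inner (?pt - ?qt) (?q - ?qt) \<le> F ?q"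
  proof -
    have "0 \<le> \<mu> / 2 * (norm (?q - ?qt))\<^sup>2" using \<mu>_pos by simp
    then show ?thesis using m[OF q(1)] by linarith
  qed
  have S'_eq: "acg_S' L (st j) = acgS (st (Suc j))"
    by (simp add: acg_S'_def st_Suc)
  show ?thesis unfolding th
  proof (rule acg_potential_step[where s = "acg_s L (st j)" and L = L and pt = ?pt and qt = ?qt
        and Fqt = "F ?qt" and q = ?q])
    show "2 * L * (acg_s L (st j))\<^sup>2 = acg_theta (st j) * acgS (st (Suc j))"
      using seq.b_sq[of j] L_pos by (simp add: acg_s_eq)
    show "?pt = (acgS (st j) / acgS (st (Suc j))) *\<^sub>R ?q
        + (acg_s L (st j) / acgS (st (Suc j))) *\<^sub>R acg_p (st j)"
      by (simp add: acg_ptilde_def S'_eq)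
    show "acg_theta (st j) = acgS (st j) * \<mu> + 1"
      using seq.\<tau>_eq[of j] by (simp add: mult.commute)
    show "acg_p (st (Suc j)) = (1 / (acgS (st (Suc j)) * \<mu> + 1)) *\<^sub>R
        (((2 * L + \<mu>) * acg_s L (st j)) *\<^sub>R ?qt
          - (2 * acgS (st j) * acg_s L (st j) * L / acgS (st (Suc j))) *\<^sub>R ?q)"
      using step[of j] by (simp add: acg_step_def Let_def S'_eq)
  qed (use seq.B_nonneg[of j] seq.b_pos[of j] L_pos \<mu>_pos F' mq m[OF u] st_Suc(1)[of j] in
      \<open>simp_all add: acg_s_eq\<close>)
qed

lemma potential_le:
  assumes u: "u \<in> eff_dom n h"
  shows "acgS (st j) * (F (acg_q (st j)) - F u) + acg_theta (st j) / 2 * (norm (u - acg_p (st j)))\<^sup>2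
    \<le> (norm (u - p0))\<^sup>2 / 2"
proof (induction j)
  case 0
  show ?case by (simp add: st_0)
next
  case (Suc j)
  then show ?case using potential_step[OF u, of j] by linarith
qed

lemma minimizer:
  obtains x where "x \<in> eff_dom n h" "\<And>u. u \<in> eff_dom n h \<Longrightarrow> hr x - inner (g' x) (u - x) \<le> hr u"
proof -
  obtain x where x: "x \<in> eff_dom n h" and min: "\<And>u. u \<in> eff_dom n h \<Longrightarrow> F x \<le> F u"
    using argmin_exists[OF h bounded_dom g_continuous zero_less_one] by auto
  have "hr x - inner (g' x) (u - x) \<le> hr u" if u: "u \<in> eff_dom n h" for u
  proof (rule argmin_first_order[where G = g and K = "(L + \<mu>) / 2" and S = "eff_dom n h"])
    show "convex_on (eff_dom n h) hr" by (rule convex_on_eff_dom[OF h])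
    show "g v \<le> g x + inner (g' x) (v - x) + (L + \<mu>) / 2 * (norm (v - x))\<^sup>2"
      if "v \<in> eff_dom n h" for v
      using that x eff_dom_subset_Rn by (intro g_upper) auto
  qed (use x u min in auto)
  then show thesis using that x by blast
qed

text \<open>The two terms of the potential bound the distances of \<open>acg_q\<close> and
  \<open>acg_p\<close> to the minimizer: the first by strong convexity, the second because
  \<open>acg_theta\<close> exceeds \<mu> times \<open>acgS\<close>. The tested point is a convex
  combination of both.\<close>

lemma ptilde_dist:
  assumes x: "x \<in> eff_dom n h" and opt: "\<And>u. u \<in> eff_dom n h \<Longrightarrow> hr x - inner (g' x) (u - x) \<le> hr u"
    and j: "0 < j"
  shows "\<mu> * acgS (st j) * (norm (acg_ptilde L (st j) - x))\<^sup>2 \<le> (norm (x - p0))\<^sup>2"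
proof -
  let ?S = "acgS (st j)" and ?q = "acg_q (st j)" and ?p = "acg_p (st j)"
  let ?N = "(norm (x - p0))\<^sup>2"
  obtain i where i: "j = Suc i" using j by (cases j) auto
  have S: "0 < ?S" "0 < acg_s L (st j)"
    using seq.B_Suc_pos[of i] seq.b_pos[of j] by (auto simp: i acg_s_eq)
  have q: "?q \<in> eff_dom n h" using states_in_domain by auto
  have Rn: "x \<in> Rn n" "?q \<in> Rn n" using x q eff_dom_subset_Rn by auto
  have gap: "\<mu> / 2 * (norm (?q - x))\<^sup>2 \<le> F ?q - F x"
    using g_lower[OF Rn] opt[OF q] by linarith
  have "0 \<le> F ?q - F x" by (rule order_trans[OF _ gap]) (use \<mu>_pos in simp)
  then have nonneg: "0 \<le> ?S * (F ?q - F x)" using S by simp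
  have pot: "?S * (F ?q - F x) + acg_theta (st j) / 2 * (norm (x - ?p))\<^sup>2 \<le> ?N / 2"
    by (rule potential_le[OF x])
  have "?S * (\<mu> / 2 * (norm (?q - x))\<^sup>2) \<le> ?S * (F ?q - F x)"
    using gap S by (intro mult_left_mono) auto
  moreover have "0 \<le> acg_theta (st j) / 2 * (norm (x - ?p))\<^sup>2"
    using seq.\<tau>_pos[of j] by simp
  ultimately have 1: "\<mu> * ?S * (norm (?q - x))\<^sup>2 \<le> ?N" using pot by (simp add: mult_ac)
  have "\<mu> * ?S * (norm (?p - x))\<^sup>2 \<le> acg_theta (st j) * (norm (?p - x))\<^sup>2"
    using seq.\<tau>_eq[of j] by (intro mult_right_mono) auto
  also have "\<dots> \<le> ?N" using pot nonneg by (simp add: norm_minus_commute)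
  finally have 2: "\<mu> * ?S * (norm (?p - x))\<^sup>2 \<le> ?N" .
  define S' where "S' = ?S + acg_s L (st j)"
  have S': "0 < S'" using S by (simp add: S'_def)
  have "(?S + acg_s L (st j)) *\<^sub>R (acg_ptilde L (st j) - x)
      = ?S *\<^sub>R (?q - x) + acg_s L (st j) *\<^sub>R (?p - x)"
    using S' unfolding acg_ptilde_def acg_S'_def S'_def[symmetric]
    by (simp add: scaleR_add_right scaleR_diff_right) (simp add: S'_def scaleR_add_left)
  then have "S' * (norm (acg_ptilde L (st j) - x))\<^sup>2
      \<le> ?S * (norm (?q - x))\<^sup>2 + acg_s L (st j) * (norm (?p - x))\<^sup>2"
    unfolding S'_def using S by (intro weighted_norm_sq_le) auto
  then have "\<mu> * ?S * (S' * (norm (acg_ptilde L (st j) - x))\<^sup>2)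
      \<le> \<mu> * ?S * (?S * (norm (?q - x))\<^sup>2 + acg_s L (st j) * (norm (?p - x))\<^sup>2)"
    using S \<mu>_pos by (intro mult_left_mono) auto
  also have "\<dots> = ?S * (\<mu> * ?S * (norm (?q - x))\<^sup>2) + acg_s L (st j) * (\<mu> * ?S * (norm (?p - x))\<^sup>2)"
    by (simp add: algebra_simps)
  also have "\<dots> \<le> ?S * ?N + acg_s L (st j) * ?N"
    using S by (intro add_mono mult_left_mono 1 2) auto
  also have "\<dots> = S' * ?N" by (simp add: S'_def algebra_simps)
  finally have "S' * (\<mu> * ?S * (norm (acg_ptilde L (st j) - x))\<^sup>2) \<le> S' * ?N"
    by (simp add: mult_ac)
  then show ?thesis using S' by simp
qed

end


section \<open>The accelerated dual iteration\<close>

text \<open>The outer loop in an abstract inner product space: \<open>res k\<close> stands for the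
  residual of the new primal point, \<open>d\<close> for the perturbed dual without its quadratic in
  the multiplier, and \<open>e k\<close> for the inexactness of the inner solve.\<close>

locale inexact_dual = accel_seq \<rho> \<gamma> B \<tau>
  for \<rho> \<gamma> :: real and B \<tau> :: "nat \<Rightarrow> real" +
  fixes lam nu res :: "nat \<Rightarrow> 'a::real_inner" and d :: "'a \<Rightarrow> real" and e :: "nat \<Rightarrow> real"
    and Y :: "'a set" and l :: 'a
  assumes nu_0: "nu 0 = 0"
    and lam_Suc: "lam (Suc k) = (B k / B (Suc k)) *\<^sub>R lam k + (b k / B (Suc k)) *\<^sub>R nu k + \<rho> *\<^sub>R res k"
    and nu_Suc: "nu (Suc k) = (1 / \<tau> (Suc k)) *\<^sub>R (\<tau> k *\<^sub>R nu k + b k *\<^sub>R res k)"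
    and lam_Y: "lam k \<in> Y" and l_Y: "l \<in> Y"
    and supergrad: "y \<in> Y \<Longrightarrow> d y \<le> d (lam (Suc k)) + e k + inner (y - lam (Suc k)) (res k)"
    and maximizer: "y \<in> Y \<Longrightarrow> d y - \<gamma> / 2 * (norm y)\<^sup>2 \<le> d l - \<gamma> / 2 * (norm l)\<^sup>2"
begin

definition Dg :: "'a \<Rightarrow> real"
  where "Dg y = d y - \<gamma> / 2 * (norm y)\<^sup>2"

definition pot :: "nat \<Rightarrow> real"
  where "pot k = B k * (Dg l - Dg (lam k)) + \<tau> k / 2 * (norm (l - nu k))\<^sup>2"

lemma pot_ge: "\<tau> k / 2 * (norm (l - nu k))\<^sup>2 \<le> pot k"
  using maximizer[OF lam_Y[of k]] B_nonneg[of k] by (simp add: pot_def Dg_def)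

lemma pot_nonneg: "0 \<le> pot k"
  by (rule order_trans[OF _ pot_ge]) (use \<tau>_pos[of k] in simp)

text \<open>
  The last term is the price for extrapolating from the points \<open>lam k\<close>, which are proximal points
  of \<open>d\<close> and not of the regularized function \<open>Dg\<close>.
\<close>

lemma pot_Suc_le:
  "pot (Suc k) + \<rho> * B (Suc k) / 2 * (norm (res k))\<^sup>2
    \<le> pot k + B (Suc k) * e k
      + \<rho> * B (Suc k) / 2 * (\<gamma>\<^sup>2 * (1 + \<delta>)\<^sup>2 * (norm (nu (Suc k)))\<^sup>2)"
proof -
  let ?B' = "B (Suc k)" and ?\<tau>' = "\<tau> (Suc k)" and ?l' = "lam (Suc k)"
  let ?r = "res k" and ?n' = "nu (Suc k)"
  \<comment> \<open>This is the new \<open>nu\<close> before the shrinkage by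
    \<open>\<tau> k / \<tau> (Suc k)\<close> that the regularization causes.\<close>
  define u where "u = nu k + (b k / \<tau> k) *\<^sub>R ?r"
  have pos: "0 < ?B'" "0 < \<tau> k" "0 < ?\<tau>'" "0 < b k" "0 \<le> B k"
    using B_Suc_pos \<tau>_pos b_pos B_nonneg by auto
  have B': "?B' = B k + b k" and \<tau>': "?\<tau>' = \<tau> k + \<gamma> * b k"
    by (simp_all add: B_Suc \<tau>_Suc)
  have bb: "b k * b k = \<rho> * ?B' * \<tau> k" using b_sq[of k] by (simp add: power2_eq_square mult_ac)
  have bu: "b k * (b k / \<tau> k) = \<rho> * ?B'" using bb pos by (simp add: field_simps)
  have B'l': "?B' *\<^sub>R ?l' = B k *\<^sub>R lam k + b k *\<^sub>R nu k + (\<rho> * ?B') *\<^sub>R ?r"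
    using pos by (simp add: lam_Suc[of k] scaleR_add_right mult.commute)
  \<comment> \<open>Because \<open>b k * (b k / \<tau> k)\<close> equals
    \<open>\<rho> * B (Suc k)\<close>, the new \<open>lam\<close> is precisely the convex
    combination of the old one and \<open>u\<close>.\<close>
  have cvx: "?B' * (norm ?l')\<^sup>2 \<le> B k * (norm (lam k))\<^sup>2 + b k * (norm u)\<^sup>2"
  proof -
    have "(B k + b k) *\<^sub>R ?l' = B k *\<^sub>R lam k + b k *\<^sub>R u"
      unfolding B'[symmetric] B'l' u_def by (simp only: scaleR_add_right scaleR_scaleR bu) simp
    then show ?thesis unfolding B' using pos by (intro weighted_norm_sq_le) auto
  qed
  have lin: "B k * d (lam k) + b k * d l \<le> ?B' * (d ?l' + e k) + b k * inner (l - nu k) ?r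
      - ?B' * \<rho> * (norm ?r)\<^sup>2"
  proof -
    have "B k * d (lam k) \<le> B k * (d ?l' + e k + inner (lam k - ?l') ?r)"
      by (intro mult_left_mono supergrad lam_Y pos)
    moreover have "b k * d l \<le> b k * (d ?l' + e k + inner (l - ?l') ?r)"
      using pos by (intro mult_left_mono supergrad l_Y) auto
    moreover have "B k * inner (lam k - ?l') ?r + b k * inner (l - ?l') ?r
        = b k * inner (l - nu k) ?r - ?B' * \<rho> * (norm ?r)\<^sup>2"
    proof -
      have "B k *\<^sub>R (lam k - ?l') + b k *\<^sub>R (l - ?l') = (B k *\<^sub>R lam k + b k *\<^sub>R l) - ?B' *\<^sub>R ?l'"
        by (simp add: B' algebra_simps)
      also have "\<dots> = b k *\<^sub>R (l - nu k) - (\<rho> * ?B') *\<^sub>R ?r"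
        unfolding B'l' by (simp add: algebra_simps)
      finally have "inner (B k *\<^sub>R (lam k - ?l') + b k *\<^sub>R (l - ?l')) ?r
          = inner (b k *\<^sub>R (l - nu k) - (\<rho> * ?B') *\<^sub>R ?r) ?r" by simp
      then show ?thesis
        by (simp add: inner_add_left inner_diff_left power2_norm_eq_inner mult_ac)
    qed
    ultimately show ?thesis by (simp add: B' algebra_simps)
  qed
  have n': "?\<tau>' *\<^sub>R ?n' = \<tau> k *\<^sub>R u"
    using pos by (simp add: nu_Suc u_def scaleR_add_right)
  have n'_u: "?\<tau>' * (norm ?n')\<^sup>2 = \<tau> k * \<tau> k / ?\<tau>' * (norm u)\<^sup>2"
  proof -
    have "(norm (?\<tau>' *\<^sub>R ?n'))\<^sup>2 = (norm (\<tau> k *\<^sub>R u))\<^sup>2" by (simp only: n')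
    then show ?thesis
      using pos by (simp add: power_mult_distrib power2_eq_square field_simps)
  qed
  have sq1: "?\<tau>' * (norm (l - ?n'))\<^sup>2 = \<tau> k * (norm (l - u))\<^sup>2 + \<gamma> * b k * (norm l)\<^sup>2
      - \<tau> k * (norm u)\<^sup>2 + ?\<tau>' * (norm ?n')\<^sup>2"
  proof -
    have "inner l (?\<tau>' *\<^sub>R ?n') = inner l (\<tau> k *\<^sub>R u)" by (simp only: n')
    then have "?\<tau>' * inner l ?n' = \<tau> k * inner l u" by simp
    then have "2 * (?\<tau>' * inner l ?n') = 2 * (\<tau> k * inner l u)" by simp
    moreover have "?\<tau>' * (norm l)\<^sup>2 = \<tau> k * (norm l)\<^sup>2 + \<gamma> * b k * (norm l)\<^sup>2"
      by (simp add: \<tau>' algebra_simps)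
    ultimately show ?thesis
      by (simp add: power2_norm_eq_inner inner_diff_left inner_diff_right inner_commute algebra_simps)
  qed
  have sq2: "\<tau> k * (norm (l - u))\<^sup>2 = \<tau> k * (norm (l - nu k))\<^sup>2 - 2 * b k * inner (l - nu k) ?r
      + \<rho> * ?B' * (norm ?r)\<^sup>2"
  proof -
    have "(norm (l - (nu k + c *\<^sub>R ?r)))\<^sup>2 = (norm (l - nu k))\<^sup>2 - 2 * c * inner (l - nu k) ?r
        + c * c * (norm ?r)\<^sup>2" for c
      by (simp add: power2_norm_eq_inner inner_add_left inner_add_right inner_diff_left
          inner_diff_right inner_commute algebra_simps)
    from this[of "b k / \<tau> k"]
    have "(norm (l - u))\<^sup>2 = (norm (l - nu k))\<^sup>2 - 2 * (b k / \<tau> k) * inner (l - nu k) ?r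
        + (b k / \<tau> k) * (b k / \<tau> k) * (norm ?r)\<^sup>2"
      unfolding u_def .
    moreover have "\<tau> k * ((b k / \<tau> k) * (b k / \<tau> k)) = \<rho> * ?B'"
      using bu pos by simp
    moreover have "\<tau> k * (2 * (b k / \<tau> k)) = 2 * b k"
      using pos by simp
    ultimately show ?thesis
      by (simp only: distrib_left right_diff_distrib mult.assoc[symmetric])
  qed
  \<comment> \<open>Expressed through the shrunken point, the mismatch is
    \<open>\<gamma>\<^sup>2 * (b k)\<^sup>2\<close> times a ratio of the \<tau> values. The
    quadratic relation for \<open>b\<close> and \<open>\<tau>_Suc_le\<close> give the stated
    form.\<close>
  have err: "\<gamma> * b k * (norm u)\<^sup>2 - \<tau> k * (norm u)\<^sup>2 + ?\<tau>' * (norm ?n')\<^sup>2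
      \<le> \<rho> * ?B' * (\<gamma>\<^sup>2 * (1 + \<delta>)\<^sup>2 * (norm ?n')\<^sup>2)"
  proof -
    have nu: "(norm u)\<^sup>2 = ?\<tau>' / \<tau> k * (?\<tau>' / \<tau> k) * (norm ?n')\<^sup>2"
      using n'_u pos by (simp add: field_simps)
    have "\<gamma> * b k * (norm u)\<^sup>2 - \<tau> k * (norm u)\<^sup>2 + ?\<tau>' * (norm ?n')\<^sup>2
        = ((\<gamma> * b k - \<tau> k) * (?\<tau>' / \<tau> k * (?\<tau>' / \<tau> k)) + ?\<tau>') * (norm ?n')\<^sup>2"
    proof -
      have "\<gamma> * b k * (X * y) - \<tau> k * (X * y) + t * y = ((\<gamma> * b k - \<tau> k) * X + t) * y" for X y t
        by (simp add: algebra_simps)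
      then show ?thesis unfolding nu .
    qed
    also have "(\<gamma> * b k - \<tau> k) * (?\<tau>' / \<tau> k * (?\<tau>' / \<tau> k)) + ?\<tau>'
        = ((\<gamma> * b k - \<tau> k) * (\<tau> k + \<gamma> * b k) + \<tau> k * \<tau> k) * ?\<tau>' / (\<tau> k * \<tau> k)"
      using pos by (simp add: \<tau>'[symmetric] field_simps)
    also have "(\<gamma> * b k - \<tau> k) * (\<tau> k + \<gamma> * b k) + \<tau> k * \<tau> k = \<gamma>\<^sup>2 * (b k * b k)"
      by (simp add: algebra_simps power2_eq_square)
    also have "\<gamma>\<^sup>2 * (b k * b k) * ?\<tau>' / (\<tau> k * \<tau> k) = \<rho> * ?B' * \<gamma>\<^sup>2 * (?\<tau>' / \<tau> k)"
      unfolding bb using pos by (simp add: field_simps)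
    also have "\<rho> * ?B' * \<gamma>\<^sup>2 * (?\<tau>' / \<tau> k) * (norm ?n')\<^sup>2
        \<le> \<rho> * ?B' * \<gamma>\<^sup>2 * (1 + \<delta>)\<^sup>2 * (norm ?n')\<^sup>2"
      using pos r_pos \<tau>_Suc_le[of k]
      by (intro mult_right_mono mult_left_mono) (simp_all add: pos_divide_le_eq)
    finally show ?thesis by (simp add: mult_ac)
  qed
  have "?B' * (Dg l - Dg ?l') \<le> B k * (Dg l - Dg (lam k)) + ?B' * e k
      + b k * inner (l - nu k) ?r - ?B' * \<rho> * (norm ?r)\<^sup>2 - \<gamma> * b k / 2 * (norm l)\<^sup>2
      + \<gamma> * b k / 2 * (norm u)\<^sup>2"
  proof -
    have "\<gamma> / 2 * (?B' * (norm ?l')\<^sup>2) \<le> \<gamma> / 2 * (B k * (norm (lam k))\<^sup>2 + b k * (norm u)\<^sup>2)"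
      using \<gamma>_pos by (intro mult_left_mono cvx) auto
    then show ?thesis
      using lin by (simp add: Dg_def B' algebra_simps add_divide_distrib)
  qed
  moreover have "?\<tau>' / 2 * (norm (l - ?n'))\<^sup>2 = \<tau> k / 2 * (norm (l - nu k))\<^sup>2
      - b k * inner (l - nu k) ?r + \<rho> * ?B' / 2 * (norm ?r)\<^sup>2 + \<gamma> * b k / 2 * (norm l)\<^sup>2
      - \<tau> k / 2 * (norm u)\<^sup>2 + ?\<tau>' / 2 * (norm ?n')\<^sup>2"
    using sq1 unfolding sq2 by (simp add: field_simps)
  moreover have "\<gamma> * b k / 2 * (norm u)\<^sup>2 - \<tau> k / 2 * (norm u)\<^sup>2 + ?\<tau>' / 2 * (norm ?n')\<^sup>2
      \<le> \<rho> * ?B' / 2 * (\<gamma>\<^sup>2 * (1 + \<delta>)\<^sup>2 * (norm ?n')\<^sup>2)"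
    using err by (simp add: field_simps)
  moreover have "?B' * \<rho> * (norm ?r)\<^sup>2 = \<rho> * ?B' / 2 * (norm ?r)\<^sup>2 + \<rho> * ?B' / 2 * (norm ?r)\<^sup>2"
    by (simp add: field_simps)
  ultimately show ?thesis
    unfolding pot_def by linarith
qed

lemma pot_sum_le:
  "pot k + (\<Sum>i<k. \<rho> * B (Suc i) / 2 * (norm (res i))\<^sup>2)
    \<le> (norm l)\<^sup>2 / 2 + (\<Sum>i<k. B (Suc i) * e i)
      + (\<Sum>i<k. \<rho> * B (Suc i) / 2 * (\<gamma>\<^sup>2 * (1 + \<delta>)\<^sup>2 * (norm (nu (Suc i)))\<^sup>2))"
proof (induction k)
  case 0
  show ?case by (simp add: pot_def B_0 \<tau>_0 nu_0)
next
  case (Suc k)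
  then show ?case using pot_Suc_le[of k] by simp
qed

text \<open>The inexactness consists of a part with bounded weighted sum and a constant floor
  \<open>einf\<close>. By \<open>sum_B_le\<close> the floor accumulates to at most
  \<open>einf * (1 + \<delta>) / (\<delta> * \<gamma>)\<close> times \<tau>, which explains the last
  term in the condition on \<open>N\<close>.\<close>

context
  fixes a :: "nat \<Rightarrow> real" and A einf Rh N \<epsilon> :: real
  assumes e_le: "\<And>i. e i \<le> a i + einf" and a_sum: "\<And>k. (\<Sum>i<k. B (Suc i) * a i) \<le> A"
    and einf: "0 \<le> einf" and \<delta>_le: "\<delta> \<le> 1 / 10" and l_le: "norm l \<le> Rh"
    and N: "0 \<le> N" "14 / 5 * (2 * Rh\<^sup>2 + 2 * A + 2 * einf * (1 + \<delta>) / (\<delta> * \<gamma>)) \<le> N\<^sup>2"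
begin

lemma e_sum_le: "(\<Sum>i<k. B (Suc i) * e i) \<le> A + einf * (\<Sum>i<k. B (Suc i))"
proof -
  have "(\<Sum>i<k. B (Suc i) * e i) \<le> (\<Sum>i<k. B (Suc i) * (a i + einf))"
    using B_nonneg by (intro sum_mono mult_left_mono e_le)
  also have "\<dots> = (\<Sum>i<k. B (Suc i) * a i) + einf * (\<Sum>i<k. B (Suc i))"
    by (simp add: distrib_left sum.distrib sum_distrib_left mult.commute)
  finally show ?thesis using a_sum[of k] by linarith
qed

lemma nu_sum_le:
  assumes "\<And>i. i < k \<Longrightarrow> norm (nu (Suc i)) \<le> K"
  shows "(\<Sum>i<k. \<rho> * B (Suc i) / 2 * (\<gamma>\<^sup>2 * (1 + \<delta>)\<^sup>2 * (norm (nu (Suc i)))\<^sup>2))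
    \<le> \<rho> / 2 * (\<gamma>\<^sup>2 * (1 + \<delta>)\<^sup>2 * K\<^sup>2) * (\<Sum>i<k. B (Suc i))"
proof -
  have "(\<Sum>i<k. \<rho> * B (Suc i) / 2 * (\<gamma>\<^sup>2 * (1 + \<delta>)\<^sup>2 * (norm (nu (Suc i)))\<^sup>2))
      \<le> (\<Sum>i<k. \<rho> * B (Suc i) / 2 * (\<gamma>\<^sup>2 * (1 + \<delta>)\<^sup>2 * K\<^sup>2))"
    using assms r_pos B_nonneg by (intro sum_mono mult_left_mono power_mono) auto
  also have "\<dots> = \<rho> / 2 * (\<gamma>\<^sup>2 * (1 + \<delta>)\<^sup>2 * K\<^sup>2) * (\<Sum>i<k. B (Suc i))"
    unfolding sum_distrib_left by (intro sum.cong) auto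
  finally show ?thesis .
qed

text \<open>At a first violation the current iterate is the largest so far, so all earlier error
  terms are bounded by its own norm. They return with a small coefficient and are absorbed.\<close>

lemma norm_nu_le: "norm (nu k) \<le> N"
proof (induction k rule: less_induct)
  case (less k)
  show ?case
  proof (rule ccontr)
    assume "\<not> ?case"
    then have gt: "N < norm (nu k)" by simp
    define M S where "M = norm (nu k)" and "S = (\<Sum>i<k. B (Suc i))"
    have M: "N < M" "0 < M" using gt N by (auto simp: M_def)
    have "norm (nu (Suc i)) \<le> M" if "i < k" for i
      using less[of "Suc i"] that M by (cases "Suc i = k") (auto simp: M_def)
    then have nus: "(\<Sum>i<k. \<rho> * B (Suc i) / 2 * (\<gamma>\<^sup>2 * (1 + \<delta>)\<^sup>2 * (norm (nu (Suc i)))\<^sup>2))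
        \<le> \<rho> / 2 * (\<gamma>\<^sup>2 * (1 + \<delta>)\<^sup>2 * M\<^sup>2) * S"
      unfolding S_def by (rule nu_sum_le)
    have "0 \<le> (\<Sum>i<k. \<rho> * B (Suc i) / 2 * (norm (res i))\<^sup>2)"
      using r_pos B_nonneg by (intro sum_nonneg) auto
    moreover have "(norm l)\<^sup>2 \<le> Rh\<^sup>2" using l_le by (intro power_mono) auto
    ultimately have main: "\<tau> k / 2 * (norm (l - nu k))\<^sup>2 \<le> Rh\<^sup>2 / 2 + A + einf * S
        + \<rho> / 2 * (\<gamma>\<^sup>2 * (1 + \<delta>)\<^sup>2 * M\<^sup>2) * S"
      using pot_sum_le[of k] pot_ge[of k] e_sum_le[of k] nus unfolding S_def by linarith
    define T where "T = (1 + \<delta>) / (\<delta> * \<gamma>)"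
    have S: "S \<le> T * \<tau> k"
    proof -
      have "\<delta> * S * \<gamma> \<le> (1 + \<delta>) * B k * \<gamma>"
        using sum_B_le[of k] \<gamma>_pos by (intro mult_right_mono) (auto simp: S_def)
      also have "\<dots> \<le> (1 + \<delta>) * \<tau> k"
        using \<delta>_pos by (simp add: \<tau>_eq algebra_simps)
      finally show ?thesis using \<delta>_pos \<gamma>_pos by (simp add: T_def field_simps)
    qed
    have "einf * S + \<rho> / 2 * (\<gamma>\<^sup>2 * (1 + \<delta>)\<^sup>2 * M\<^sup>2) * S
        = (einf + \<rho> / 2 * (\<gamma>\<^sup>2 * (1 + \<delta>)\<^sup>2 * M\<^sup>2)) * S" by (simp add: algebra_simps)
    also have "\<dots> \<le> (einf + \<rho> / 2 * (\<gamma>\<^sup>2 * (1 + \<delta>)\<^sup>2 * M\<^sup>2)) * (T * \<tau> k)"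
      using einf r_pos by (intro mult_left_mono S) auto
    also have "\<dots> = (einf * T + \<delta> * (1 + \<delta>) ^ 3 / 2 * M\<^sup>2) * \<tau> k"
    proof -
      have T: "\<rho> * \<gamma>\<^sup>2 * T = \<delta> * (1 + \<delta>)"
      proof -
        have "\<rho> * \<gamma>\<^sup>2 = \<delta> * (\<delta> * \<gamma>)"
          using \<delta>_sq by (simp add: power2_eq_square)
        then show ?thesis using \<delta>_pos \<gamma>_pos by (simp add: T_def)
      qed
      have "\<rho> / 2 * (\<gamma>\<^sup>2 * (1 + \<delta>)\<^sup>2 * M\<^sup>2) * T = \<delta> * (1 + \<delta>) / 2 * (1 + \<delta>)\<^sup>2 * M\<^sup>2"
        unfolding arg_cong[OF T, of "\<lambda>x. x / 2 * (1 + \<delta>)\<^sup>2 * M\<^sup>2", symmetric] by (simp add: mult_ac)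
      also have "\<dots> = \<delta> * (1 + \<delta>) ^ 3 / 2 * M\<^sup>2"
        by (simp add: power2_eq_square power3_eq_cube)
      finally have *: "\<rho> / 2 * (\<gamma>\<^sup>2 * (1 + \<delta>)\<^sup>2 * M\<^sup>2) * T = \<delta> * (1 + \<delta>) ^ 3 / 2 * M\<^sup>2" .
      have "(einf + X) * (T * \<tau> k) = (einf * T + X * T) * \<tau> k" for X
        by (simp add: algebra_simps)
      then show ?thesis unfolding *[symmetric] .
    qed
    finally have "\<tau> k / 2 * (norm (l - nu k))\<^sup>2
        \<le> Rh\<^sup>2 / 2 + A + (einf * T + \<delta> * (1 + \<delta>) ^ 3 / 2 * M\<^sup>2) * \<tau> k"
      using main by linarith
    \<comment> \<open>Since \<tau> is at least 1, the remaining constants may be multiplied by it,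
      after which \<tau> cancels.\<close>
    moreover have A0: "0 \<le> A" using a_sum[of 0] by simp
    then have "0 \<le> (Rh\<^sup>2 / 2 + A) * (\<tau> k - 1)"
      using \<tau>_ge_1[of k] by (intro mult_nonneg_nonneg) auto
    ultimately have "\<tau> k * ((norm (l - nu k))\<^sup>2 / 2)
        \<le> \<tau> k * (Rh\<^sup>2 / 2 + A + einf * T + \<delta> * (1 + \<delta>) ^ 3 / 2 * M\<^sup>2)"
      by (simp add: algebra_simps add_divide_distrib diff_divide_distrib)
    then have "(norm (l - nu k))\<^sup>2 / 2 \<le> Rh\<^sup>2 / 2 + A + einf * T + \<delta> * (1 + \<delta>) ^ 3 / 2 * M\<^sup>2"
      using \<tau>_pos[of k] by simp
    moreover have "\<delta> * (1 + \<delta>) ^ 3 / 2 * M\<^sup>2 \<le> 1 / 14 * M\<^sup>2"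
    proof (rule mult_right_mono)
      have "\<delta> * (1 + \<delta>) ^ 3 \<le> (1 / 10) * (1 + 1 / 10) ^ 3"
        using \<delta>_le \<delta>_pos by (intro mult_mono power_mono) auto
      then show "\<delta> * (1 + \<delta>) ^ 3 / 2 \<le> 1 / 14" by (simp add: power3_eq_cube)
    qed simp
    moreover have "M\<^sup>2 \<le> 2 * Rh\<^sup>2 + 2 * (norm (l - nu k))\<^sup>2"
    proof -
      have "M \<le> Rh + norm (l - nu k)"
        using l_le norm_triangle_ineq4[of l "l - nu k"] by (simp add: M_def)
      then have "M\<^sup>2 \<le> (Rh + norm (l - nu k))\<^sup>2" using M by (intro power_mono) auto
      also have "\<dots> \<le> 2 * Rh\<^sup>2 + 2 * (norm (l - nu k))\<^sup>2"
        using sum_squares_bound[of Rh "norm (l - nu k)"] by (simp add: power2_sum)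
      finally show ?thesis .
    qed
    moreover have "14 / 5 * (2 * Rh\<^sup>2 + 2 * A + 2 * (einf * T)) \<le> N\<^sup>2"
      using N(2) by (simp add: T_def mult.assoc)
    \<comment> \<open>Inserting the first inequality into the third returns 2/7 of \<open>m\<close>
      to the right. Solving for \<open>m\<close> leaves the factor 2 / (1 - 2/7) = 14/5.\<close>
    moreover have "X / 2 \<le> R / 2 + A + E + Q \<Longrightarrow> Q \<le> 1 / 14 * m \<Longrightarrow> m \<le> 2 * R + 2 * X \<Longrightarrow>
        14 / 5 * (2 * R + 2 * A + 2 * E) \<le> n \<Longrightarrow> m \<le> n" for X R A E Q m n :: real
      by (simp add: field_simps)
    ultimately have "M\<^sup>2 \<le> N\<^sup>2" by blast
    then show False using M N by (simp add: power2_le_iff_abs_le)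
  qed
qed

text \<open>Weights increase, so indices from \<open>K0\<close> on carry at least half of the total
  weight \<open>S\<close>. If all their residuals were large, the gain would be at least \<rho>
  \<open>\<epsilon>\<^sup>2\<close> \<open>S\<close> / 4. The two error sums take 1/32 each, and the
  remaining 3/16 contradicts \<open>large\<close>. The start at \<open>K0\<close> leaves time for
  the inner tolerance to shrink.\<close>

lemma small_residual:
  assumes eps: "0 < \<epsilon>" and NN: "\<gamma>\<^sup>2 * (1 + \<delta>)\<^sup>2 * N\<^sup>2 \<le> \<epsilon>\<^sup>2 / 16" and einf_le: "einf \<le> \<rho> * \<epsilon>\<^sup>2 / 32"
    and K: "2 * K0 \<le> K" "0 < K" and large: "Rh\<^sup>2 / 2 + A < 3 / 16 * (\<rho> * \<epsilon>\<^sup>2 * B K)"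
  shows "\<exists>i. K0 \<le> i \<and> i < K \<and> norm (res i) \<le> \<epsilon>"
proof (rule ccontr)
  assume contra: "\<not> ?thesis"
  define S S1 where "S = (\<Sum>i<K. B (Suc i))" and "S1 = (\<Sum>i\<in>{K0..<K}. B (Suc i))"
  have S_half: "S \<le> 2 * S1"
  proof -
    have "(\<Sum>i<K0. B (Suc i)) \<le> (\<Sum>i<K0. B (Suc (i + K0)))"
      by (intro sum_mono B_mono) simp
    also have "\<dots> = (\<Sum>i\<in>{K0..<2 * K0}. B (Suc i))"
      using sum.shift_bounds_nat_ivl[of "\<lambda>i. B (Suc i)" 0 K0 K0]
      by (simp add: atLeast0LessThan mult_2)
    also have "\<dots> \<le> S1"
      unfolding S1_def using K B_nonneg by (intro sum_mono2) auto
    finally have "(\<Sum>i<K0. B (Suc i)) \<le> S1" .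
    moreover have "S = (\<Sum>i<K0. B (Suc i)) + S1"
      unfolding S_def S1_def using K
        sum.atLeastLessThan_concat[of 0 K0 K "\<lambda>i. B (Suc i)"] by (simp add: atLeast0LessThan)
    ultimately show ?thesis by linarith
  qed
  have "B K \<le> S"
  proof -
    obtain j where "K = Suc j" using K by (cases K) auto
    then show ?thesis unfolding S_def
      using sum_nonneg[of "{..<j}" "\<lambda>i. B (Suc i)"] B_nonneg by simp
  qed
  have "\<rho> / 2 * \<epsilon>\<^sup>2 * S1 \<le> (\<Sum>i\<in>{K0..<K}. \<rho> * B (Suc i) / 2 * (norm (res i))\<^sup>2)"
  proof -
    have "\<rho> / 2 * \<epsilon>\<^sup>2 * S1 = (\<Sum>i\<in>{K0..<K}. \<rho> * B (Suc i) / 2 * \<epsilon>\<^sup>2)"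
      unfolding S1_def sum_distrib_left by (intro sum.cong) auto
    also have "\<dots> \<le> (\<Sum>i\<in>{K0..<K}. \<rho> * B (Suc i) / 2 * (norm (res i))\<^sup>2)"
      using contra eps r_pos B_nonneg by (intro sum_mono mult_left_mono power_mono) auto
    finally show ?thesis .
  qed
  also have "\<dots> \<le> (\<Sum>i<K. \<rho> * B (Suc i) / 2 * (norm (res i))\<^sup>2)"
    using r_pos B_nonneg by (intro sum_mono2) auto
  also have "\<dots> \<le> Rh\<^sup>2 / 2 + A + einf * S + \<rho> / 2 * (\<gamma>\<^sup>2 * (1 + \<delta>)\<^sup>2 * N\<^sup>2) * S"
  proof -
    have "(norm l)\<^sup>2 \<le> Rh\<^sup>2" using l_le by (intro power_mono) auto
    then show ?thesis
      using pot_sum_le[of K] pot_nonneg[of K] e_sum_le[of K] nu_sum_le[of K N, OF norm_nu_le]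
      unfolding S_def by linarith
  qed
  also have "einf * S \<le> \<rho> * \<epsilon>\<^sup>2 / 32 * S"
    using B_nonneg unfolding S_def by (intro mult_right_mono einf_le sum_nonneg) auto
  also have "\<rho> / 2 * (\<gamma>\<^sup>2 * (1 + \<delta>)\<^sup>2 * N\<^sup>2) * S \<le> \<rho> / 2 * (\<epsilon>\<^sup>2 / 16) * S"
    using B_nonneg r_pos unfolding S_def by (intro mult_right_mono mult_left_mono NN sum_nonneg) auto
  finally have "\<rho> * \<epsilon>\<^sup>2 / 2 * S1 \<le> Rh\<^sup>2 / 2 + A + \<rho> * \<epsilon>\<^sup>2 / 16 * S"
    by simp
  moreover have "\<rho> * \<epsilon>\<^sup>2 / 4 * S \<le> \<rho> * \<epsilon>\<^sup>2 / 4 * (2 * S1)"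
    using r_pos by (intro mult_left_mono S_half) auto
  moreover have "3 / 16 * (\<rho> * \<epsilon>\<^sup>2 * B K) \<le> 3 / 16 * (\<rho> * \<epsilon>\<^sup>2 * S)"
    using r_pos \<open>B K \<le> S\<close> by (intro mult_left_mono) auto
  ultimately show False using large by (simp add: algebra_simps)
qed

end

end


section \<open>Geometric growth\<close>

text \<open>From ln (1 + \<delta> / 2) \<ge> \<delta> / (2 + \<delta>), applied to an exponent
  \<open>2 * k\<close>. The rounding up of \<open>k\<close> accounts for the additive 1.\<close>

lemma exists_power_ge:
  fixes \<delta> W :: real
  assumes \<delta>: "0 < \<delta>" and W: "1 \<le> W"
  shows "\<exists>k::nat. W \<le> (1 + \<delta> / 2) ^ (2 * k) \<and> real k \<le> 1 + (1 / \<delta> + 1 / 2) * ln W"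
proof -
  define x where "x = (1 / \<delta> + 1 / 2) * ln W"
  have x: "0 \<le> x" using \<delta> W by (simp add: x_def)
  define k where "k = nat \<lceil>x\<rceil>"
  have k: "x \<le> real k" "real k \<le> 1 + x" using x by (auto simp: k_def) linarith
  have "\<delta> / (2 + \<delta>) \<le> ln (1 + \<delta> / 2)"
  proof -
    have "- ln (1 + \<delta> / 2) = ln (1 + (- (\<delta> / (2 + \<delta>))))"
      using \<delta> by (subst ln_inverse[symmetric]) (auto simp: field_simps)
    also have "\<dots> \<le> - (\<delta> / (2 + \<delta>))"
      using \<delta> by (intro ln_add_one_self_le_self2) (simp add: field_simps)
    finally show ?thesis by simp
  qed
  then have "2 * real k * (\<delta> / (2 + \<delta>)) \<le> 2 * real k * ln (1 + \<delta> / 2)"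
    by (intro mult_left_mono) auto
  moreover have "2 * x * (\<delta> / (2 + \<delta>)) \<le> 2 * real k * (\<delta> / (2 + \<delta>))"
    using k \<delta> by (intro mult_right_mono) auto
  moreover have "2 * x * (\<delta> / (2 + \<delta>)) = ln W"
  proof -
    have *: "2 * (1 / \<delta> + 1 / 2) * \<delta> = 2 + \<delta>" using \<delta> by (simp add: distrib_left distrib_right)
    have "2 * (1 / \<delta> + 1 / 2) * \<delta> / (2 + \<delta>) = 1" unfolding * using \<delta> by simp
    from arg_cong[OF this, of "\<lambda>t. ln W * t"]
    have "ln W * (2 * (1 / \<delta> + 1 / 2) * \<delta> / (2 + \<delta>)) = ln W" by (simp only: mult_1_right)
    moreover have "2 * (a * w) * (d / e) = w * (2 * a * d / e)" for a w d e :: real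
      by simp
    ultimately show ?thesis unfolding x_def by metis
  qed
  ultimately have "ln W \<le> ln ((1 + \<delta> / 2) ^ (2 * k))"
    using \<delta> by (simp add: ln_realpow)
  then have "W \<le> (1 + \<delta> / 2) ^ (2 * k)"
    using W \<delta> by (subst (asm) ln_le_cancel_iff) auto
  then show ?thesis using k by (auto simp: x_def)
qed


section \<open>Runs of I-FALM\<close>

locale ifalm =
  fixes P :: problem and M :: params and r :: run
  assumes standing: "standing_assms P" and input: "ifalm_input P M" and run: "ifalm_run P M r"
begin

abbreviation hr :: "fvec \<Rightarrow> real" where "hr x \<equiv> real_of_ereal (hobj P x)"
abbreviation D :: real where "D \<equiv> diam P"

lemma h: "proper_closed_convex (nvar P) (hobj P)" and bounded_domh: "bounded (domh P)"
  and smooth_f: "smooth (nvar P) (Lf P) (fobj P)" and convex_f: "convex_on (Xsp P) (fobj P)"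
  and Lf_pos: "0 < Lf P" and D_ge_1: "1 \<le> D" and rhs_Y: "rhs P \<in> Ysp P"
  using standing unfolding standing_assms_def by blast+

lemma xinit: "xinit M \<in> domh P" and linit: "linit M = 0" and rho_pos: "0 < rho M"
  and gam_d_pos: "0 < gam_d M" and eps_pos: "0 < eps M" and eps0_ge: "eps M \<le> eps0 M"
  and gam_p_eq: "gam_p M = eps M / (2 * D)" and sig_pos: "0 < sig M"
  and alpha_nonneg: "0 \<le> alpha M" and alpha_less: "alpha M < 1 / (1 + sqrt (gam_d M * rho M))\<^sup>2"
  using input unfolding ifalm_input_def by blast+

lemma bounded_eff_dom: "bounded (eff_dom (nvar P) (hobj P))"
  using bounded_domh by (simp add: domh_def)

lemma domh_Xsp: "x \<in> domh P \<Longrightarrow> x \<in> Xsp P"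
  by (auto simp: domh_def eff_dom_def)

lemma domh_dist: "x \<in> domh P \<Longrightarrow> y \<in> domh P \<Longrightarrow> norm (x - y) \<le> D"
  using diameter_bounded_bound[OF bounded_domh] by (simp add: diam_def dist_norm)

lemma D_pos: "0 < D" using D_ge_1 by simp

lemma gam_p_pos: "0 < gam_p M" using eps_pos D_pos by (simp add: gam_p_eq)

lemma eps_k_pos: "0 < eps_k M k"
proof -
  have "0 \<le> 7 * eps0 M * alpha M ^ k" using eps0_ge eps_pos alpha_nonneg by simp
  moreover have "0 < sig M * rho M * (eps M)\<^sup>2" using sig_pos rho_pos eps_pos by simp
  ultimately show ?thesis by (simp add: eps_k_def)
qed

text \<open>The strong convexity modulus of the proximal term of the subproblem. Over the domain the
  gradient of that term stays below \<open>kappa k * D\<close>, half of the inner tolerance.\<close>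

definition kappa :: "nat \<Rightarrow> real"
  where "kappa k = eps_k M k / (4 * D\<^sup>2)"

lemma kappa_pos: "0 < kappa k" using eps_k_pos D_pos by (simp add: kappa_def)

lemma kappa_D: "kappa k * D = eps_k M k / (4 * D)"
  using D_pos by (simp add: kappa_def power2_eq_square)

lemma mu_k_eq: "mu_k P M k = gam_p M + kappa k" by (simp add: mu_k_def kappa_def)

lemma mu_k_pos: "0 < mu_k P M k" using gam_p_pos kappa_pos by (simp add: mu_k_eq add_pos_pos)

lemma M_rho_pos: "0 < M_rho P M"
  using Lf_pos rho_pos by (simp add: M_rho_def add_pos_nonneg)

lemma eta_pos: "0 < eta_k P M k" using mu_k_pos[of k] M_rho_pos by (simp add: eta_k_def add_pos_pos)

lemma eta_lip: "eta_k P M k * (M_rho P M + gam_p M) \<le> 1"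
  using M_rho_pos gam_p_pos kappa_pos[of k] by (simp add: eta_k_def mu_k_eq field_simps add_pos_pos)

lemma eta_mult: "(2 * M_rho P M + mu_k P M k) * eta_k P M k = 1"
  using mu_k_pos[of k] M_rho_pos by (simp add: eta_k_def add_pos_pos less_imp_neq[symmetric])

lemma xs_0: "xs r 0 = xinit M" and lams_0: "lams r 0 = 0" and nus_0: "nus r 0 = 0"
  using run unfolding ifalm_run_def linit by blast+

lemma acg_runs: "acg_run (nvar P) (sub_psi P M r k) (hobj P) (sub_g P M r k) (M_rho P M) (mu_k P M k)
    (xs r k) (acg_tr r k)"
  and xs_Suc: "xs r (Suc k) = x_tilde P M r k - eta_k P M k *\<^sub>R sub_gm P M r k (x_tilde P M r k)"
  and lams_Suc: "lams r (Suc k) = nu_tilde M r k + rho M *\<^sub>R resid P (xs r (Suc k))"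
  using run unfolding ifalm_run_def by blast+

sublocale outer: accel_seq "rho M" "gam_d M" "Bk M" "tauk M"
  by unfold_locales (use rho_pos gam_d_pos in \<open>simp_all add: mult.commute\<close>)

lemma bk_eq: "bk M k = outer.b k" by (simp add: bk_def)

lemma nus_Suc: "nus r (Suc k) = (1 / tauk M (Suc k)) *\<^sub>R
  (tauk M k *\<^sub>R nus r k + bk M k *\<^sub>R resid P (xs r (Suc k)))"
proof -
  define l' where "l' = (1 / (1 + gam_d M * rho M)) *\<^sub>R lams r (Suc k)"
  have "1 + gam_d M * rho M \<noteq> 0"
    using gam_d_pos rho_pos by (metis add_pos_pos less_numeral_extra(1) mult_pos_pos order_less_irrefl)
  then have "(1 + gam_d M * rho M) *\<^sub>R l' = nu_tilde M r k + rho M *\<^sub>R resid P (xs r (Suc k))"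
    by (simp add: l'_def lams_Suc)
  then have "(bk M k / rho M) *\<^sub>R ((1 + gam_d M * rho M) *\<^sub>R l')
      = (bk M k / rho M) *\<^sub>R (nu_tilde M r k + rho M *\<^sub>R resid P (xs r (Suc k)))" by simp
  moreover have "bk M k / rho M * (1 + gam_d M * rho M) = bk M k / rho M + bk M k * gam_d M"
    using rho_pos by (simp add: field_simps)
  ultimately have "(bk M k * gam_d M) *\<^sub>R l' - (bk M k / rho M) *\<^sub>R (nu_tilde M r k - l')
      = bk M k *\<^sub>R resid P (xs r (Suc k))"
    using rho_pos by (simp add: scaleR_add_right scaleR_add_left scaleR_diff_right)
      (simp add: algebra_simps)
  then have "tauk M k *\<^sub>R nus r k + (bk M k * gam_d M) *\<^sub>R l' - (bk M k / rho M) *\<^sub>R (nu_tilde M r k - l')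
      = tauk M k *\<^sub>R nus r k + bk M k *\<^sub>R resid P (xs r (Suc k))" by (simp add: algebra_simps)
  moreover have "nus r (Suc k) = (1 / tauk M (Suc k)) *\<^sub>R
            (tauk M k *\<^sub>R nus r k + (bk M k * gam_d M) *\<^sub>R l'
             - (bk M k / rho M) *\<^sub>R (nu_tilde M r k - l'))"
    using run unfolding ifalm_run_def Let_def l'_def by blast
  ultimately show ?thesis by simp
qed

lemma resid_Y: "resid P x \<in> Ysp P"
  using rhs_Y by (auto simp: resid_def)

lemma duals_Y: "lams r k \<in> Ysp P \<and> nus r k \<in> Ysp P"
proof (induction k)
  case (Suc k)
  then have nt: "nu_tilde M r k \<in> Ysp P" by (auto simp: nu_tilde_def)
  have "lams r (Suc k) \<in> Ysp P"
    unfolding lams_Suc using nt resid_Y by blast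
  moreover have "nus r (Suc k) \<in> Ysp P"
    unfolding nus_Suc using Suc resid_Y by blast
  ultimately show ?case by simp
qed (simp add: lams_0 nus_0)


subsection \<open>The inner method\<close>

lemma acg_instance:
  assumes x: "xs r k \<in> domh P"
  shows "acg (nvar P) (hobj P) (sub_g P M r k)
    (\<lambda>x. grad_Psi P M (nu_tilde M r k) x + kappa k *\<^sub>R (x - xs r k)) (sub_psi P M r k)
    (- gam_d M / 2 * (norm (nu_tilde M r k - linit M))\<^sup>2) (M_rho P M) (mu_k P M k) (xs r k) (acg_tr r k)"
proof
  note xX = domh_Xsp[OF x]
  have sub_g: "sub_g P M r k y = Psi P M (nu_tilde M r k) y + kappa k / 2 * (norm (y - xs r k))\<^sup>2" for y
    by (simp add: sub_g_def kappa_def)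
  show "has_grad (nvar P) (sub_g P M r k) y
      (grad_Psi P M (nu_tilde M r k) y + kappa k *\<^sub>R (y - xs r k))" if y: "y \<in> Xsp P" for y
  proof -
    have eq: "sub_g P M r k = (\<lambda>u. Psi P M (nu_tilde M r k) u + kappa k / 2 * (norm (u - xs r k))\<^sup>2)"
      by (rule ext) (rule sub_g)
    have "2 * (kappa k / 2) = kappa k" by simp
    from has_grad_add_quadratic[OF has_grad_Psi[OF smooth_f y domh_Xsp[OF xinit],
        of "nu_tilde M r k"] y xX, of "kappa k / 2"] show ?thesis
      unfolding eq \<open>2 * (kappa k / 2) = kappa k\<close> .
  qed
  show "sub_g P M r k y + inner (grad_Psi P M (nu_tilde M r k) y + kappa k *\<^sub>R (y - xs r k)) (z - y)
      + mu_k P M k / 2 * (norm (z - y))\<^sup>2 \<le> sub_g P M r k z" if "y \<in> Xsp P" "z \<in> Xsp P" for y z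
    using Psi_lower[OF convex_f smooth_f less_imp_le[OF rho_pos] that, of "nu_tilde M r k"]
    unfolding sub_g mu_k_eq norm_diff_sq_expand[of z "xs r k" y]
    by (simp add: inner_add_left algebra_simps add_divide_distrib)
  show "sub_g P M r k z \<le> sub_g P M r k y
      + inner (grad_Psi P M (nu_tilde M r k) y + kappa k *\<^sub>R (y - xs r k)) (z - y)
      + (M_rho P M + mu_k P M k) / 2 * (norm (z - y))\<^sup>2" if "y \<in> Xsp P" "z \<in> Xsp P" for y z
    using Psi_upper[OF smooth_f less_imp_le[OF rho_pos] that, of "nu_tilde M r k"]
    unfolding sub_g mu_k_eq norm_diff_sq_expand[of z "xs r k" y]
    by (simp add: inner_add_left algebra_simps add_divide_distrib)
  show "sub_psi P M r k y = hobj P y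
      + ereal (sub_g P M r k y + - gam_d M / 2 * (norm (nu_tilde M r k - linit M))\<^sup>2)" for y
    by (cases "hobj P y")
      (simp_all add: sub_psi_def auglagr_pert_def lagr_pert_def lagr_def phi_def sub_g_def Psi_def)
qed (use h bounded_eff_dom M_rho_pos mu_k_pos x acg_runs in \<open>auto simp: domh_def\<close>)

lemma x_tilde_X:
  assumes "xs r k \<in> domh P"
  shows "acg_ptilde (M_rho P M) (acg_tr r k j) \<in> Xsp P" "x_tilde P M r k \<in> Xsp P"
proof -
  interpret I: acg "nvar P" "hobj P" "sub_g P M r k"
    "\<lambda>x. grad_Psi P M (nu_tilde M r k) x + kappa k *\<^sub>R (x - xs r k)" "sub_psi P M r k"
    "- gam_d M / 2 * (norm (nu_tilde M r k - linit M))\<^sup>2" "M_rho P M" "mu_k P M k" "xs r k" "acg_tr r k"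
    by (rule acg_instance[OF assms])
  show "acg_ptilde (M_rho P M) (acg_tr r k j) \<in> Xsp P" "x_tilde P M r k \<in> Xsp P"
    using I.ptilde_in_Rn by (simp_all add: x_tilde_def)
qed

definition prox_grad :: "nat \<Rightarrow> fvec \<Rightarrow> fvec"
  where "prox_grad k x = x - eta_k P M k *\<^sub>R sub_gm P M r k x"

text \<open>The gradient mapping minus the gradient at \<open>x\<close> is a subgradient of the
  nonsmooth part at the new point. It refers to the objective without the proximal term, while its
  step length includes the modulus of that term.\<close>

lemma prox_grad:
  assumes x: "x \<in> Xsp P"
  shows "prox_grad k x \<in> domh P"
    and "u \<in> domh P \<Longrightarrow> hr (prox_grad k x) + inner (sub_gm P M r k x - grad_Psi P M (nu_tilde M r k) x) (u - prox_grad k x) \<le> hr u"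
proof -
  let ?\<eta> = "eta_k P M k" and ?g = "grad_Psi P M (nu_tilde M r k) x"
  have g: "grad (nvar P) (Psi P M (nu_tilde M r k)) x = ?g"
    by (rule grad_eqI[OF has_grad_Psi[OF smooth_f x domh_Xsp[OF xinit]] x])
  have y: "prox_grad k x = prox (nvar P) ?\<eta> (hobj P) (x - ?\<eta> *\<^sub>R ?g)"
    using eta_pos[of k] by (simp add: prox_grad_def sub_gm_def grad_map_def g)
  note p = prox_char[OF h bounded_eff_dom eta_pos]
  show "prox_grad k x \<in> domh P" unfolding y domh_def by (rule p)
  assume u: "u \<in> domh P"
  have "x - ?\<eta> *\<^sub>R ?g - prox_grad k x = ?\<eta> *\<^sub>R (sub_gm P M r k x - ?g)"
    by (simp add: prox_grad_def algebra_simps)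
  then have "?\<eta> * (hr (prox_grad k x) + inner (sub_gm P M r k x - ?g) (u - prox_grad k x)) \<le> ?\<eta> * hr u"
    using p(2)[of u k "x - ?\<eta> *\<^sub>R ?g"] u unfolding y[symmetric]
    by (simp add: domh_def distrib_left)
  then show "hr (prox_grad k x) + inner (sub_gm P M r k x - ?g) (u - prox_grad k x) \<le> hr u"
    using eta_pos[of k] by simp
qed

lemma xs_domh: "xs r k \<in> domh P"
proof (induction k)
  case (Suc k)
  then show ?case
    using prox_grad(1)[OF x_tilde_X(2)[OF Suc], of k] by (simp add: xs_Suc prox_grad_def)
qed (simp add: xs_0 xinit)

text \<open>Since \<open>z\<close> minimizes the subproblem with the proximal term, the mapping need
  not vanish there; this costs \<open>kappa k * D\<close>. Adding the optimality inequalities of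
  \<open>y\<close> and \<open>z\<close> bounds \<open>norm (z - y)\<close> by \<open>norm w\<close>,
  and the triangle inequality yields the factor 3.\<close>

lemma gradient_mapping_le:
  assumes x: "x \<in> Xsp P" and z: "z \<in> domh P"
    and opt: "\<And>u. u \<in> domh P \<Longrightarrow>
      hr z - inner (grad_Psi P M (nu_tilde M r k) z + kappa k *\<^sub>R (z - xs r k)) (u - z) \<le> hr u"
  shows "norm (sub_gm P M r k x) \<le> 3 * (2 * M_rho P M + mu_k P M k) * norm (x - z) + kappa k * D"
proof -
  let ?\<eta> = "eta_k P M k" and ?G = "sub_gm P M r k x"
  let ?gx = "grad_Psi P M (nu_tilde M r k) x" and ?gz = "grad_Psi P M (nu_tilde M r k) z"
  define y where "y = prox_grad k x"
  note \<eta> = eta_pos[of k]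
  have y: "y \<in> domh P" unfolding y_def by (rule prox_grad(1)[OF x])
  have yx: "?\<eta> *\<^sub>R ?G = x - y" by (simp add: y_def prox_grad_def)
  define w where "w = x - z - ?\<eta> *\<^sub>R (?gx - ?gz - kappa k *\<^sub>R (z - xs r k))"
  have "inner (?G - ?gx + (?gz + kappa k *\<^sub>R (z - xs r k))) (z - y) \<le> 0"
    using prox_grad(2)[OF x z, of k] opt[OF y] unfolding y_def[symmetric]
    by (simp add: inner_add_left inner_diff_right)
  then have "?\<eta> * inner (?G - ?gx + (?gz + kappa k *\<^sub>R (z - xs r k))) (z - y) \<le> 0"
    using \<eta> by (simp add: mult_le_0_iff)
  moreover have "?\<eta> *\<^sub>R (?G - ?gx + (?gz + kappa k *\<^sub>R (z - xs r k))) = (z - y) + w"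
    unfolding w_def scaleR_add_right[of ?\<eta> "?G - ?gx"] scaleR_diff_right[of ?\<eta> ?G] yx
    by (simp add: algebra_simps)
  ultimately have "inner ((z - y) + w) (z - y) \<le> 0"
    by (metis inner_scaleR_left)
  then have "(norm (z - y))\<^sup>2 \<le> inner (- w) (z - y)"
    by (simp add: inner_add_left power2_norm_eq_inner)
  also have "\<dots> \<le> norm w * norm (z - y)"
    using norm_cauchy_schwarz[of "- w" "z - y"] by simp
  finally have zy: "norm (z - y) \<le> norm w"
    by (cases "z = y") (simp_all add: power2_eq_square)
  have "norm w \<le> norm (x - z) + norm (?\<eta> *\<^sub>R (?gx - ?gz - kappa k *\<^sub>R (z - xs r k)))"
    unfolding w_def by (rule norm_triangle_ineq4)
  also have "norm (?\<eta> *\<^sub>R (?gx - ?gz - kappa k *\<^sub>R (z - xs r k)))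
      \<le> ?\<eta> * ((M_rho P M + gam_p M) * norm (x - z) + kappa k * D)"
  proof -
    have "norm (?gx - ?gz - kappa k *\<^sub>R (z - xs r k)) \<le> norm (?gx - ?gz) + norm (kappa k *\<^sub>R (z - xs r k))"
      by (rule norm_triangle_ineq4)
    also have "norm (kappa k *\<^sub>R (z - xs r k)) \<le> kappa k * D"
      using domh_dist[OF z xs_domh[of k]] kappa_pos[of k] by simp
    also have "norm (?gx - ?gz) \<le> (M_rho P M + gam_p M) * norm (x - z)"
      using rho_pos gam_p_pos by (intro grad_Psi_diff_le smooth_f x domh_Xsp[OF z]) auto
    finally show ?thesis using \<eta> by simp
  qed
  also have "\<dots> \<le> norm (x - z) + ?\<eta> * (kappa k * D)"
  proof -
    have "?\<eta> * ((M_rho P M + gam_p M) * norm (x - z)) \<le> norm (x - z)"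
      using mult_right_mono[OF eta_lip[of k] norm_ge_zero[of "x - z"]] by (simp only: mult.assoc mult_1_left)
    then show ?thesis unfolding distrib_left[of ?\<eta> "_ * _"] by simp
  qed
  finally have "norm (x - y) \<le> 3 * norm (x - z) + ?\<eta> * (kappa k * D)"
    using zy norm_triangle_ineq[of "x - z" "z - y"] by simp
  then have "?\<eta> * norm ?G \<le> 3 * norm (x - z) + ?\<eta> * (kappa k * D)"
    unfolding yx[symmetric] using \<eta> by simp
  also have "\<dots> = ?\<eta> * (3 * (2 * M_rho P M + mu_k P M k) * norm (x - z) + kappa k * D)"
    using arg_cong[OF eta_mult[of k], of "\<lambda>t. t * (3 * norm (x - z))"] by (simp add: algebra_simps)
  finally show ?thesis using \<eta> by simp
qed

text \<open>The growth of \<open>2 * M_rho P M * acgS\<close> that forces the stopping test of the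
  inner method; the maximum with 1 makes its logarithm nonnegative.\<close>

definition W_inner :: "nat \<Rightarrow> real"
  where "W_inner k = max 1 (2 * M_rho P M / mu_k P M k
    * (12 * D\<^sup>2 * (2 * M_rho P M + mu_k P M k) / eps_k M k)\<^sup>2)"

lemma acg_stops:
  "\<exists>j. acg_stop P M r k j \<and>
    real j \<le> 2 + (sqrt (2 * M_rho P M / mu_k P M k) + 1 / 2) * ln (W_inner k)"
proof -
  let ?L = "M_rho P M" and ?\<mu> = "mu_k P M k"
  interpret I: acg "nvar P" "hobj P" "sub_g P M r k"
    "\<lambda>x. grad_Psi P M (nu_tilde M r k) x + kappa k *\<^sub>R (x - xs r k)" "sub_psi P M r k"
    "- gam_d M / 2 * (norm (nu_tilde M r k - linit M))\<^sup>2" ?L ?\<mu> "xs r k" "acg_tr r k"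
    by (rule acg_instance[OF xs_domh])
  obtain z where z: "z \<in> domh P" and opt: "\<And>u. u \<in> domh P \<Longrightarrow>
      hr z - inner (grad_Psi P M (nu_tilde M r k) z + kappa k *\<^sub>R (z - xs r k)) (u - z) \<le> hr u"
    using I.minimizer unfolding domh_def by blast
  have W: "1 \<le> W_inner k" by (simp add: W_inner_def)
  obtain i where i: "W_inner k \<le> (1 + I.seq.\<delta> / 2) ^ (2 * i)"
    "real i \<le> 1 + (1 / I.seq.\<delta> + 1 / 2) * ln (W_inner k)"
    using exists_power_ge[OF I.seq.\<delta>_pos W] by blast
  define j where "j = Suc i"
  \<comment> \<open>At distance \<open>D / Q\<close> from the minimizer the first term of
    \<open>gradient_mapping_le\<close> is \<open>eps_k M k / (4 * D)\<close>, the other half of the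
    tolerance.\<close>
  define Q where "Q = 12 * D\<^sup>2 * (2 * ?L + ?\<mu>) / eps_k M k"
  define y where "y = acg_ptilde ?L (acg_tr r k j)"
  have Q: "0 < Q" using D_pos M_rho_pos mu_k_pos[of k] eps_k_pos[of k]
    by (simp add: Q_def add_pos_pos)
  have "1 / (2 * ?L) * W_inner k \<le> 1 / (2 * ?L) * (1 + I.seq.\<delta> / 2) ^ (2 * i)"
    using i M_rho_pos by (intro mult_left_mono) auto
  also have "\<dots> \<le> acgS (acg_tr r k j)"
    unfolding j_def by (rule I.seq.B_lower)
  finally have "?\<mu> * (1 / (2 * ?L) * W_inner k) \<le> ?\<mu> * acgS (acg_tr r k j)"
    using mu_k_pos[of k] by (intro mult_left_mono) auto
  moreover have "Q\<^sup>2 \<le> ?\<mu> * (1 / (2 * ?L) * W_inner k)"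
  proof -
    have "2 * ?L / ?\<mu> * Q\<^sup>2 \<le> W_inner k" by (simp add: W_inner_def Q_def)
    then show ?thesis using M_rho_pos mu_k_pos[of k] by (simp add: field_simps)
  qed
  ultimately have S: "Q\<^sup>2 \<le> ?\<mu> * acgS (acg_tr r k j)" by linarith
  have "(Q * norm (y - z))\<^sup>2 \<le> ?\<mu> * acgS (acg_tr r k j) * (norm (y - z))\<^sup>2"
    unfolding power_mult_distrib by (intro mult_right_mono S) simp
  also have "\<dots> \<le> (norm (z - xs r k))\<^sup>2"
    unfolding y_def using z opt by (intro I.ptilde_dist) (auto simp: domh_def j_def)
  also have "\<dots> \<le> D\<^sup>2"
    using domh_dist[OF z xs_domh[of k]] by (intro power_mono) auto
  finally have "Q * norm (y - z) \<le> D"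
    by (rule power2_le_imp_le) (use D_pos in simp)
  then have "3 * (2 * ?L + ?\<mu>) * norm (y - z) \<le> eps_k M k / (4 * D)"
  proof -
    have "D * (12 * D * (2 * ?L + ?\<mu>) * norm (y - z) / eps_k M k) \<le> D * 1"
      using \<open>Q * norm (y - z) \<le> D\<close> by (simp add: Q_def power2_eq_square mult_ac)
    then have "12 * D * (2 * ?L + ?\<mu>) * norm (y - z) / eps_k M k \<le> 1"
      using D_pos by (simp only: mult_le_cancel_left_pos)
    then show ?thesis using D_pos eps_k_pos[of k] by (simp add: pos_divide_le_eq pos_le_divide_eq mult_ac)
  qed
  moreover have "y \<in> Xsp P" unfolding y_def by (rule I.ptilde_in_Rn)
  ultimately have "norm (sub_gm P M r k y) \<le> eps_k M k / (4 * D) + eps_k M k / (4 * D)"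
    using gradient_mapping_le[OF _ z opt, of y] kappa_D[of k] by simp
  also have "\<dots> = eps_k M k / (2 * D)" by simp
  finally have "acg_stop P M r k j" by (simp add: acg_stop_def y_def)
  moreover have "1 / I.seq.\<delta> = sqrt (2 * ?L / ?\<mu>)"
    unfolding I.seq.\<delta>_def by (simp add: real_sqrt_divide real_sqrt_mult)
  ultimately show ?thesis using i(2) by (intro exI[of _ j]) (simp add: j_def)
qed

lemma acg_last_stop: "norm (sub_gm P M r k (x_tilde P M r k)) \<le> eps_k M k / (2 * D)"
proof -
  obtain j where "acg_stop P M r k j" using acg_stops by blast
  then have "acg_stop P M r k (acg_last P M r k)"
    unfolding acg_last_def by (rule LeastI)
  then show ?thesis by (simp add: x_tilde_def acg_stop_def)
qed

lemma acg_last_le: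
  "real (acg_last P M r k) \<le> 2 + (sqrt (2 * M_rho P M / mu_k P M k) + 1 / 2) * ln (W_inner k)"
proof -
  obtain j where j: "acg_stop P M r k j"
    "real j \<le> 2 + (sqrt (2 * M_rho P M / mu_k P M k) + 1 / 2) * ln (W_inner k)"
    using acg_stops by blast
  have "acg_last P M r k \<le> j" unfolding acg_last_def using j(1) by (rule Least_le)
  then have "real (acg_last P M r k) \<le> real j" by simp
  then show ?thesis using j(2) by linarith
qed


subsection \<open>The outer method\<close>

lemma xs_Suc_prox_grad: "xs r (Suc k) = prox_grad k (x_tilde P M r k)"
  by (simp add: xs_Suc prox_grad_def)

text \<open>
  \<open>V k\<close> is the subgradient at \<open>xs r (Suc k)\<close> of the function minimized in outer step \<open>k\<close> that the
  gradient mapping provides.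
\<close>

definition V :: "nat \<Rightarrow> fvec"
  where "V k = sub_gm P M r k (x_tilde P M r k) - grad_Psi P M (nu_tilde M r k) (x_tilde P M r k)
    + grad_Psi P M (nu_tilde M r k) (xs r (Suc k))"

text \<open>The change of the gradient over one step is at most the Lipschitz constant times the
  step length times the gradient mapping, and that step length is below the inverse Lipschitz
  constant.\<close>

lemma norm_V_le: "norm (V k) \<le> 2 * norm (sub_gm P M r k (x_tilde P M r k))"
proof -
  let ?G = "sub_gm P M r k (x_tilde P M r k)"
  have "norm (V k) \<le> norm ?G + norm (grad_Psi P M (nu_tilde M r k) (xs r (Suc k))
      - grad_Psi P M (nu_tilde M r k) (x_tilde P M r k))"
    unfolding V_def by (metis add_diff_eq diff_add_eq norm_triangle_ineq)
  also have "norm (grad_Psi P M (nu_tilde M r k) (xs r (Suc k))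
      - grad_Psi P M (nu_tilde M r k) (x_tilde P M r k))
     \<le> (M_rho P M + gam_p M) * norm (xs r (Suc k) - x_tilde P M r k)"
    using rho_pos gam_p_pos
    by (intro grad_Psi_diff_le smooth_f x_tilde_X xs_domh domh_Xsp[OF xs_domh]) auto
  also have "norm (xs r (Suc k) - x_tilde P M r k) = eta_k P M k * norm ?G"
    using eta_pos[of k] by (simp add: xs_Suc)
  also have "(M_rho P M + gam_p M) * (eta_k P M k * norm ?G) \<le> 1 * norm ?G"
    using mult_right_mono[OF eta_lip[of k] norm_ge_zero[of ?G]] by (simp add: mult_ac)
  finally show ?thesis by simp
qed

lemma grad_Psi_xs_Suc: "grad_Psi P M (nu_tilde M r k) (xs r (Suc k))
    = grad (nvar P) (fobj P) (xs r (Suc k)) + gam_p M *\<^sub>R (xs r (Suc k) - xinit M)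
      + appAT P (lams r (Suc k))"
  by (simp add: grad_Psi_def lams_Suc)

lemma stationarity:
  "u \<in> domh P \<Longrightarrow> hr (xs r (Suc k)) + inner (V k - grad_Psi P M (nu_tilde M r k) (xs r (Suc k)))
      (u - xs r (Suc k)) \<le> hr u"
  using prox_grad(2)[OF x_tilde_X(2)[OF xs_domh], of u k] by (simp add: V_def xs_Suc_prox_grad)

text \<open>Removing the gradient of the primal perturbation from \<open>V k\<close> leaves a
  stationarity residual of the original problem. The test gives eps / 2 for \<open>V k\<close>, and
  the choice of \<open>gam_p\<close> gives another eps / 2 for the perturbation.\<close>

lemma outer_stop_solution:
  assumes "outer_stop P M r k"
  shows "primal_dual_solution P (eps M) (xs r (Suc k)) (lams r (Suc k))"
proof -
  let ?x = "xs r (Suc k)"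
  define w where "w = V k - grad_Psi P M (nu_tilde M r k) ?x"
  have xd: "?x \<in> domh P" by (rule xs_domh)
  have "w = sub_gm P M r k (x_tilde P M r k) - grad_Psi P M (nu_tilde M r k) (x_tilde P M r k)"
    by (simp add: w_def V_def)
  moreover have "sub_gm P M r k (x_tilde P M r k) \<in> Xsp P"
  proof -
    have "sub_gm P M r k (x_tilde P M r k) = (1 / eta_k P M k) *\<^sub>R (x_tilde P M r k - ?x)"
      using eta_pos[of k] by (simp add: xs_Suc)
    then show ?thesis
      using x_tilde_X(2)[OF xs_domh] domh_Xsp[OF xd] by (metis Rn_intros(2,3))
  qed
  ultimately have wX: "w \<in> Xsp P"
    using grad_Psi_in_Xsp[OF smooth_f x_tilde_X(2)[OF xs_domh] domh_Xsp[OF xinit]] by auto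
  have w: "w \<in> subdiff (nvar P) (hobj P) ?x"
  proof -
    have "hobj P ?x + ereal (inner w (y - ?x)) \<le> hobj P y" if "y \<in> Xsp P" for y
    proof (cases "y \<in> domh P")
      case True
      have "hobj P ?x = ereal (hr ?x)" "hobj P y = ereal (hr y)"
        using ereal_real_eff_dom[OF h] xd True by (auto simp: domh_def)
      then show ?thesis using stationarity[OF True, of k]
        by (metis ereal_less_eq(3) plus_ereal.simps(1) w_def)
    next
      case False
      then show ?thesis using that by (simp add: domh_def eff_dom_def)
    qed
    then show ?thesis using wX xd by (simp add: subdiff_def domh_def)
  qed
  define v where "v = w + grad (nvar P) (fobj P) ?x + appAT P (lams r (Suc k))"
  have "v = V k - gam_p M *\<^sub>R (?x - xinit M)"
    by (simp add: v_def w_def grad_Psi_xs_Suc)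
  then have "norm v \<le> norm (V k) + norm (gam_p M *\<^sub>R (?x - xinit M))"
    using norm_triangle_ineq4[of "V k" "gam_p M *\<^sub>R (?x - xinit M)"] by simp
  also have "norm (V k) \<le> eps M / 2"
    using norm_V_le[of k] assms by (simp add: outer_stop_def)
  also have "norm (gam_p M *\<^sub>R (?x - xinit M)) \<le> gam_p M * D"
    using gam_p_pos domh_dist[OF xd xinit] by simp
  also have "gam_p M * D = eps M / 2"
    using D_pos by (simp add: gam_p_eq)
  finally have "norm v \<le> eps M" by simp
  moreover have "norm (resid P ?x) \<le> eps M" using assms by (simp add: outer_stop_def)
  ultimately show ?thesis
    unfolding primal_dual_solution_def using w duals_Y domh_Xsp[OF xd] by (auto simp: v_def)
qed

section \<open>The perturbed dual function and its approximate supergradients\<close>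

definition val :: "fvec \<Rightarrow> fvec \<Rightarrow> real"
  where "val l x = hr x + (fobj P x + inner l (resid P x) + gam_p M / 2 * (norm (x - xinit M))\<^sup>2)"

text \<open>The concave part of the perturbed dual, without the quadratic in the multiplier. Taking
  the infimum over the domain keeps it real-valued.\<close>

definition d0 :: "fvec \<Rightarrow> real"
  where "d0 l = (INF x\<in>domh P. val l x)"

lemma resid_continuous: "continuous_on S (resid P)"
  unfolding resid_def[abs_def]
  by (intro continuous_intros linear_continuous_on bounded_linear_appA)

lemma val_attained: "\<exists>x\<in>domh P. \<forall>u\<in>domh P. val l x \<le> val l u"
proof -
  have "continuous_on (Xsp P)
      (\<lambda>x. fobj P x + inner l (resid P x) + gam_p M / 2 * (norm (x - xinit M))\<^sup>2)"
    by (intro continuous_intros smooth_continuous_on[OF smooth_f] resid_continuous)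
  from argmin_exists[OF h bounded_eff_dom this zero_less_one]
  show ?thesis by (simp add: domh_def val_def)
qed

lemma d0_attained: "\<exists>x\<in>domh P. d0 l = val l x"
  and d0_le: "u \<in> domh P \<Longrightarrow> d0 l \<le> val l u"
proof -
  obtain x where x: "x \<in> domh P" "\<And>u. u \<in> domh P \<Longrightarrow> val l x \<le> val l u"
    using val_attained by blast
  then have "d0 l = val l x"
    unfolding d0_def by (intro cInf_eq_minimum) auto
  then show "\<exists>x\<in>domh P. d0 l = val l x" "u \<in> domh P \<Longrightarrow> d0 l \<le> val l u"
    using x by auto
qed

lemma dual_pert_eq: "dual_pert P M l = ereal (d0 l - gam_d M / 2 * (norm l)\<^sup>2)"
proof -
  let ?G = "\<lambda>x. fobj P x + inner l (resid P x) + gam_p M / 2 * (norm (x - xinit M))\<^sup>2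
    - gam_d M / 2 * (norm l)\<^sup>2"
  obtain x where x: "x \<in> domh P" "d0 l = val l x" using d0_attained by blast
  have "lagr_pert P M y l = hobj P y + ereal (?G y)" for y
    by (cases "hobj P y") (simp_all add: lagr_pert_def lagr_def phi_def linit)
  then have "dual_pert P M l = (INF y\<in>Xsp P. hobj P y + ereal (?G y))"
    by (simp add: dual_pert_def)
  also have "\<dots> = ereal (hr x + ?G x)"
    using x d0_le[of _ l] by (intro INF_ereal_eq h) (auto simp: domh_def val_def add.assoc)
  finally show ?thesis by (simp add: x(2) val_def algebra_simps)
qed

text \<open>Stationarity up to \<open>V k\<close>, paired with a displacement of length at most
  \<open>D\<close>, makes the new primal point an approximate minimizer of the Lagrangian at the new
  multiplier. For fixed primal point the Lagrangian is affine in the multiplier with slope the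
  residual.\<close>

lemma supergradient:
  "d0 y \<le> d0 (lams r (Suc k)) + eps_k M k + inner (y - lams r (Suc k)) (resid P (xs r (Suc k)))"
proof -
  let ?x = "xs r (Suc k)" and ?l = "lams r (Suc k)"
  have xd: "?x \<in> domh P" by (rule xs_domh)
  obtain u where u: "u \<in> domh P" "d0 ?l = val ?l u" using d0_attained by blast
  have "fobj P ?x + inner (grad (nvar P) (fobj P) ?x) (u - ?x) \<le> fobj P u"
    using xd u domh_Xsp by (intro convex_lower_bound[OF convex_f] smooth_has_grad[OF smooth_f]) auto
  moreover have "gam_p M / 2 * ((norm (?x - xinit M))\<^sup>2 + 2 * inner (?x - xinit M) (u - ?x))
      \<le> gam_p M / 2 * (norm (u - xinit M))\<^sup>2"
    using gam_p_pos unfolding norm_diff_sq_expand[of u "xinit M" ?x] by (intro mult_left_mono) auto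
  moreover have "inner ?l (resid P u) = inner ?l (resid P ?x) + inner (appAT P ?l) (u - ?x)"
  proof -
    have "resid P u = resid P ?x + appA P (u - ?x)" using resid_diff[of P u ?x] by (simp add: algebra_simps)
    then show ?thesis by (simp add: inner_add_right inner_appA)
  qed
  moreover have "hr ?x + inner (V k) (u - ?x)
      - inner (grad_Psi P M (nu_tilde M r k) ?x) (u - ?x) \<le> hr u"
    using stationarity[OF u(1), of k] by (simp add: inner_diff_left)
  moreover have "inner (grad_Psi P M (nu_tilde M r k) ?x) (u - ?x)
      = inner (grad (nvar P) (fobj P) ?x) (u - ?x) + gam_p M * inner (?x - xinit M) (u - ?x)
        + inner (appAT P ?l) (u - ?x)"
    unfolding grad_Psi_xs_Suc by (simp add: inner_add_left)
  moreover have "- inner (V k) (u - ?x) \<le> eps_k M k"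
  proof -
    have "- inner (V k) (u - ?x) \<le> norm (V k) * norm (u - ?x)"
      using norm_cauchy_schwarz[of "- V k" "u - ?x"] by simp
    also have "\<dots> \<le> (2 * (eps_k M k / (2 * D))) * D"
      using norm_V_le[of k] acg_last_stop[of k] domh_dist[OF u(1) xd] eps_k_pos[of k] D_pos
      by (intro mult_mono) auto
    also have "\<dots> = eps_k M k" using D_pos by simp
    finally show ?thesis .
  qed
  ultimately have "val ?l ?x \<le> d0 ?l + eps_k M k"
    unfolding u(2) val_def by (simp add: distrib_left)
  moreover have "d0 y \<le> val y ?x" by (rule d0_le[OF xd])
  moreover have "val y ?x = val ?l ?x + inner (y - ?l) (resid P ?x)"
    by (simp add: val_def inner_diff_left)
  ultimately show ?thesis by linarith
qed

lemma inexact_dual_instance: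
  assumes lt: "is_unique_maximizer (Ysp P) (dual_pert P M) lt"
  shows "inexact_dual (rho M) (gam_d M) (Bk M) (tauk M) (lams r) (nus r)
    (\<lambda>k. resid P (xs r (Suc k))) d0 (eps_k M) (Ysp P) lt"
proof
  show "lams r (Suc k) = (Bk M k / Bk M (Suc k)) *\<^sub>R lams r k
      + (outer.b k / Bk M (Suc k)) *\<^sub>R nus r k + rho M *\<^sub>R resid P (xs r (Suc k))" for k
    by (simp only: lams_Suc[of k] nu_tilde_def bk_eq)
  show "d0 y - gam_d M / 2 * (norm y)\<^sup>2 \<le> d0 lt - gam_d M / 2 * (norm lt)\<^sup>2" if "y \<in> Ysp P" for y
  proof (cases "y = lt")
    case False
    then have "dual_pert P M y < dual_pert P M lt"
      using lt that unfolding is_unique_maximizer_def by blast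
    then show ?thesis by (simp add: dual_pert_eq)
  qed simp
qed (use nus_0 nus_Suc bk_eq duals_Y supergradient lt in \<open>auto simp: is_unique_maximizer_def\<close>)

end


section \<open>Constants of the complexity bound\<close>

text \<open>Each of the first i + 1 terms of the geometric series is at least its last one.\<close>

lemma Suc_times_power_le:
  assumes "0 < q" "q < (1::real)"
  shows "real (Suc i) * q ^ i \<le> 1 / (1 - q)"
proof -
  have "real (Suc i) * q ^ i = (\<Sum>j<Suc i. q ^ i)" by simp
  also have "\<dots> \<le> (\<Sum>j<Suc i. q ^ j)"
    using assms by (intro sum_mono power_decreasing) auto
  also have "\<dots> = (1 - q ^ Suc i) / (1 - q)"
    using assms by (subst sum_gp_strict) auto
  also have "\<dots> \<le> 1 / (1 - q)"
    using assms by (intro divide_right_mono) auto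
  finally show ?thesis .
qed

text \<open>The ratio \<open>97 / 100\<close> is chosen such that its cube exceeds \<open>9 / 10\<close>.\<close>

lemma Suc_sq_times_power_le:
  "(real (Suc i))\<^sup>2 * (9 / 10) ^ i \<le> (100 / 3)\<^sup>2 * (97 / 100) ^ i"
proof -
  let ?q = "97 / 100 :: real"
  have "(real (Suc i))\<^sup>2 * (9 / 10) ^ i \<le> (real (Suc i))\<^sup>2 * (?q ^ 3) ^ i"
    by (intro mult_left_mono power_mono) (simp_all add: power3_eq_cube)
  also have "\<dots> = (real (Suc i) * ?q ^ i)\<^sup>2 * ?q ^ i"
    by (simp only: power_mult_distrib power_mult[symmetric] mult.commute[of _ i] mult.assoc
        power_add[symmetric]) (simp add: algebra_simps)
  also have "\<dots> \<le> (100 / 3)\<^sup>2 * ?q ^ i"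
    using Suc_times_power_le[of ?q i] by (intro mult_right_mono power_mono) auto
  finally show ?thesis .
qed

lemma summable_dominated:
  fixes f :: "nat \<Rightarrow> real"
  assumes "\<And>i. 0 \<le> f i" "\<And>i. f i \<le> c * ((real (Suc i))\<^sup>2 * (9 / 10) ^ i)" "0 \<le> c"
  shows "summable f" "suminf f \<le> 37038 * c"
proof -
  have le: "f i \<le> c * (100 / 3)\<^sup>2 * (97 / 100) ^ i" for i
    using assms(2)[of i] mult_left_mono[OF Suc_sq_times_power_le[of i] assms(3)]
    by (simp add: mult.assoc)
  have sg: "summable (\<lambda>i. c * (100 / 3)\<^sup>2 * (97 / 100 :: real) ^ i)"
    by (intro summable_mult summable_geometric) simp
  show s: "summable f"
    using assms(1) le by (intro summable_comparison_test'[OF sg, of 0]) simp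
  have "suminf f \<le> (\<Sum>i. c * (100 / 3)\<^sup>2 * (97 / 100) ^ i)"
    by (rule suminf_le[OF le s sg])
  also have "\<dots> = c * (100 / 3)\<^sup>2 * (1 / (1 - 97 / 100))"
    by (subst suminf_mult) (simp_all add: suminf_geometric summable_geometric)
  \<comment> \<open>The left side is 1000000/27 times \<open>c\<close>, rounded up.\<close>
  also have "\<dots> \<le> 37038 * c"
    using assms(3) by (simp add: power2_eq_square)
  finally show "suminf f \<le> 37038 * c" .
qed

locale ifalm_parameters = ifalm +
  fixes lt ls :: fvec
  assumes eps_le: "eps M \<le> (normA P)\<^sup>2 / Lf P" and rho_eq: "rho M = Lf P / (normA P)\<^sup>2"
    and eps0_eq: "eps0 M = 1 / rho M" and sig_eq: "sig M = 1 / 4"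
    and lt: "is_unique_maximizer (Ysp P) (dual_pert P M) lt"
    and gam_d_eq: "gam_d M = sig M powr (3/2) * eps M / (sqrt 3 * R_const M lt)"
    and alpha_le: "alpha M \<le> min (9/10 * (1 / (1 + sqrt (rho M * gam_d M))\<^sup>2))
      ((15 * D * eps M / (28 * eps0 M)) powr sqrt (rho M * eps M / D))"
    and ls: "is_arg_min (\<lambda>l. norm (l - linit M)) (\<lambda>l. l \<in> dual_solutions P) ls"
begin

lemma normA_pos: "0 < normA P"
proof (rule ccontr)
  assume "\<not> ?thesis"
  then have "normA P = 0" using normA_nonneg[of P] by simp
  then show False using eps_le eps_pos by simp
qed

lemma rho_normA: "rho M * (normA P)\<^sup>2 = Lf P"
  using normA_pos by (simp add: rho_eq)

lemma M_rho_eq: "M_rho P M = 2 * Lf P"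
  by (simp add: M_rho_def rho_normA)

lemma rho_eps_le: "rho M * eps M \<le> 1"
proof -
  have "rho M * eps M \<le> rho M * ((normA P)\<^sup>2 / Lf P)"
    using rho_pos by (intro mult_left_mono eps_le) auto
  then show ?thesis using rho_normA Lf_pos by (simp add: mult.assoc[symmetric])
qed

lemma rho_eps_pos: "0 < rho M * eps M"
  using rho_pos eps_pos by simp

lemma term_le:
  "0 \<le> Bk M (Suc i) * alpha M ^ i"
  "Bk M (Suc i) * alpha M ^ i \<le> rho M * ((real (Suc i))\<^sup>2 * (9 / 10) ^ i)"
proof -
  show "0 \<le> Bk M (Suc i) * alpha M ^ i"
    using outer.B_nonneg[of "Suc i"] alpha_nonneg by simp
  define c where "c = (1 + outer.\<delta>)\<^sup>2"
  have c: "0 < c" using outer.\<delta>_pos by (simp add: c_def add_pos_pos)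
  have "alpha M \<le> 9 / 10 * (1 / c)"
    using alpha_le by (simp add: c_def outer.\<delta>_def)
  then have "alpha M ^ i \<le> (9 / 10 * (1 / c)) ^ i"
    using alpha_nonneg by (intro power_mono) auto
  then have "Bk M (Suc i) * alpha M ^ i \<le> rho M * (real (Suc i))\<^sup>2 * c ^ i * (9 / 10 * (1 / c)) ^ i"
    using outer.B_upper[of i] outer.B_nonneg[of "Suc i"] rho_pos alpha_nonneg c
    by (intro mult_mono) (auto simp: c_def)
  also have "\<dots> = rho M * ((real (Suc i))\<^sup>2 * (9 / 10) ^ i)"
    using c by (simp add: power_mult_distrib power_divide)
  finally show "Bk M (Suc i) * alpha M ^ i \<le> rho M * ((real (Suc i))\<^sup>2 * (9 / 10) ^ i)" .
qed

lemma summable_C: "summable (\<lambda>i. Bk M (Suc i) * alpha M ^ i)"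
  and C_le: "C_const M \<le> 37038 * rho M"
  using summable_dominated[OF term_le] rho_pos by (simp_all add: C_const_def)

definition eC :: real where "eC = eps0 M * C_const M"

lemma partial_C_le: "(\<Sum>i<k. Bk M (Suc i) * alpha M ^ i) \<le> C_const M"
  unfolding C_const_def by (rule sum_le_suminf[OF summable_C]) (use term_le in auto)

text \<open>Absolute bounds, so the constant \<open>C_const\<close> adds no parameter dependence to
  \<open>R_const\<close>. The lower bound comes from the first summand, \<open>Bk M 1\<close> being
  equal to \<rho>.\<close>

lemma eC_bounds: "1 \<le> eC" "eC \<le> 37038"
proof -
  have "rho M \<le> C_const M"
    using partial_C_le[of 1] outer.B_1 by (simp del: Bk.simps)
  then show "1 \<le> eC" using rho_pos by (simp add: eC_def eps0_eq)
  show "eC \<le> 37038" using C_le rho_pos by (simp add: eC_def eps0_eq field_simps)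
qed

section \<open>The size of the radius and of the dual regularization\<close>

abbreviation Rt :: real where "Rt \<equiv> Rhat M lt"
abbreviation Rs :: real where "Rs \<equiv> Rhat M ls"
abbreviation R :: real where "R \<equiv> R_const M lt"

lemma Rt_ge: "1 \<le> Rt" "norm lt \<le> Rt" by (auto simp: Rhat_def linit)

lemma Rs_ge: "1 \<le> Rs" "norm ls \<le> Rs" by (auto simp: Rhat_def linit)

text \<open>The first two bounds make \<open>R\<close> comparable with \<open>Rt\<close>. The last
  gives room for absorbing the initial distance and the weighted inexactness; 1089/100 is the square
  of 33/10, a lower bound for the last factor of \<open>R_const\<close>.\<close>

lemma R_bounds: "79 / 10 * Rt \<le> R" "R \<le> 1000 * Rt" "1089 / 100 * (Rt\<^sup>2 * (1 + 2 * eC)) \<le> R\<^sup>2"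
proof -
  define s a where "s = sqrt (2 * eC)" and "a = 2 / sqrt (1 - sig M) + 1"
  have R: "R = Rt * (1 + s) * a" by (simp add: R_const_def s_def a_def eC_def mult.assoc)
  have s: "14 / 10 \<le> s" "s \<le> 273"
    unfolding s_def using eC_bounds
    by (intro real_le_rsqrt real_le_lsqrt; simp add: power2_eq_square)+
  have w1: "86 / 100 \<le> sqrt (3 / 4 :: real)"
    by (rule real_le_rsqrt) (simp add: power2_eq_square)
  have w2: "sqrt (3 / 4 :: real) \<le> 8695 / 10000"
    by (rule real_le_lsqrt) (simp_all add: power2_eq_square)
  have "2 / sqrt (3 / 4 :: real) \<ge> 2 / (8695 / 10000)"
    using w1 w2 by (intro divide_left_mono) auto
  moreover have "2 / sqrt (3 / 4 :: real) \<le> 2 / (86 / 100)"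
    using w1 by (intro divide_left_mono) auto
  ultimately have a: "33 / 10 \<le> a" "a \<le> 34 / 10"
    by (simp_all add: a_def sig_eq)
  have "Rt * ((24 / 10) * (33 / 10)) \<le> Rt * ((1 + s) * a)"
    using s a Rt_ge by (intro mult_left_mono mult_mono) auto
  then show "79 / 10 * Rt \<le> R" using Rt_ge by (simp add: R mult.assoc)
  have "Rt * ((1 + s) * a) \<le> Rt * (274 * (34 / 10))"
    using s a Rt_ge by (intro mult_left_mono mult_mono) auto
  then show "R \<le> 1000 * Rt" using Rt_ge by (simp add: R mult.assoc)
  have "s\<^sup>2 = 2 * eC" using eC_bounds by (simp add: s_def)
  then have "1 + 2 * eC \<le> (1 + s)\<^sup>2" using s by (simp add: power2_sum)
  moreover have "(33 / 10)\<^sup>2 \<le> a\<^sup>2" using a by (intro power_mono) auto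
  ultimately have "(33 / 10)\<^sup>2 * (Rt\<^sup>2 * (1 + 2 * eC)) \<le> a\<^sup>2 * (Rt\<^sup>2 * (1 + s)\<^sup>2)"
    using eC_bounds by (intro mult_mono) auto
  then show "1089 / 100 * (Rt\<^sup>2 * (1 + 2 * eC)) \<le> R\<^sup>2"
    by (simp add: R power_mult_distrib power2_eq_square mult_ac)
qed

lemma Rt_eC_le: "Rt\<^sup>2 + 2 * eC \<le> 100 / 1089 * R\<^sup>2"
proof -
  have "1 * eC \<le> Rt\<^sup>2 * eC"
    using eC_bounds one_le_power[OF Rt_ge(1), of 2] by (intro mult_right_mono) auto
  moreover have "1089 / 100 * Rt\<^sup>2 + 1089 / 50 * (Rt\<^sup>2 * eC) \<le> R\<^sup>2"
    using R_bounds(3) by (simp add: algebra_simps)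
  ultimately show ?thesis by linarith
qed

lemma R_ge: "79 / 10 \<le> R"
  using R_bounds(1) Rt_ge by simp

lemma sig_powr: "sig M powr (3/2) = 1 / 8"
proof -
  have "sig M powr (3/2) = ((1 / 2) powr 2) powr (3 / 2)"
    by (simp add: sig_eq powr_numeral power2_eq_square)
  also have "\<dots> = (1 / 2) powr 3" by (simp only: powr_powr) simp
  also have "\<dots> = 1 / 8" by (simp add: powr_numeral power3_eq_cube)
  finally show ?thesis .
qed

lemma eps_eq: "eps M = 8 * sqrt 3 * R * gam_d M"
  using R_ge by (simp add: gam_d_eq sig_powr)

lemma eps_sq_eq: "(eps M)\<^sup>2 = 192 * R\<^sup>2 * (gam_d M)\<^sup>2"
  unfolding eps_eq by (simp add: power_mult_distrib)

lemma sqrt_3: "173 / 100 \<le> sqrt (3::real)" "sqrt (3::real) \<le> 174 / 100"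
proof -
  show "173 / 100 \<le> sqrt (3::real)"
    by (rule real_le_rsqrt) (simp add: power2_eq_square)
  show "sqrt (3::real) \<le> 174 / 100"
    by (rule real_le_lsqrt) (simp_all add: power2_eq_square)
qed

lemma rho_eps_eq: "rho M * eps M = 8 * sqrt 3 * R * outer.\<delta>\<^sup>2"
  unfolding outer.\<delta>_sq by (simp add: eps_eq)

text \<open>The choice of \<open>gam_d\<close> gives \<rho> eps = 8 sqrt 3 R
  \<open>\<delta>\<^sup>2\<close>, whose coefficient exceeds 100, while \<rho> eps is at most
  1.\<close>

lemma \<delta>_le: "outer.\<delta> \<le> 1 / 10"
proof (rule power2_le_imp_le)
  have "100 \<le> 8 * (173 / 100) * (79 / 10 :: real)" by simp
  also have "\<dots> \<le> 8 * sqrt 3 * R"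
    using R_ge sqrt_3 by (intro mult_mono) auto
  finally have "100 * outer.\<delta>\<^sup>2 \<le> 8 * sqrt 3 * R * outer.\<delta>\<^sup>2"
    by (intro mult_right_mono) auto
  then have "100 * outer.\<delta>\<^sup>2 \<le> 1"
    using rho_eps_le unfolding rho_eps_eq[symmetric] by linarith
  then show "outer.\<delta>\<^sup>2 \<le> (1 / 10)\<^sup>2" by (simp add: power2_eq_square)
qed simp

section \<open>Inner tolerances and the number of outer steps\<close>

lemma eps_k_eq: "eps_k M k = 7 / 8 * eps0 M * alpha M ^ k + rho M * (eps M)\<^sup>2 / 32"
  by (simp add: eps_k_def sig_eq field_simps)

lemma rho_eps_sq_le: "rho M * (eps M)\<^sup>2 \<le> eps M"
  using mult_right_mono[OF rho_eps_le, of "eps M"] eps_pos by (simp add: power2_eq_square mult.assoc)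

lemma alpha_le_1: "alpha M \<le> 1"
proof -
  define c where "c = (1 + sqrt (gam_d M * rho M))\<^sup>2"
  have "1 \<le> c" unfolding c_def using gam_d_pos rho_pos by (intro one_le_power) auto
  then have "1 / c \<le> 1" by simp
  then show ?thesis using alpha_less unfolding c_def by linarith
qed

lemma eps_k_le: "eps_k M k \<le> eps0 M"
proof -
  have "eps0 M * alpha M ^ k \<le> eps0 M * 1"
    using alpha_nonneg alpha_le_1 eps0_ge eps_pos by (intro mult_left_mono power_le_one) auto
  then show ?thesis using rho_eps_sq_le eps0_ge eps_pos unfolding eps_k_eq by linarith
qed

text \<open>Once k times the exponent q reaches 1, the second bound on \<alpha> gives
  \<open>alpha M ^ k \<le> \<beta>\<close>. The decaying part is then at most 15/32 of
  \<open>D * eps M\<close> and the floor at most 1/32, together one half. If \<beta> is at least 1,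
  already \<alpha> \<le> 1 suffices.\<close>

lemma eps_k_small:
  assumes k: "sqrt (D / (rho M * eps M)) \<le> real k"
  shows "eps_k M k \<le> D * eps M / 2"
proof -
  define \<beta> where "\<beta> = 15 * D * eps M / (28 * eps0 M)"
  define q where "q = sqrt (rho M * eps M / D)"
  have \<beta>: "0 < \<beta>" using D_pos eps_pos eps0_ge by (simp add: \<beta>_def)
  have q: "0 < q" using rho_eps_pos D_pos by (simp add: q_def)
  have qk: "1 \<le> q * real k"
  proof -
    have "q * sqrt (D / (rho M * eps M)) = sqrt ((rho M * eps M / D) * (D / (rho M * eps M)))"
      by (simp only: q_def real_sqrt_mult)
    also have "\<dots> = 1" using rho_eps_pos D_pos rho_pos eps_pos by simp
    finally have "1 = q * sqrt (D / (rho M * eps M))" by simp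
    also have "\<dots> \<le> q * real k" using k q by (intro mult_left_mono) auto
    finally show ?thesis .
  qed
  then have k0: "0 < k" by (cases k) auto
  have "alpha M ^ k \<le> \<beta>"
  proof (cases "1 \<le> \<beta>")
    case True
    have "alpha M ^ k \<le> 1" by (intro power_le_one alpha_nonneg alpha_le_1)
    then show ?thesis using True by simp
  next
    case False
    have "alpha M \<le> \<beta> powr q" using alpha_le by (simp add: \<beta>_def q_def)
    then have "alpha M ^ k \<le> (\<beta> powr q) ^ k"
      using alpha_nonneg by (intro power_mono) auto
    also have "\<dots> = (\<beta> powr q) powr real k"
      using \<beta> by (intro powr_realpow[symmetric]) simp
    also have "\<dots> = \<beta> powr (q * real k)"
      by (rule powr_powr)
    also have "\<dots> \<le> \<beta> powr 1"
      using False \<beta> qk by (intro powr_mono') auto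
    also have "\<dots> = \<beta>" using \<beta> by simp
    finally show ?thesis .
  qed
  then have "7 / 8 * eps0 M * alpha M ^ k \<le> 7 / 8 * eps0 M * \<beta>"
    using eps0_ge eps_pos by (intro mult_left_mono) auto
  also have "\<dots> = 15 / 32 * (D * eps M)" using eps0_ge eps_pos by (simp add: \<beta>_def)
  finally have "7 / 8 * eps0 M * alpha M ^ k \<le> 15 / 32 * (D * eps M)" .
  moreover have "rho M * (eps M)\<^sup>2 \<le> D * eps M"
  proof -
    have "1 * eps M \<le> D * eps M" using eps_pos by (intro mult_right_mono D_ge_1) simp
    then show ?thesis using rho_eps_sq_le by linarith
  qed
  ultimately show ?thesis unfolding eps_k_eq by simp
qed

lemma outer_stopI:
  assumes "sqrt (D / (rho M * eps M)) \<le> real k" "norm (resid P (xs r (Suc k))) \<le> eps M"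
  shows "outer_stop P M r k"
proof -
  have "eps_k M k / (2 * D) \<le> (D * eps M / 2) / (2 * D)"
    using eps_k_small[OF assms(1)] D_pos by (intro divide_right_mono) auto
  also have "\<dots> = eps M / 4" using D_pos by simp
  finally show ?thesis
    using acg_last_stop[of k] assms(2) by (simp add: outer_stop_def)
qed

text \<open>At this growth \<rho> \<open>eps\<^sup>2\<close> times the weight \<open>Bk\<close>
  reaches \<open>R\<^sup>2\<close>, which dominates the initial potential.\<close>

definition W_outer :: real
  where "W_outer = (R / (rho M * eps M))\<^sup>2"

lemma W_outer_ge_1: "1 \<le> W_outer"
proof -
  have "1 \<le> R / (rho M * eps M)"
    using R_ge rho_eps_le rho_eps_pos by (simp add: pos_le_divide_eq)
  then show ?thesis unfolding W_outer_def by (rule one_le_power)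
qed

text \<open>From \<open>K0\<close> on, the gradient mapping passes the termination test. Up to
  \<open>K\<close> some index from \<open>K0\<close> on has a small residual: \<open>2 * K0\<close>
  provides the upper half of the weights, \<open>Suc j\<close> the required growth.\<close>

lemma outer_stop_exists:
  "\<exists>k. outer_stop P M r k \<and> real (Suc k) \<le>
    2 * sqrt (D / (rho M * eps M)) + 4 + (1 / outer.\<delta> + 1 / 2) * ln W_outer"
proof -
  interpret I: inexact_dual "rho M" "gam_d M" "Bk M" "tauk M" "lams r" "nus r"
    "\<lambda>k. resid P (xs r (Suc k))" d0 "eps_k M" "Ysp P" lt
    by (rule inexact_dual_instance[OF lt])
  define X where "X = sqrt (D / (rho M * eps M))"
  have X: "0 \<le> X" using D_pos rho_eps_pos by (simp add: X_def)
  define K0 where "K0 = nat \<lceil>X\<rceil>"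
  have K0: "X \<le> real K0" "real K0 \<le> X + 1" using X by (auto simp: K0_def)
  obtain j where j: "W_outer \<le> (1 + outer.\<delta> / 2) ^ (2 * j)"
    "real j \<le> 1 + (1 / outer.\<delta> + 1 / 2) * ln W_outer"
    using exists_power_ge[OF outer.\<delta>_pos W_outer_ge_1] by blast
  define K where "K = max (2 * K0) (Suc j)"
  have "\<exists>i. K0 \<le> i \<and> i < K \<and> norm (resid P (xs r (Suc i))) \<le> eps M"
  \<comment> \<open>The factor 11/5 in \<open>N\<close> fits between two requirements: 14/5
    (200/1089 + 132/100) must not exceed its square, and (11/10) squared times its square must not
    exceed 12 = 192/16.\<close>
  proof (rule I.small_residual[where a = "\<lambda>i. 7 / 8 * eps0 M * alpha M ^ i"
        and einf = "rho M * (eps M)\<^sup>2 / 32" and A = "7 / 8 * eC" and Rh = Rt and N = "11 / 5 * R"])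
    show "eps_k M i \<le> 7 / 8 * eps0 M * alpha M ^ i + rho M * (eps M)\<^sup>2 / 32" for i
      by (simp add: eps_k_eq)
    show "(\<Sum>i<k. Bk M (Suc i) * (7 / 8 * eps0 M * alpha M ^ i)) \<le> 7 / 8 * eC" for k
    proof -
      have "(\<Sum>i<k. Bk M (Suc i) * (7 / 8 * eps0 M * alpha M ^ i))
          = 7 / 8 * eps0 M * (\<Sum>i<k. Bk M (Suc i) * alpha M ^ i)"
        unfolding sum_distrib_left by (intro sum.cong refl) (simp only: mult_ac)
      also have "\<dots> \<le> 7 / 8 * eps0 M * C_const M"
        using eps0_ge eps_pos by (intro mult_left_mono partial_C_le) auto
      finally show ?thesis by (simp add: eC_def)
    qed
    show "outer.\<delta> \<le> 1 / 10" by (rule \<delta>_le)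
    show "14 / 5 * (2 * Rt\<^sup>2 + 2 * (7 / 8 * eC) + 2 * (rho M * (eps M)\<^sup>2 / 32) * (1 + outer.\<delta>)
        / (outer.\<delta> * gam_d M)) \<le> (11 / 5 * R)\<^sup>2"
    proof -
      have 1: "2 * Rt\<^sup>2 + 2 * (7 / 8 * eC) \<le> 200 / 1089 * R\<^sup>2"
        using Rt_eC_le eC_bounds by linarith
      have "rho M * (eps M)\<^sup>2 = 192 * R\<^sup>2 * gam_d M * outer.\<delta>\<^sup>2"
        unfolding eps_sq_eq outer.\<delta>_sq by (simp add: power2_eq_square)
      then have "2 * (rho M * (eps M)\<^sup>2 / 32) * (1 + outer.\<delta>) / (outer.\<delta> * gam_d M)
          = 12 * R\<^sup>2 * (outer.\<delta> * (1 + outer.\<delta>))"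
        using outer.\<delta>_pos gam_d_pos by (simp add: power2_eq_square)
      also have "\<dots> \<le> 12 * R\<^sup>2 * ((1 / 10) * (1 + 1 / 10))"
        using outer.\<delta>_pos \<delta>_le by (intro mult_left_mono mult_mono) auto
      finally have 2: "2 * (rho M * (eps M)\<^sup>2 / 32) * (1 + outer.\<delta>) / (outer.\<delta> * gam_d M)
          \<le> 132 / 100 * R\<^sup>2" by simp
      have "14 / 5 * (a + b) \<le> 121 / 25 * x"
        if "a \<le> 200 / 1089 * x" "b \<le> 132 / 100 * x" "0 \<le> x" for a b x :: real
        using that by simp
      from this[OF 1 2 zero_le_power2] show ?thesis
        by (simp only: power_mult_distrib power_divide) (simp add: power2_eq_square)
    qed
    show "(gam_d M)\<^sup>2 * (1 + outer.\<delta>)\<^sup>2 * (11 / 5 * R)\<^sup>2 \<le> (eps M)\<^sup>2 / 16"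
    proof -
      have "(1 + outer.\<delta>)\<^sup>2 \<le> (1 + 1 / 10)\<^sup>2"
        using outer.\<delta>_pos \<delta>_le by (intro power_mono) auto
      then have "(gam_d M)\<^sup>2 * (1 + outer.\<delta>)\<^sup>2 * (11 / 5 * R)\<^sup>2
          \<le> (gam_d M)\<^sup>2 * (1 + 1 / 10)\<^sup>2 * (11 / 5 * R)\<^sup>2"
        by (intro mult_right_mono mult_left_mono) auto
      also have "\<dots> = (11 / 10)\<^sup>2 * (11 / 5)\<^sup>2 * (R\<^sup>2 * (gam_d M)\<^sup>2)"
        by (simp add: power_mult_distrib power_divide mult_ac)
      also have "\<dots> \<le> 12 * (R\<^sup>2 * (gam_d M)\<^sup>2)"
        by (intro mult_right_mono) (auto simp: power2_eq_square)
      also have "\<dots> = (eps M)\<^sup>2 / 16" unfolding eps_sq_eq by simp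
      finally show ?thesis .
    qed
    show "Rt\<^sup>2 / 2 + 7 / 8 * eC < 3 / 16 * (rho M * (eps M)\<^sup>2 * Bk M K)"
    proof -
      have "rho M * W_outer \<le> rho M * (1 + outer.\<delta> / 2) ^ (2 * j)"
        using j rho_pos by (intro mult_left_mono) auto
      also have "\<dots> \<le> Bk M (Suc j)" by (rule outer.B_lower)
      also have "\<dots> \<le> Bk M K" by (intro outer.B_mono) (simp add: K_def)
      finally have "rho M * (eps M)\<^sup>2 * (rho M * W_outer) \<le> rho M * (eps M)\<^sup>2 * Bk M K"
        using rho_pos by (intro mult_left_mono) auto
      moreover have "rho M * (eps M)\<^sup>2 * (rho M * W_outer) = R\<^sup>2"
        using rho_pos eps_pos by (simp add: W_outer_def power_divide power_mult_distrib power2_eq_square)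
      moreover have "Rt\<^sup>2 / 2 + 7 / 8 * eC \<le> 50 / 1089 * R\<^sup>2"
        using Rt_eC_le eC_bounds by linarith
      moreover have "0 < R\<^sup>2" using R_ge by simp
      ultimately show ?thesis by linarith
    qed
  qed (use rho_pos eps_pos R_ge Rt_ge in \<open>auto simp: K_def\<close>)
  then obtain i where i: "K0 \<le> i" "i < K" "norm (resid P (xs r (Suc i))) \<le> eps M" by blast
  have "X \<le> real i" using K0 i by linarith
  then have "outer_stop P M r i" using i(3) unfolding X_def by (rule outer_stopI)
  moreover have "real (Suc i) \<le> 2 * X + 4 + (1 / outer.\<delta> + 1 / 2) * ln W_outer"
  proof -
    have "real (Suc i) \<le> real K" using i by simp
    also have "\<dots> \<le> 2 * real K0 + real (Suc j)" by (simp add: K_def)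
    also have "\<dots> \<le> 2 * X + 4 + (1 / outer.\<delta> + 1 / 2) * ln W_outer"
      using K0 j by simp
    finally show ?thesis .
  qed
  ultimately show ?thesis unfolding X_def by blast
qed


subsection \<open>Comparison of the dual solutions\<close>

definition dual_real :: "fvec \<Rightarrow> real"
  where "dual_real l = (INF x\<in>domh P. hr x + (fobj P x + inner l (resid P x)))"

lemma dual_real_attained: "\<exists>x\<in>domh P. dual_real l = hr x + (fobj P x + inner l (resid P x)) \<and> dual P l = ereal (dual_real l)"
  and dual_real_le: "u \<in> domh P \<Longrightarrow> dual_real l \<le> hr u + (fobj P u + inner l (resid P u))"
proof -
  let ?G = "\<lambda>x. fobj P x + inner l (resid P x)"
  have "continuous_on (Xsp P) ?G"
    by (intro continuous_intros smooth_continuous_on[OF smooth_f] resid_continuous)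
  from argmin_exists[OF h bounded_eff_dom this zero_less_one]
  obtain x where x: "x \<in> domh P" and min: "\<And>u. u \<in> domh P \<Longrightarrow> hr x + ?G x \<le> hr u + ?G u"
    by (auto simp: domh_def)
  have dual_real: "dual_real l = hr x + ?G x"
    unfolding dual_real_def using x min by (intro cInf_eq_minimum) auto
  have "lagr P y l = hobj P y + ereal (?G y)" for y
    by (cases "hobj P y") (simp_all add: lagr_def phi_def)
  then have "dual P l = (INF y\<in>Xsp P. hobj P y + ereal (?G y))"
    by (simp add: dual_def)
  also have "\<dots> = ereal (hr x + ?G x)"
    using x min by (intro INF_ereal_eq h) (auto simp: domh_def)
  finally show "\<exists>x\<in>domh P. dual_real l = hr x + ?G x \<and> dual P l = ereal (dual_real l)"
    using x dual_real by auto
  show "u \<in> domh P \<Longrightarrow> dual_real l \<le> hr u + ?G u" using min dual_real by simp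
qed

lemma dual_real_d0: "dual_real l \<le> d0 l" "d0 l \<le> dual_real l + gam_p M / 2 * D\<^sup>2"
proof -
  obtain x where x: "x \<in> domh P" "d0 l = val l x" using d0_attained by blast
  have "0 \<le> gam_p M / 2 * (norm (x - xinit M))\<^sup>2" using gam_p_pos by simp
  then show "dual_real l \<le> d0 l" using dual_real_le[OF x(1), of l] by (simp add: x(2) val_def)
  obtain y where y: "y \<in> domh P" "dual_real l = hr y + (fobj P y + inner l (resid P y))"
    using dual_real_attained by blast
  have "(norm (y - xinit M))\<^sup>2 \<le> D\<^sup>2" using domh_dist[OF y(1) xinit] by (intro power_mono) auto
  then have "gam_p M / 2 * (norm (y - xinit M))\<^sup>2 \<le> gam_p M / 2 * D\<^sup>2"
    using gam_p_pos by (intro mult_left_mono) auto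
  then show "d0 l \<le> dual_real l + gam_p M / 2 * D\<^sup>2"
    using d0_le[OF y(1), of l] by (simp add: y(2) val_def)
qed

text \<open>The optimality of \<open>ls\<close> for the original dual and of \<open>lt\<close> for
  the perturbed one are added. The two duals without the quadratic differ by at most half of gam_p
  \<open>D\<^sup>2\<close>, which remains as the only discrepancy.\<close>

lemma norm_lt_le: "(norm lt)\<^sup>2 \<le> (norm ls)\<^sup>2 + gam_p M * D\<^sup>2 / gam_d M"
proof -
  have "ls \<in> dual_solutions P" using ls by (auto simp: is_arg_min_def)
  then have lsY: "ls \<in> Ysp P" and "dual P lt \<le> dual P ls"
    using lt by (auto simp: dual_solutions_def is_unique_maximizer_def)
  then have 1: "dual_real lt \<le> dual_real ls"
    using dual_real_attained[of lt] dual_real_attained[of ls] by auto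
  have 2: "d0 ls - gam_d M / 2 * (norm ls)\<^sup>2 \<le> d0 lt - gam_d M / 2 * (norm lt)\<^sup>2"
  proof (cases "ls = lt")
    case False
    then have "dual_pert P M ls < dual_pert P M lt"
      using lt lsY unfolding is_unique_maximizer_def by blast
    then show ?thesis by (simp add: dual_pert_eq)
  qed simp
  have "gam_d M / 2 * (norm lt)\<^sup>2 \<le> gam_d M / 2 * (norm ls)\<^sup>2 + gam_p M / 2 * D\<^sup>2"
    using 1 2 dual_real_d0(2)[of lt] dual_real_d0(1)[of ls] by linarith
  then show ?thesis using gam_d_pos by (simp add: field_simps)
qed

text \<open>The radius occurs on both sides, as \<open>gam_d\<close> depends on \<open>R\<close> and
  hence on \<open>Rt\<close>. The perturbation term is linear in \<open>Rt\<close>, though, so it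
  loses against the square: 4 sqrt 3 times 1000 is below 7000.\<close>

lemma Rt_le: "Rt \<le> 7000 * (D + Rs)"
proof (rule ccontr)
  assume "\<not> ?thesis"
  then have gt: "7000 * D + Rs < Rt" using Rs_ge by simp
  have Rt1: "Rt \<noteq> 1" using gt Rs_ge D_pos by simp
  then have "Rt = norm lt" by (auto simp: Rhat_def linit max_def split: if_splits)
  then have "Rt\<^sup>2 \<le> (norm ls)\<^sup>2 + gam_p M * D\<^sup>2 / gam_d M" using norm_lt_le by simp
  also have "gam_p M * D\<^sup>2 / gam_d M = 4 * sqrt 3 * R * D"
    using gam_d_pos D_pos by (simp add: gam_p_eq eps_eq power2_eq_square)
  also have "\<dots> \<le> 4 * (174 / 100) * (1000 * Rt) * D"
    using sqrt_3 R_bounds(2) R_ge Rt_ge D_pos by (intro mult_mono) auto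
  also have "\<dots> \<le> 7000 * D * Rt" using D_pos Rt_ge by (simp add: mult_ac)
  also have "(norm ls)\<^sup>2 \<le> Rs * Rs"
    unfolding power2_eq_square using Rs_ge by (intro mult_mono) auto
  also have "\<dots> \<le> Rs * Rt" using gt D_pos Rs_ge by (intro mult_left_mono) auto
  finally have "Rt * Rt \<le> (7000 * D + Rs) * Rt" by (simp add: power2_eq_square algebra_simps)
  also have "\<dots> < Rt * Rt" using gt Rt_ge by (intro mult_strict_right_mono) auto
  finally show False by simp
qed


subsection \<open>Logarithmic factors\<close>

definition \<Lambda> :: real
  where "\<Lambda> = Lf P + 1 / Lf P + normA P + 1 / normA P + D + eps M + 1 / eps M + Rs"

lemma log_factor_eq: "log_factor P M ls = ln \<Lambda>"
  by (simp add: log_factor_def \<Lambda>_def)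

text \<open>Three pairs x + 1/x contribute at least 2 each, the diameter and \<open>Rs\<close> at
  least 1 each. This lets numerical constants be absorbed into powers of \<Lambda>.\<close>

lemma \<Lambda>_ge_8: "8 \<le> \<Lambda>"
proof -
  have "2 \<le> x + 1 / x" if "0 < x" for x :: real
  proof -
    have "0 \<le> (x - 1)\<^sup>2 / x" using that by simp
    also have "\<dots> = x + 1 / x - 2" using that by (simp add: power2_eq_square field_simps)
    finally show ?thesis by simp
  qed
  from this[OF Lf_pos] this[OF normA_pos] this[OF eps_pos] show ?thesis
    using D_ge_1 Rs_ge by (simp add: \<Lambda>_def)
qed

lemma \<Lambda>_ge: "Lf P \<le> \<Lambda>" "1 / Lf P \<le> \<Lambda>" "normA P \<le> \<Lambda>" "D \<le> \<Lambda>" "1 / eps M \<le> \<Lambda>" "D + Rs \<le> \<Lambda>"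
  using Lf_pos normA_pos D_ge_1 eps_pos Rs_ge
  by (simp_all add: \<Lambda>_def add_nonneg_nonneg)

text \<open>Every quantity under a logarithm is bounded by a power of \<Lambda>; the exponents add
  up along the factors, so all logarithms become multiples of \<open>ln \<Lambda>\<close>.\<close>

lemma prod_le_\<Lambda>_power: "0 \<le> x \<Longrightarrow> 0 \<le> y \<Longrightarrow> x \<le> \<Lambda> ^ i \<Longrightarrow> y \<le> \<Lambda> ^ j \<Longrightarrow> x * y \<le> \<Lambda> ^ (i + j)"
  unfolding power_add using \<Lambda>_ge_8 by (intro mult_mono) auto

lemma inv_rho_le: "1 / rho M \<le> \<Lambda> ^ 3"
proof -
  have "normA P * normA P * (1 / Lf P) \<le> \<Lambda> ^ (1 + 1 + 1)"
    using \<Lambda>_ge normA_pos Lf_pos by (intro prod_le_\<Lambda>_power) auto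
  then show ?thesis by (simp add: rho_eq power2_eq_square power3_eq_cube mult.assoc)
qed

lemma inv_rho_eps_le: "1 / (rho M * eps M) \<le> \<Lambda> ^ 4"
proof -
  have "(1 / rho M) * (1 / eps M) \<le> \<Lambda> ^ (3 + 1)"
    using \<Lambda>_ge inv_rho_le rho_pos eps_pos by (intro prod_le_\<Lambda>_power) auto
  then show ?thesis by simp
qed

lemma numeral_le_\<Lambda>_power: "c \<le> 8 ^ i \<Longrightarrow> c \<le> \<Lambda> ^ i"
  using power_mono[OF \<Lambda>_ge_8, of i] by simp

lemma ln_le_of_power:
  assumes "1 \<le> x" "x \<le> \<Lambda> ^ i"
  shows "ln x \<le> real i * ln \<Lambda>"
proof -
  have "ln x \<le> ln (\<Lambda> ^ i)" using assms \<Lambda>_ge_8 by (subst ln_le_cancel_iff) auto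
  then show ?thesis using \<Lambda>_ge_8 by (simp add: ln_realpow)
qed

lemma ln_W_outer_le: "ln W_outer \<le> 26 * ln \<Lambda>"
proof -
  have "7000000 \<le> \<Lambda> ^ 8" by (rule numeral_le_\<Lambda>_power) simp
  have "R \<le> 7000000 * (D + Rs)" using R_bounds(2) Rt_le by simp
  also have "\<dots> \<le> \<Lambda> ^ (8 + 1)"
    using \<Lambda>_ge D_pos Rs_ge \<open>7000000 \<le> \<Lambda> ^ 8\<close> by (intro prod_le_\<Lambda>_power) auto
  finally have "R \<le> \<Lambda> ^ 9" by simp
  then have "R * (1 / (rho M * eps M)) \<le> \<Lambda> ^ (9 + 4)"
    using inv_rho_eps_le R_ge rho_eps_pos by (intro prod_le_\<Lambda>_power) auto
  then have "(R / (rho M * eps M))\<^sup>2 \<le> (\<Lambda> ^ 13)\<^sup>2"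
    using R_ge rho_pos eps_pos by (intro power_mono) auto
  then have "W_outer \<le> \<Lambda> ^ 26" by (simp add: W_outer_def power_mult[symmetric])
  from ln_le_of_power[OF W_outer_ge_1 this] show ?thesis by simp
qed

lemma M_rho_div_mu_le: "2 * M_rho P M / mu_k P M k \<le> 8 * (D * Lf P / eps M)"
proof -
  have "2 * M_rho P M / mu_k P M k \<le> 2 * M_rho P M / gam_p M"
    using M_rho_pos gam_p_pos kappa_pos[of k] mu_k_pos[of k]
    by (intro divide_left_mono) (auto simp: mu_k_eq)
  also have "\<dots> = 8 * (D * Lf P / eps M)"
    using D_pos eps_pos by (simp add: M_rho_eq gam_p_eq)
  finally show ?thesis .
qed

lemma ln_W_inner_le: "ln (W_inner k) \<le> 34 * ln \<Lambda>"
proof -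
  let ?L = "M_rho P M" and ?\<mu> = "mu_k P M k"
  have 1: "2 * ?L / ?\<mu> \<le> \<Lambda> ^ 4"
  proof -
    have "8 * (D * (Lf P * (1 / eps M))) \<le> \<Lambda> ^ (1 + (1 + (1 + 1)))"
      using \<Lambda>_ge \<Lambda>_ge_8 D_pos Lf_pos eps_pos by (intro prod_le_\<Lambda>_power) auto
    then show ?thesis using M_rho_div_mu_le[of k] by (simp add: power4_eq_xxxx mult.assoc)
  qed
  have 2: "2 * ?L + ?\<mu> \<le> \<Lambda> ^ 4"
  proof -
    have "gam_p M \<le> eps M"
    proof -
      have "eps M * 1 \<le> eps M * (2 * D)" using D_ge_1 eps_pos by (intro mult_left_mono) auto
      then show ?thesis using D_pos by (simp add: gam_p_eq pos_divide_le_eq)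
    qed
    moreover have "kappa k \<le> eps0 M"
    proof -
      have "1 \<le> D\<^sup>2" using D_ge_1 by (rule one_le_power)
      then have "eps_k M k * 1 \<le> eps_k M k * (4 * D\<^sup>2)" using eps_k_pos[of k] by (intro mult_left_mono) auto
      then have "kappa k \<le> eps_k M k" using D_pos by (simp add: kappa_def pos_divide_le_eq)
      then show ?thesis using eps_k_le[of k] by simp
    qed
    ultimately have "?\<mu> \<le> 2 * \<Lambda> ^ 3"
      using eps0_ge inv_rho_le by (simp add: mu_k_eq eps0_eq)
    moreover have "2 * ?L \<le> 4 * \<Lambda> ^ 3"
    proof -
      have "\<Lambda> ^ 1 \<le> \<Lambda> ^ 3" using \<Lambda>_ge_8 by (intro power_increasing) auto
      then show ?thesis using \<Lambda>_ge by (simp add: M_rho_eq)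
    qed
    moreover have "8 * \<Lambda> ^ 3 \<le> \<Lambda> * \<Lambda> ^ 3" using \<Lambda>_ge_8 by (intro mult_right_mono) auto
    moreover have "\<Lambda> * \<Lambda> ^ 3 = \<Lambda> ^ 4" by (simp add: power_Suc[symmetric] del: power_Suc)
    moreover have "0 \<le> \<Lambda> ^ 3" using \<Lambda>_ge_8 by simp
    ultimately show ?thesis by linarith
  qed
  have 3: "1 / eps_k M k \<le> \<Lambda> ^ 7"
  proof -
    have "rho M * (eps M)\<^sup>2 / 32 \<le> eps_k M k"
      unfolding eps_k_eq using eps0_ge eps_pos alpha_nonneg by simp
    then have "1 / eps_k M k \<le> 1 / (rho M * (eps M)\<^sup>2 / 32)"
      using rho_pos eps_pos eps_k_pos[of k] by (intro divide_left_mono) auto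
    also have "\<dots> = 32 * (1 / (rho M * eps M) * (1 / eps M))"
      by (simp add: power2_eq_square)
    also have "\<dots> \<le> \<Lambda> ^ (2 + (4 + 1))"
      using inv_rho_eps_le \<Lambda>_ge rho_eps_pos rho_pos eps_pos numeral_le_\<Lambda>_power[of 32 2]
      by (intro prod_le_\<Lambda>_power) auto
    finally show ?thesis by simp
  qed
  have "12 * (D * D * ((2 * ?L + ?\<mu>) * (1 / eps_k M k))) \<le> \<Lambda> ^ (2 + ((1 + 1) + (4 + 7)))"
    using 2 3 \<Lambda>_ge D_pos M_rho_pos mu_k_pos[of k] eps_k_pos[of k] numeral_le_\<Lambda>_power[of 12 2]
    by (intro prod_le_\<Lambda>_power) auto
  then have "12 * D\<^sup>2 * (2 * ?L + ?\<mu>) / eps_k M k \<le> \<Lambda> ^ 15"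
    by (simp add: power2_eq_square mult_ac)
  then have "(12 * D\<^sup>2 * (2 * ?L + ?\<mu>) / eps_k M k)\<^sup>2 \<le> (\<Lambda> ^ 15)\<^sup>2"
    using D_pos M_rho_pos mu_k_pos[of k] eps_k_pos[of k] by (intro power_mono) auto
  then have "(12 * D\<^sup>2 * (2 * ?L + ?\<mu>) / eps_k M k)\<^sup>2 \<le> \<Lambda> ^ 30"
    by (simp add: power_mult[symmetric])
  then have "2 * ?L / ?\<mu> * (12 * D\<^sup>2 * (2 * ?L + ?\<mu>) / eps_k M k)\<^sup>2 \<le> \<Lambda> ^ (4 + 30)"
    using 1 M_rho_pos mu_k_pos[of k] by (intro prod_le_\<Lambda>_power) auto
  moreover have "1 \<le> \<Lambda> ^ 34" using \<Lambda>_ge_8 by (intro one_le_power) simp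
  ultimately have "W_inner k \<le> \<Lambda> ^ 34" by (simp add: W_inner_def)
  moreover have "1 \<le> W_inner k" by (simp add: W_inner_def)
  ultimately show ?thesis using ln_le_of_power[of "W_inner k" 34] by simp
qed

lemma ln_\<Lambda>_ge_1: "1 \<le> ln \<Lambda>"
proof -
  have "exp 1 \<le> \<Lambda>" using \<Lambda>_ge_8 exp_le by linarith
  then show ?thesis using \<Lambda>_ge_8 by (subst ln_ge_iff) auto
qed

lemma inner_iterations_le:
  "real (Suc (acg_last P M r k)) \<le> 102 * (1 + sqrt (D * Lf P / eps M)) * ln \<Lambda>"
proof -
  define Z where "Z = sqrt (D * Lf P / eps M)"
  have Z: "0 \<le> Z" using D_pos Lf_pos eps_pos by (simp add: Z_def)
  \<comment> \<open>The factor 8 is enlarged to 9 to make its root an integer.\<close>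
  have "sqrt (2 * M_rho P M / mu_k P M k) \<le> sqrt (9 * (D * Lf P / eps M))"
    using M_rho_div_mu_le[of k] D_pos Lf_pos eps_pos
    by (intro real_sqrt_le_mono) (rule order_trans, assumption, intro mult_right_mono, auto)
  also have "\<dots> = 3 * Z"
    by (simp only: real_sqrt_mult Z_def) simp
  finally have "(sqrt (2 * M_rho P M / mu_k P M k) + 1 / 2) * ln (W_inner k)
      \<le> (3 * Z + 1 / 2) * (34 * ln \<Lambda>)"
    using ln_W_inner_le[of k] Z by (intro mult_mono) (auto simp: W_inner_def)
  then have "real (Suc (acg_last P M r k)) \<le> 3 * 1 + (3 * Z + 1 / 2) * (34 * ln \<Lambda>)"
    using acg_last_le[of k] by simp
  also have "\<dots> \<le> 3 * ln \<Lambda> + (3 * Z + 1 / 2) * (34 * ln \<Lambda>)"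
    using ln_\<Lambda>_ge_1 by simp
  also have "\<dots> = (20 + 102 * Z) * ln \<Lambda>" by (simp add: algebra_simps)
  also have "\<dots> \<le> (102 * (1 + Z)) * ln \<Lambda>"
    using ln_\<Lambda>_ge_1 by (intro mult_right_mono) auto
  finally show ?thesis by (simp add: Z_def)
qed

definition T :: real
  where "T = sqrt (D + Rs) * normA P / sqrt (Lf P * eps M)"

lemma T_eq: "T = sqrt ((D + Rs) / (rho M * eps M))"
proof -
  have "(D + Rs) / (rho M * eps M) = (D + Rs) * (normA P)\<^sup>2 / (Lf P * eps M)"
    using normA_pos by (simp add: rho_eq)
  then show ?thesis
    using normA_pos by (simp add: T_def real_sqrt_divide real_sqrt_mult)
qed

lemma T_nonneg: "0 \<le> T"
  using D_pos Rs_ge rho_eps_pos by (simp add: T_eq)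

text \<open>Here the perturbed radius disappears from the rate: \<open>1 / \<delta>\<^sup>2\<close>
  is proportional to \<open>R\<close>, and \<open>Rt_le\<close> bounds \<open>R\<close> by a
  multiple of \<open>D + Rs\<close>. The numerical factor is below the square of 10000.\<close>

lemma inv_\<delta>_le: "1 / outer.\<delta> \<le> 10000 * T"
proof -
  have "1 / outer.\<delta>\<^sup>2 = 8 * sqrt 3 * R / (rho M * eps M)"
    using R_ge outer.\<delta>_pos unfolding rho_eps_eq by simp
  also have "\<dots> \<le> 8 * (174 / 100) * (7000000 * (D + Rs)) / (rho M * eps M)"
  proof -
    have "R \<le> 7000000 * (D + Rs)" using R_bounds(2) Rt_le by simp
    then show ?thesis
      using sqrt_3 R_ge rho_eps_pos by (intro divide_right_mono mult_mono) auto
  qed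
  also have "\<dots> \<le> 10000\<^sup>2 * ((D + Rs) / (rho M * eps M))"
  proof -
    have "0 \<le> (D + Rs) / (rho M * eps M)" using D_pos Rs_ge rho_eps_pos by simp
    then have "8 * (174 / 100) * 7000000 * ((D + Rs) / (rho M * eps M))
        \<le> 10000\<^sup>2 * ((D + Rs) / (rho M * eps M))"
      by (intro mult_right_mono) auto
    then show ?thesis by (simp only: times_divide_eq_right mult.assoc)
  qed
  finally have "sqrt (1 / outer.\<delta>\<^sup>2) \<le> sqrt (10000\<^sup>2 * ((D + Rs) / (rho M * eps M)))"
    by (rule real_sqrt_le_mono)
  then show ?thesis
    using outer.\<delta>_pos by (simp only: T_eq real_sqrt_mult real_sqrt_divide) simp
qed

lemma outer_iterations_le:
  "2 * sqrt (D / (rho M * eps M)) + 4 + (1 / outer.\<delta> + 1 / 2) * ln W_outer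
    \<le> 300000 * (1 + T) * ln \<Lambda>"
proof -
  have "sqrt (D / (rho M * eps M)) \<le> T"
    unfolding T_eq using Rs_ge rho_eps_pos by (intro real_sqrt_le_mono divide_right_mono) auto
  moreover have "(1 / outer.\<delta> + 1 / 2) * ln W_outer \<le> (10000 * T + 1 / 2) * (26 * ln \<Lambda>)"
    using inv_\<delta>_le ln_W_outer_le W_outer_ge_1 outer.\<delta>_pos T_nonneg by (intro mult_mono) auto
  ultimately have "2 * sqrt (D / (rho M * eps M)) + 4 + (1 / outer.\<delta> + 1 / 2) * ln W_outer
      \<le> (2 * T + 4) * 1 + (10000 * T + 1 / 2) * (26 * ln \<Lambda>)" by simp
  also have "\<dots> \<le> (2 * T + 4) * ln \<Lambda> + (10000 * T + 1 / 2) * (26 * ln \<Lambda>)"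
    using ln_\<Lambda>_ge_1 T_nonneg by (intro add_right_mono mult_left_mono) auto
  also have "\<dots> = (17 + 260002 * T) * ln \<Lambda>" by (simp add: algebra_simps)
  also have "\<dots> \<le> (300000 * (1 + T)) * ln \<Lambda>"
    using ln_\<Lambda>_ge_1 T_nonneg by (intro mult_right_mono) auto
  finally show ?thesis by simp
qed

text \<open>The four terms of the bound are the expansion of a product whose factors measure the
  number of outer steps and the length of each inner run.\<close>

lemma complexity_eq: "complexity P M ls = (1 + T) * (1 + sqrt (D * Lf P / eps M))"
proof -
  have 1: "sqrt (D\<^sup>2 + D * Rs) * normA P / eps M = T * sqrt (D * Lf P / eps M)"
  proof -
    have "D\<^sup>2 + D * Rs = D * (D + Rs)" by (simp add: power2_eq_square algebra_simps)
    moreover have "sqrt (eps M) * sqrt (eps M) = eps M" using eps_pos by simp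
    moreover have "sqrt (Lf P) \<noteq> 0" using Lf_pos by simp
    ultimately show ?thesis
      by (simp add: T_def real_sqrt_mult real_sqrt_divide)
  qed
  have 2: "sqrt (D * Lf P) / sqrt (eps M) = sqrt (D * Lf P / eps M)"
    by (simp only: real_sqrt_divide)
  show ?thesis
    unfolding complexity_def 1 2 T_def[symmetric] by (simp add: algebra_simps del: real_sqrt_mult)
qed

text \<open>The constant is 300000 times 102, from the outer and the inner count; each level
  contributes one factor \<open>ln \<Lambda>\<close>. The algorithm stops at the first outer index
  passing the test, hence no later than the one found above.\<close>

lemma halting_and_complexity:
  "\<exists>k. ifalm_halts P M r k \<and>
     primal_dual_solution P (eps M) (xs r (Suc k)) (lams r (Suc k)) \<and>
     real (total_acg P M r k) \<le> 30600000 * complexity P M ls * log_factor P M ls ^ 2"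
proof -
  define Z where "Z = sqrt (D * Lf P / eps M)"
  obtain k0 where k0: "outer_stop P M r k0"
    "real (Suc k0) \<le> 2 * sqrt (D / (rho M * eps M)) + 4 + (1 / outer.\<delta> + 1 / 2) * ln W_outer"
    using outer_stop_exists by blast
  define k where "k = (LEAST k. outer_stop P M r k)"
  have k: "outer_stop P M r k" unfolding k_def using k0(1) by (rule LeastI)
  have "k \<le> k0" unfolding k_def using k0(1) by (rule Least_le)
  then have k_le: "real (Suc k) \<le> 300000 * (1 + T) * ln \<Lambda>"
    using k0(2) outer_iterations_le by simp
  have "\<not> outer_stop P M r i" if "i < k" for i
    using that not_less_Least unfolding k_def by blast
  then have halts: "ifalm_halts P M r k"
    using k acg_stops unfolding ifalm_halts_def by blast
  have Z: "0 \<le> Z" using D_pos Lf_pos eps_pos by (simp add: Z_def)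
  have "real (total_acg P M r k) = (\<Sum>i\<le>k. real (Suc (acg_last P M r i)))"
    by (simp add: total_acg_def)
  also have "\<dots> \<le> (\<Sum>i\<le>k. 102 * (1 + Z) * ln \<Lambda>)"
    unfolding Z_def by (intro sum_mono inner_iterations_le)
  also have "\<dots> = real (Suc k) * (102 * (1 + Z) * ln \<Lambda>)" by simp
  also have "\<dots> \<le> 300000 * (1 + T) * ln \<Lambda> * (102 * (1 + Z) * ln \<Lambda>)"
    using k_le Z ln_\<Lambda>_ge_1 by (intro mult_right_mono) auto
  also have "\<dots> = 30600000 * complexity P M ls * log_factor P M ls ^ 2"
    unfolding complexity_eq log_factor_eq Z_def[symmetric]
    by (simp add: power2_eq_square algebra_simps)
  finally show ?thesis using halts outer_stop_solution[OF k] by blast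
qed

end


theorem theorem3p4:
  shows "\<exists>K>0. \<exists>p::nat. \<forall>(P::problem) (M::params) (lt::fvec) (ls::fvec) (r::run).
    standing_assms P \<longrightarrow>
    ifalm_input P M \<longrightarrow>
    eps M \<le> (normA P)\<^sup>2 / Lf P \<longrightarrow>
    rho M = Lf P / (normA P)\<^sup>2 \<longrightarrow>
    eps0 M = 1 / rho M \<longrightarrow>
    sig M = 1 / 4 \<longrightarrow>
    gam_p M = eps M / (2 * diam P) \<longrightarrow>
    is_unique_maximizer (Ysp P) (dual_pert P M) lt \<longrightarrow>
    gam_d M = sig M powr (3/2) * eps M / (sqrt 3 * R_const M lt) \<longrightarrow>
    alpha M \<le> min (9/10 * (1 / (1 + sqrt (rho M * gam_d M))\<^sup>2))
                   ((15 * diam P * eps M / (28 * eps0 M)) powr sqrt (rho M * eps M / diam P)) \<longrightarrow>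
    is_arg_min (\<lambda>l. norm (l - linit M)) (\<lambda>l. l \<in> dual_solutions P) ls \<longrightarrow>
    ifalm_run P M r \<longrightarrow>
      summable (\<lambda>i. Bk M (Suc i) * alpha M ^ i) \<and>
      (\<exists>k. ifalm_halts P M r k \<and>
           primal_dual_solution P (eps M) (xs r (Suc k)) (lams r (Suc k)) \<and>
           real (total_acg P M r k) \<le> K * complexity P M ls * log_factor P M ls ^ p)"
proof (rule exI[of _ "30600000 :: real"], rule conjI, simp, rule exI[of _ "2 :: nat"],
    intro allI impI conjI)
  fix P M lt ls r
  assume "standing_assms P" "ifalm_input P M" "eps M \<le> (normA P)\<^sup>2 / Lf P"
    "rho M = Lf P / (normA P)\<^sup>2" "eps0 M = 1 / rho M" "sig M = 1 / 4"
    "is_unique_maximizer (Ysp P) (dual_pert P M) lt"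
    "gam_d M = sig M powr (3/2) * eps M / (sqrt 3 * R_const M lt)"
    "alpha M \<le> min (9/10 * (1 / (1 + sqrt (rho M * gam_d M))\<^sup>2))
       ((15 * diam P * eps M / (28 * eps0 M)) powr sqrt (rho M * eps M / diam P))"
    "is_arg_min (\<lambda>l. norm (l - linit M)) (\<lambda>l. l \<in> dual_solutions P) ls"
    "ifalm_run P M r"
  then interpret ifalm_parameters P M r lt ls
    by unfold_locales
  show "summable (\<lambda>i. Bk M (Suc i) * alpha M ^ i)"
    by (rule summable_C)
  show "\<exists>k. ifalm_halts P M r k \<and>
      primal_dual_solution P (eps M) (xs r (Suc k)) (lams r (Suc k)) \<and>
      real (total_acg P M r k) \<le> 30600000 * complexity P M ls * log_factor P M ls ^ 2"
    by (rule halting_and_complexity)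
qed

end
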